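(* Let $\Omega \subset \mathbb{R}^d$, $d \geq 2$, be a bounded domain with $\mathrm{C}^4$-boundary, $\theta \in (\pi / 2 , \pi)$, and $\alpha > 1 / 4$. Then for all $n \in \mathbb{N}$ there exist $f_n \in \mathrm{L}^2_{\sigma} (\Omega)$ and $\lambda_n \in \mathrm{S}_{\theta}$ with $\lvert \lambda_n \rvert \geq 1$ such that the pressure $\phi_n \in \mathrm{L}^2_0 (\Omega)$ associated to the Stokes resolvent problem with parameter $\lambda_n$ subject to homogeneous Dirichlet boundary conditions and right-hand side $f_n$ satisfies $$\lvert \lambda_n \rvert^{\alpha} \| \phi_n \|_{\mathrm{L}^2 (\Omega)} > n \| f_n \|_{\mathrm{L}^2_{\sigma} (\Omega)}.$$
   Context: Sector: $\mathrm{S}_{\theta} := \{ z \in \mathbb{C} \setminus \{0\} : \lvert \arg(z) \rvert < \theta \}$ for $\theta \in (0,\pi)$. Spaces: $\mathrm{C}_{c,\sigma}^\infty(\Omega) := \{\varphi \in \mathrm{C}_c^\infty(\Omega;\mathbb{C}^d): \operatorname{div}(\varphi)=0\}$; $\mathrm{L}^2_\sigma(\Omega)$ and $\mathrm{H}^1_{0,\sigma}(\Omega)$ are its closures in $\mathrm{L}^2(\Omega;\mathbb{C}^d)$ and $\mathrm{H}^1(\Omega;\mathbb{C}^d)$, respectively, with the natural norms; $\mathrm{L}^2_0(\Omega)$ is the space of $\mathrm{L}^2$-functions on $\Omega$ with mean value zero. Associated pressure: for $f \in \mathrm{L}^2_\sigma(\Omega)$ and $\lambda\in \mathrm{S}_\theta$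 there is a unique pair $u \in \mathrm{H}^1_{0,\sigma}(\Omega)$, $\phi\in \mathrm{L}^2_0(\Omega)$ such that $$\lambda\int_\Omega u\cdot\overline{v}\,dx + \int_\Omega \nabla u\cdot\overline{\nabla v}\,dx - \int_\Omega \phi\,\overline{\operatorname{div}(v)}\,dx = \int_\Omega f\cdot\overline{v}\,dx \qquad \text{for all } v\in \mathrm{H}^1_0(\Omega;\mathbb{C}^d),$$ i.e. the weak form of $\lambda u-\Delta u+\nabla\phi=f$, $\operatorname{div}(u)=0$ in $\Omega$, $u=0$ on $\partial\Omega$; $\phi$ is the pressure associated to the problem with right-hand side $f$. *)

theory Defs
  imports "HOL-Analysis.Analysis"
begin

section \<open>Classical derivatives and regularity of the boundary\<close>

definition dir_deriv :: "'a::euclidean_space \<Rightarrow> ('a \<Rightarrow> 'b::real_normed_vector) \<Rightarrow> 'a \<Rightarrow> 'b" where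
  "dir_deriv b f x = frechet_derivative f (at x) b"

text \<open>Meant for open \<open>U\<close>.\<close>

primrec Ck_on :: "nat \<Rightarrow> 'a::euclidean_space set \<Rightarrow> ('a \<Rightarrow> 'b::real_normed_vector) \<Rightarrow> bool" where
  "Ck_on 0 U f \<longleftrightarrow> continuous_on U f"
| "Ck_on (Suc k) U f \<longleftrightarrow>
     (\<forall>x\<in>U. f differentiable (at x)) \<and> (\<forall>b\<in>Basis. Ck_on k U (dir_deriv b f))"

definition domain :: "'a::euclidean_space set \<Rightarrow> bool" where
  "domain \<Omega> \<longleftrightarrow> open \<Omega> \<and> connected \<Omega> \<and> \<Omega> \<noteq> {}"

text \<open>Near every boundary point, \<open>\<Omega>\<close> is the region above the graph of a \<open>C\<^sup>k\<close> function in
  suitable Cartesian coordinates. The last coordinate direction is the unit vector \<open>\<nu>\<close>; a function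
  of the remaining \<open>d - 1\<close> coordinates is encoded as a function \<open>\<gamma>\<close> on the whole space that is
  constant along \<open>\<nu>\<close>.\<close>

definition Ck_boundary :: "nat \<Rightarrow> 'a::euclidean_space set \<Rightarrow> bool" where
  "Ck_boundary k \<Omega> \<longleftrightarrow>
     (\<forall>x\<^sub>0\<in>frontier \<Omega>. \<exists>r>0. \<exists>\<nu>. \<exists>\<gamma>::'a \<Rightarrow> real.
        norm \<nu> = 1 \<and> Ck_on k UNIV \<gamma> \<and> (\<forall>x t. \<gamma> (x + t *\<^sub>R \<nu>) = \<gamma> x) \<and>
        \<Omega> \<inter> ball x\<^sub>0 r = {x \<in> ball x\<^sub>0 r. \<gamma> x < x \<bullet> \<nu>})"

definition sector :: "real \<Rightarrow> complex set" where
  "sector \<theta> = {z. z \<noteq> 0 \<and> \<bar>Arg z\<bar> < \<theta>}"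


section \<open>Function spaces\<close>

text \<open>Elements of the spaces below are functions on the whole space of which only the values on
  \<open>\<Omega>\<close> matter, and they are not identified when they agree almost everywhere. Accordingly the norms
  are seminorms, and the closures are taken with respect to them.\<close>

definition test_functions :: "'a::euclidean_space set \<Rightarrow> ('a \<Rightarrow> 'b::real_normed_vector) set" where
  "test_functions \<Omega> =
     {\<phi>. (\<forall>k. Ck_on k UNIV \<phi>) \<and> compact (closure {x. \<phi> x \<noteq> 0}) \<and> closure {x. \<phi> x \<noteq> 0} \<subseteq> \<Omega>}"

definition divergence :: "(real^'n \<Rightarrow> complex^'n) \<Rightarrow> real^'n \<Rightarrow> complex" where
  "divergence \<phi> x = (\<Sum>i\<in>UNIV. dir_deriv (axis i 1) \<phi> x $ i)"

definition solenoidal_test_functions :: "(real^'n) set \<Rightarrow> (real^'n \<Rightarrow> complex^'n) set" where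
  "solenoidal_test_functions \<Omega> = {\<phi> \<in> test_functions \<Omega>. \<forall>x. divergence \<phi> x = 0}"

definition L2 :: "'a::euclidean_space set \<Rightarrow> ('a \<Rightarrow> 'b::euclidean_space) set" where
  "L2 \<Omega> = {f \<in> borel_measurable (lebesgue_on \<Omega>). integrable (lebesgue_on \<Omega>) (\<lambda>x. (norm (f x))\<^sup>2)}"

definition L2_norm :: "'a::euclidean_space set \<Rightarrow> ('a \<Rightarrow> 'b::euclidean_space) \<Rightarrow> real" where
  "L2_norm \<Omega> f = sqrt (integral\<^sup>L (lebesgue_on \<Omega>) (\<lambda>x. (norm (f x))\<^sup>2))"

definition L2_zero :: "'a::euclidean_space set \<Rightarrow> ('a \<Rightarrow> complex) set" where
  "L2_zero \<Omega> = {p \<in> L2 \<Omega>. integral\<^sup>L (lebesgue_on \<Omega>) p = 0}"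

definition L2_sigma :: "(real^'n) set \<Rightarrow> (real^'n \<Rightarrow> complex^'n) set" where
  "L2_sigma \<Omega> =
     {f \<in> L2 \<Omega>. \<forall>\<epsilon>>0. \<exists>\<phi>\<in>solenoidal_test_functions \<Omega>. L2_norm \<Omega> (\<lambda>x. f x - \<phi> x) < \<epsilon>}"

text \<open>The gradient is stored as \<open>G x $ i $ j = \<partial>\<^sub>i u\<^sub>j (x)\<close>; the norm on \<open>complex^'n^'n\<close> is then the
  Euclidean (Frobenius) norm.\<close>

definition has_weak_grad ::
    "(real^'n) set \<Rightarrow> (real^'n \<Rightarrow> complex^'n) \<Rightarrow> (real^'n \<Rightarrow> complex^'n^'n) \<Rightarrow> bool" where
  "has_weak_grad \<Omega> u G \<longleftrightarrow> G \<in> L2 \<Omega> \<and>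
     (\<forall>\<psi>\<in>(test_functions \<Omega> :: (real^'n \<Rightarrow> real) set). \<forall>i.
        integral\<^sup>L (lebesgue_on \<Omega>) (\<lambda>x. dir_deriv (axis i 1) \<psi> x *\<^sub>R u x) =
        - integral\<^sup>L (lebesgue_on \<Omega>) (\<lambda>x. \<psi> x *\<^sub>R (G x $ i)))"

definition weak_grad :: "(real^'n) set \<Rightarrow> (real^'n \<Rightarrow> complex^'n) \<Rightarrow> (real^'n \<Rightarrow> complex^'n^'n)" where
  "weak_grad \<Omega> u = (SOME G. has_weak_grad \<Omega> u G)"

definition H1 :: "(real^'n) set \<Rightarrow> (real^'n \<Rightarrow> complex^'n) set" where
  "H1 \<Omega> = {u \<in> L2 \<Omega>. \<exists>G. has_weak_grad \<Omega> u G}"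

definition H1_norm :: "(real^'n) set \<Rightarrow> (real^'n \<Rightarrow> complex^'n) \<Rightarrow> real" where
  "H1_norm \<Omega> u = sqrt ((L2_norm \<Omega> u)\<^sup>2 + (L2_norm \<Omega> (weak_grad \<Omega> u))\<^sup>2)"

definition H1_0 :: "(real^'n) set \<Rightarrow> (real^'n \<Rightarrow> complex^'n) set" where
  "H1_0 \<Omega> = {u \<in> H1 \<Omega>. \<forall>\<epsilon>>0. \<exists>\<phi>\<in>test_functions \<Omega>. H1_norm \<Omega> (\<lambda>x. u x - \<phi> x) < \<epsilon>}"

definition H1_0_sigma :: "(real^'n) set \<Rightarrow> (real^'n \<Rightarrow> complex^'n) set" where
  "H1_0_sigma \<Omega> =
     {u \<in> H1 \<Omega>. \<forall>\<epsilon>>0. \<exists>\<phi>\<in>solenoidal_test_functions \<Omega>. H1_norm \<Omega> (\<lambda>x. u x - \<phi> x) < \<epsilon>}"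


section \<open>The Stokes resolvent problem\<close>

definition weak_div :: "(real^'n) set \<Rightarrow> (real^'n \<Rightarrow> complex^'n) \<Rightarrow> real^'n \<Rightarrow> complex" where
  "weak_div \<Omega> v x = (\<Sum>i\<in>UNIV. weak_grad \<Omega> v x $ i $ i)"

definition stokes_resolvent_solution ::
    "(real^'n) set \<Rightarrow> complex \<Rightarrow> (real^'n \<Rightarrow> complex^'n) \<Rightarrow>
      (real^'n \<Rightarrow> complex^'n) \<Rightarrow> (real^'n \<Rightarrow> complex) \<Rightarrow> bool" where
  "stokes_resolvent_solution \<Omega> lam f u p \<longleftrightarrow>
     u \<in> H1_0_sigma \<Omega> \<and> p \<in> L2_zero \<Omega> \<and>
     (\<forall>v\<in>H1_0 \<Omega>.
        lam * integral\<^sup>L (lebesgue_on \<Omega>) (\<lambda>x. \<Sum>j\<in>UNIV. u x $ j * cnj (v x $ j))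
        + integral\<^sup>L (lebesgue_on \<Omega>)
            (\<lambda>x. \<Sum>i\<in>UNIV. \<Sum>j\<in>UNIV. weak_grad \<Omega> u x $ i $ j * cnj (weak_grad \<Omega> v x $ i $ j))
        - integral\<^sup>L (lebesgue_on \<Omega>) (\<lambda>x. p x * cnj (weak_div \<Omega> v x))
        = integral\<^sup>L (lebesgue_on \<Omega>) (\<lambda>x. \<Sum>j\<in>UNIV. f x $ j * cnj (v x $ j)))"

definition associated_pressure ::
    "(real^'n) set \<Rightarrow> complex \<Rightarrow> (real^'n \<Rightarrow> complex^'n) \<Rightarrow> (real^'n \<Rightarrow> complex) \<Rightarrow> bool" where
  "associated_pressure \<Omega> lam f p \<longleftrightarrow> (\<exists>u. stokes_resolvent_solution \<Omega> lam f u p)"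

end

theory Submission
  imports Defs
begin

text \<open>The pressure is the fixed linear function \<open>x\<^sub>1 - m\<close>, and only the velocity depends on \<open>\<lambda>\<close>. Put
  \<open>e = \<lambda> powr (-1/2)\<close> and \<open>\<nabla>\<^sup>\<bottom>a = (\<partial>\<^sub>2a, -\<partial>\<^sub>1a, 0, \<dots>)\<close>. Because \<open>\<nabla>x\<^sub>1 = \<nabla>\<^sup>\<bottom>x\<^sub>2\<close>, the velocity
  \<open>u = \<nabla>\<^sup>\<bottom>a\<close> belongs to the right-hand side \<open>f = \<nabla>\<^sup>\<bottom>c\<close> with \<open>c = \<lambda>a - \<Delta>a + x\<^sub>2\<close>. If \<open>a\<close>, \<open>\<nabla>a\<close> and \<open>\<Delta>a - x\<^sub>2\<close>
  vanish on \<open>\<partial>\<Omega>\<close>, then so does \<open>c\<close>; cutting off and mollifying \<open>a\<close> and \<open>c\<close> shows \<open>u \<in> H\<^sup>1\<^sub>0\<^sub>,\<^sub>\<sigma>\<close> and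
  \<open>f \<in> L\<^sup>2\<^sub>\<sigma>\<close>. Such an \<open>a\<close> is a sum over boundary charts of layers \<open>e\<^sup>2 w g(s / e)\<close>, where \<open>s\<close> is a \<open>C\<^sup>4\<close>
  defining function of the boundary and \<open>g(t) = t\<^sup>2/2 + O(t\<^sup>4)\<close>. Then \<open>f\<close> is of size \<open>1/e\<close> on a layer of
  width \<open>e\<close> and bounded elsewhere, so its \<open>L\<^sup>2\<close> norm is \<open>O(e powr (-1/2)) = O(\<lambda> powr (1/4))\<close>, while the norm
  of the pressure is a positive constant.\<close>

section \<open>Calculus of directional derivatives\<close>

text \<open>The gradient of x_1 is smooth and divergence free; what keeps it from being an
  admissible right-hand side is its normal component on the boundary, where x_2 is not constant. The
  layers remove exactly this: the boundary values of \<Delta>a cancel x_2. The width e makes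
  \<lambda>a and \<Delta>a of the same order, so neither term spoils the bound.

  Two obstacles shape the construction. All functions have to be differentiable on the whole space,
  across the boundary, so the layers use globally defined graph functions instead of the distance to
  the boundary, and an even rational profile instead of a decaying exponential. Its derivatives
  decay only like 1/(1 + t^2), but this is the derivative of arctan, so the layer width is measured
  by one integration by parts, with no change of variables. Secondly, the solution operator must
  exchange third derivatives of a merely C^3 function; symmetry of mixed derivatives is checked on
  one explicit bump function and carried over by mollification. The same mollifiers supply cutoffs,
  test functions and the closure arguments.\<close>

abbreviation Ck :: "nat \<Rightarrow> ('a::euclidean_space \<Rightarrow> 'b::real_normed_vector) \<Rightarrow> bool" where
  "Ck k f \<equiv> Ck_on k UNIV f"

text \<open>A radius instead of a compact closure: the notion suits discontinuous functions such as
  indicators as well, and passes at once to products and derivatives.\<close>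

definition bdd_supp :: "('a::real_normed_vector \<Rightarrow> 'b::zero) \<Rightarrow> bool" where
  "bdd_supp f \<longleftrightarrow> (\<exists>R. \<forall>x. R < norm x \<longrightarrow> f x = 0)"

lemma dir_deriv_eqI: "(f has_derivative f') (at x) \<Longrightarrow> dir_deriv b f x = f' b"
  unfolding dir_deriv_def by (metis frechet_derivative_at)

lemma has_derivative_dir_deriv:
  "f differentiable (at x) \<Longrightarrow> (f has_derivative (\<lambda>v. dir_deriv v f x)) (at x)"
  unfolding dir_deriv_def by (simp add: frechet_derivative_works)

lemma dir_deriv_basis:
  assumes "f differentiable (at x)"
  shows "dir_deriv v f x = (\<Sum>b\<in>Basis. (v \<bullet> b) *\<^sub>R dir_deriv b f x)"
proof -
  interpret bounded_linear "\<lambda>v. dir_deriv v f x"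
    using has_derivative_dir_deriv[OF assms] by (rule has_derivative_bounded_linear)
  have "dir_deriv v f x = dir_deriv (\<Sum>b\<in>Basis. (v \<bullet> b) *\<^sub>R b) f x"
    by (simp add: euclidean_representation)
  then show ?thesis by (simp add: sum scaleR)
qed

text \<open>Also holds where neither function is differentiable: \<open>frechet_derivative\<close>
  chooses from the set of derivatives, and that set depends only on the germ at
  \<open>x\<close>.\<close>

lemma dir_deriv_cong_open:
  assumes "open S" "x \<in> S" "\<And>y. y \<in> S \<Longrightarrow> f y = g y"
  shows "dir_deriv b f x = dir_deriv b g x"
proof -
  have "(f has_derivative D) (at x) \<longleftrightarrow> (g has_derivative D) (at x)" for D
    using assms has_derivative_transform_within_open[of f D x UNIV S g]
      has_derivative_transform_within_open[of g D x UNIV S f] by fastforce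
  then show ?thesis by (simp add: dir_deriv_def frechet_derivative_def)
qed

lemma dir_deriv_const [simp]: "dir_deriv b (\<lambda>x. c) = (\<lambda>x. 0)"
  by (rule ext) (simp add: dir_deriv_def)

lemma dir_deriv_add:
  "f differentiable (at x) \<Longrightarrow> g differentiable (at x) \<Longrightarrow>
    dir_deriv b (\<lambda>x. f x + g x) x = dir_deriv b f x + dir_deriv b g x"
  by (rule dir_deriv_eqI) (auto intro!: derivative_eq_intros has_derivative_dir_deriv)

lemma dir_deriv_diff:
  "f differentiable (at x) \<Longrightarrow> g differentiable (at x) \<Longrightarrow>
    dir_deriv b (\<lambda>x. f x - g x) x = dir_deriv b f x - dir_deriv b g x"
  by (rule dir_deriv_eqI) (auto intro!: derivative_eq_intros has_derivative_dir_deriv)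

lemma dir_deriv_scaleR:
  "f differentiable (at x) \<Longrightarrow> g differentiable (at x) \<Longrightarrow>
    dir_deriv b (\<lambda>x. f x *\<^sub>R g x) x = f x *\<^sub>R dir_deriv b g x + dir_deriv b f x *\<^sub>R g x"
  by (rule dir_deriv_eqI) (auto intro!: derivative_eq_intros has_derivative_dir_deriv)

lemma dir_deriv_mult:
  fixes f g :: "'a::euclidean_space \<Rightarrow> real"
  shows "f differentiable (at x) \<Longrightarrow> g differentiable (at x) \<Longrightarrow>
    dir_deriv b (\<lambda>x. f x * g x) x = f x * dir_deriv b g x + dir_deriv b f x * g x"
  using dir_deriv_scaleR[of f x g b] by simp

lemma dir_deriv_cmult:
  fixes f :: "'a::euclidean_space \<Rightarrow> real"
  shows "f differentiable (at x) \<Longrightarrow> dir_deriv b (\<lambda>x. c * f x) x = c * dir_deriv b f x"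
  by (rule dir_deriv_eqI) (auto intro!: derivative_eq_intros has_derivative_dir_deriv)

lemma dir_deriv_sum:
  assumes "\<And>i. i \<in> I \<Longrightarrow> f i differentiable (at x)"
  shows "dir_deriv b (\<lambda>x. \<Sum>i\<in>I. f i x) x = (\<Sum>i\<in>I. dir_deriv b (f i) x)"
  by (rule dir_deriv_eqI) (auto intro!: derivative_eq_intros has_derivative_dir_deriv assms)

lemma dir_deriv_bounded_linear:
  assumes "bounded_linear L" "f differentiable (at x)"
  shows "dir_deriv b (\<lambda>x. L (f x)) x = L (dir_deriv b f x)"
  by (rule dir_deriv_eqI)
    (rule bounded_linear.has_derivative[OF assms(1) has_derivative_dir_deriv[OF assms(2)]])

lemma dir_deriv_linear: "bounded_linear L \<Longrightarrow> dir_deriv b L x = L b"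
  by (rule dir_deriv_eqI) (rule bounded_linear_imp_has_derivative)

lemma dir_deriv_chain_real:
  fixes g :: "real \<Rightarrow> real"
  assumes "(g has_real_derivative g') (at (f x))" "f differentiable (at x)"
  shows "dir_deriv b (\<lambda>x. g (f x)) x = g' * dir_deriv b f x"
proof (rule dir_deriv_eqI)
  have "((g \<circ> f) has_derivative ((\<lambda>h. g' * h) \<circ> (\<lambda>v. dir_deriv v f x))) (at x)"
    using assms by (intro diff_chain_at has_derivative_dir_deriv)
      (auto simp: has_field_derivative_def)
  then show "((\<lambda>x. g (f x)) has_derivative (\<lambda>v. g' * dir_deriv v f x)) (at x)"
    by (simp add: o_def)
qed

lemma differentiable_chain_real:
  fixes g :: "real \<Rightarrow> real"
  assumes "(g has_real_derivative g') (at (f x))" "f differentiable (at x)"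
  shows "(\<lambda>x. g (f x)) differentiable (at x)"
  using assms by (metis differentiable_compose differentiable_def has_field_derivative_def o_def)

lemma has_derivative_affine:
  assumes "f differentiable (at (c *\<^sub>R x + a))"
  shows "((\<lambda>x. f (c *\<^sub>R x + a)) has_derivative (\<lambda>v. c *\<^sub>R dir_deriv v f (c *\<^sub>R x + a))) (at x)"
proof -
  have "((f \<circ> (\<lambda>x. c *\<^sub>R x + a)) has_derivative
      ((\<lambda>v. dir_deriv v f (c *\<^sub>R x + a)) \<circ> (\<lambda>v. c *\<^sub>R v))) (at x)"
    using assms by (intro diff_chain_at has_derivative_dir_deriv) (auto intro!: derivative_eq_intros)
  moreover have "dir_deriv (c *\<^sub>R v) f (c *\<^sub>R x + a) = c *\<^sub>R dir_deriv v f (c *\<^sub>R x + a)" for v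
  proof -
    interpret bounded_linear "\<lambda>v. dir_deriv v f (c *\<^sub>R x + a)"
      using has_derivative_dir_deriv[OF assms] by (rule has_derivative_bounded_linear)
    show ?thesis by (rule scaleR)
  qed
  ultimately show ?thesis by (simp add: o_def)
qed

lemma dir_deriv_affine:
  "f differentiable (at (c *\<^sub>R x + a)) \<Longrightarrow>
    dir_deriv b (\<lambda>x. f (c *\<^sub>R x + a)) x = c *\<^sub>R dir_deriv b f (c *\<^sub>R x + a)"
  by (rule dir_deriv_eqI) (rule has_derivative_affine)

section \<open>Closure properties of the classes C^k\<close>

lemma Ck_SucD: "Ck (Suc k) f \<Longrightarrow> f differentiable (at x)" "Ck (Suc k) f \<Longrightarrow> b \<in> Basis \<Longrightarrow> Ck k (dir_deriv b f)"
  by simp_all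

lemma Ck_Suc_le: "Ck (Suc k) f \<Longrightarrow> Ck k f"
proof (induction k arbitrary: f)
  case 0
  then show ?case
    by (auto intro!: differentiable_imp_continuous_on differentiable_at_imp_differentiable_on)
next
  case (Suc k)
  then show ?case by (metis Ck_on.simps(2))
qed

lemma Ck_mono: "Ck m f \<Longrightarrow> k \<le> m \<Longrightarrow> Ck k f"
  by (induction m rule: nat_induct) (auto simp: le_Suc_eq simp del: Ck_on.simps(2) dest: Ck_Suc_le)

lemma Ck_continuous: "Ck k f \<Longrightarrow> continuous_on S f"
  using Ck_mono[of k f 0] continuous_on_subset[of UNIV f S] by simp

lemma Ck_differentiable: "Ck k f \<Longrightarrow> 1 \<le> k \<Longrightarrow> f differentiable (at x)"
  by (metis Ck_SucD(1) One_nat_def Suc_le_D)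

lemma Ck_const [simp]: "Ck k (\<lambda>x. c)"
  by (induction k arbitrary: c) auto

lemma Ck_add: "Ck k f \<Longrightarrow> Ck k g \<Longrightarrow> Ck k (\<lambda>x. f x + g x)"
proof (induction k arbitrary: f g)
  case (Suc k)
  then have "dir_deriv b (\<lambda>x. f x + g x) = (\<lambda>x. dir_deriv b f x + dir_deriv b g x)" for b
    by (intro ext dir_deriv_add) auto
  with Suc show ?case by simp
qed (auto intro: continuous_intros)

lemma Ck_scaleR:
  fixes f :: "'a::euclidean_space \<Rightarrow> real"
  shows "Ck k f \<Longrightarrow> Ck k g \<Longrightarrow> Ck k (\<lambda>x. f x *\<^sub>R g x)"
proof (induction k arbitrary: f g)
  case (Suc k)
  then have D: "dir_deriv b (\<lambda>x. f x *\<^sub>R g x) = (\<lambda>x. f x *\<^sub>R dir_deriv b g x + dir_deriv b f x *\<^sub>R g x)" for b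
    by (intro ext dir_deriv_scaleR) auto
  have "Ck k f" "Ck k g" using Suc.prems Ck_Suc_le by blast+
  then show ?case using Suc by (simp add: D Ck_add)
qed (auto intro: continuous_intros)

lemma Ck_mult:
  fixes f g :: "'a::euclidean_space \<Rightarrow> real"
  shows "Ck k f \<Longrightarrow> Ck k g \<Longrightarrow> Ck k (\<lambda>x. f x * g x)"
  using Ck_scaleR[of k f g] by simp

lemma Ck_bounded_linear:
  "bounded_linear L \<Longrightarrow> Ck k f \<Longrightarrow> Ck k (\<lambda>x. L (f x))"
proof (induction k arbitrary: f)
  case 0
  then show ?case by (auto intro: continuous_on_compose2[OF linear_continuous_on[of L UNIV]])
next
  case (Suc k)
  then have "dir_deriv b (\<lambda>x. L (f x)) = (\<lambda>x. L (dir_deriv b f x))" for b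
    by (intro ext dir_deriv_bounded_linear) auto
  moreover have "(\<lambda>x. L (f x)) differentiable (at x)" for x
    using bounded_linear.has_derivative[OF Suc.prems(1) has_derivative_dir_deriv[of f x]] Suc.prems(2)
    by (metis Ck_on.simps(2) UNIV_I differentiable_def)
  ultimately show ?case using Suc by simp
qed

lemma Ck_cmult:
  fixes f :: "'a::euclidean_space \<Rightarrow> real"
  shows "Ck k f \<Longrightarrow> Ck k (\<lambda>x. c * f x)"
  by (rule Ck_mult) auto

lemma Ck_minus: "Ck k f \<Longrightarrow> Ck k (\<lambda>x. - f x)"
  by (rule Ck_bounded_linear) (auto intro: bounded_linear_minus bounded_linear_ident)

lemma Ck_diff: "Ck k f \<Longrightarrow> Ck k g \<Longrightarrow> Ck k (\<lambda>x. f x - g x)"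
  using Ck_add[of k f "\<lambda>x. - g x"] Ck_minus[of k g] by simp

lemma Ck_sum: "(\<And>i. i \<in> I \<Longrightarrow> Ck k (f i)) \<Longrightarrow> Ck k (\<lambda>x. \<Sum>i\<in>I. f i x)"
  by (induction I rule: infinite_finite_induct) (auto intro: Ck_add)

lemma Ck_linear: "bounded_linear L \<Longrightarrow> Ck k L"
proof (cases k)
  case 0 then show "bounded_linear L \<Longrightarrow> ?thesis" by (simp add: linear_continuous_on)
next
  case (Suc m)
  assume L: "bounded_linear L"
  have "dir_deriv b L = (\<lambda>x. L b)" for b using dir_deriv_linear[OF L] by auto
  then show ?thesis using L Suc by (auto intro: bounded_linear_imp_differentiable)
qed

text \<open>The derivative of 1/f is again built from 1/f and derivatives of f, so products carry
  the induction. With rational profiles this takes the place of a general chain rule for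
  \<open>Ck\<close>.\<close>

lemma Ck_inverse:
  fixes f :: "'a::euclidean_space \<Rightarrow> real"
  shows "Ck k f \<Longrightarrow> (\<And>x. f x \<noteq> 0) \<Longrightarrow> Ck k (\<lambda>x. inverse (f x))"
proof (induction k arbitrary: f)
  case 0 then show ?case by (auto intro: continuous_intros)
next
  case (Suc k)
  have der: "((\<lambda>t. inverse t) has_real_derivative - (inverse (f x) * inverse (f x))) (at (f x))" for x
    using Suc.prems(2) by (auto intro!: derivative_eq_intros)
  have D: "dir_deriv b (\<lambda>x. inverse (f x)) = (\<lambda>x. - (inverse (f x) * inverse (f x)) * dir_deriv b f x)" for b
    by (intro ext dir_deriv_chain_real[where g=inverse] der) (use Suc.prems(1) in auto)
  have "Ck k (\<lambda>x. inverse (f x))" using Suc Ck_Suc_le by blast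
  then have "Ck k (\<lambda>x. - (inverse (f x) * inverse (f x)) * dir_deriv b f x)" if "b \<in> Basis" for b
    using Suc.prems that by (intro Ck_mult Ck_minus) auto
  moreover have "(\<lambda>x. inverse (f x)) differentiable (at x)" for x
    using differentiable_chain_real[where g=inverse and f=f and x=x, OF der] Suc.prems(1) by auto
  ultimately show ?case by (simp add: D)
qed

lemma Ck_affine: "Ck k f \<Longrightarrow> Ck k (\<lambda>x. f (c *\<^sub>R x + a))"
proof (induction k arbitrary: f)
  case 0 then show ?case
    by (auto intro!: continuous_on_compose2[of UNIV f] continuous_intros)
next
  case (Suc k)
  have "dir_deriv b (\<lambda>x. f (c *\<^sub>R x + a)) = (\<lambda>x. c *\<^sub>R dir_deriv b f (c *\<^sub>R x + a))" for b
    using Suc.prems by (intro ext dir_deriv_affine) auto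
  moreover have "Ck k (\<lambda>x. c *\<^sub>R dir_deriv b f (c *\<^sub>R x + a))" if "b \<in> Basis" for b
    using Suc that by (intro Ck_scaleR) auto
  moreover have "(\<lambda>x. f (c *\<^sub>R x + a)) differentiable (at x)" for x
    using has_derivative_affine[of f c x a] Suc.prems by (auto simp: differentiable_def)
  ultimately show ?case by simp
qed

section \<open>Functions of bounded support\<close>

lemma bdd_supp_dir_deriv:
  fixes f :: "'a::euclidean_space \<Rightarrow> 'b::real_normed_vector"
  shows "bdd_supp f \<Longrightarrow> bdd_supp (dir_deriv b f)"
  unfolding bdd_supp_def
proof (elim exE, intro exI allI impI)
  fix R and x :: 'a assume f: "\<forall>x. R < norm x \<longrightarrow> f x = 0" and x: "R < norm x"
  have "dir_deriv b f x = dir_deriv b (\<lambda>x. 0) x"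
    using f x by (intro dir_deriv_cong_open[of "{x. R < norm x}"]) (auto intro!: open_Collect_less continuous_intros)
  then show "dir_deriv b f x = 0" by simp
qed

lemma bdd_supp_bounded:
  fixes f :: "'a::euclidean_space \<Rightarrow> 'b::real_normed_vector"
  assumes "bdd_supp f" "continuous_on UNIV f"
  obtains M where "\<And>x. norm (f x) \<le> M"
proof -
  obtain R where R: "\<And>x. R < norm x \<Longrightarrow> f x = 0" using assms by (auto simp: bdd_supp_def)
  have "bounded (f ` cball 0 R)"
    using assms continuous_on_subset by (intro compact_imp_bounded compact_continuous_image) auto
  then obtain M where M: "M > 0" "\<And>x. x \<in> cball 0 R \<Longrightarrow> norm (f x) \<le> M" by (auto simp: bounded_pos)
  show ?thesis
  proof
    fix x show "norm (f x) \<le> M" using R[of x] M(1) M(2)[of x] by (cases "R < norm x") auto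
  qed
qed

lemma bdd_supp_uniformly_continuous:
  fixes f :: "'a::euclidean_space \<Rightarrow> 'b::real_normed_vector"
  assumes "bdd_supp f" "continuous_on UNIV f" "e > 0"
  obtains d where "d > 0" "\<And>x y. norm (x - y) < d \<Longrightarrow> norm (f x - f y) < e"
proof -
  obtain R where R: "\<And>x. R < norm x \<Longrightarrow> f x = 0" using assms by (auto simp: bdd_supp_def)
  have "uniformly_continuous_on (cball 0 (R+1)) f"
    using assms continuous_on_subset by (intro compact_uniformly_continuous) auto
  then obtain d where d: "d > 0"
    "\<And>x y. x \<in> cball 0 (R+1) \<Longrightarrow> y \<in> cball 0 (R+1) \<Longrightarrow> dist y x < d \<Longrightarrow> dist (f y) (f x) < e"
    using \<open>e > 0\<close> unfolding uniformly_continuous_on_def by blast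
  show ?thesis
  proof
    \<comment> \<open>The cap 1 covers the case that one point leaves the ball of radius
      \<open>R + 1\<close>: the other is then still outside radius \<open>R\<close>, and both values
      are 0.\<close>
    show "min d 1 > 0" using d by simp
    fix x y :: 'a assume xy: "norm (x - y) < min d 1"
    show "norm (f x - f y) < e"
    proof (cases "norm x \<le> R + 1 \<and> norm y \<le> R + 1")
      case True then show ?thesis using d(2)[of y x] xy by (auto simp: dist_norm)
    next
      case False
      have "norm x \<le> norm y + norm (x - y)" "norm y \<le> norm x + norm (x - y)"
        by norm+
      then have "R < norm x" "R < norm y" using False xy by auto
      then show ?thesis using R \<open>e > 0\<close> by simp
    qed
  qed
qed

section \<open>A smooth bump function\<close>

text \<open>Carrying the power \<open>n\<close> along makes the family closed under differentiation
  up to linear combinations, which is what the induction for smoothness needs.\<close>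

definition exp_flat :: "nat \<Rightarrow> real \<Rightarrow> real" where
  "exp_flat n t = (if t > 0 then (1/t)^n * exp (- (1/t)) else 0)"

text \<open>This is the difference quotient of \<open>exp_flat n\<close> at 0. From the right, u =
  1/t turns it into u^(n+1) / exp u.\<close>

lemma exp_flat_div_tendsto: "((\<lambda>t. exp_flat n t / t) \<longlongrightarrow> 0) (at 0)"
proof -
  have "((\<lambda>u. u^(Suc n) / exp u) \<longlongrightarrow> (0::real)) at_top"
    by (rule tendsto_power_div_exp_0)
  then have "((\<lambda>t. (inverse t)^(Suc n) / exp (inverse t)) \<longlongrightarrow> (0::real)) (at_right 0)"
    by (rule filterlim_compose) (rule filterlim_inverse_at_top_right)
  then have R: "((\<lambda>t. exp_flat n t / t) \<longlongrightarrow> 0) (at_right 0)"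
    by (rule Lim_transform_eventually)
      (auto simp: eventually_at_filter exp_flat_def exp_minus field_simps)
  have L: "((\<lambda>t. exp_flat n t / t) \<longlongrightarrow> 0) (at_left 0)"
    by (rule Lim_transform_eventually[where f="\<lambda>_. 0"])
      (auto simp: eventually_at_filter exp_flat_def)
  show ?thesis using filterlim_split_at[OF L R] .
qed

lemma exp_flat_deriv:
  "(exp_flat n has_real_derivative exp_flat (n+2) t - real n * exp_flat (n+1) t) (at t)"
proof (cases "t > 0")
  case True
  have "((\<lambda>t. (1/t)^n * exp (- (1/t))) has_real_derivative exp_flat (n+2) t - real n * exp_flat (n+1) t) (at t)"
  proof -
    have "((\<lambda>t. (1/t)^n) has_real_derivative - real n * (1/t)^(n+1)) (at t)"
    proof -
      have "((\<lambda>t. 1/t) has_real_derivative - ((1/t)^2)) (at t)"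
        using True by (auto intro!: derivative_eq_intros simp: power2_eq_square)
      note DERIV_power[OF this, of n]
      moreover have "real n * (- ((1/t)^2) * (1/t)^(n - Suc 0)) = - real n * (1/t)^(n+1)"
        by (cases n) (auto simp: power2_eq_square algebra_simps add_divide_distrib diff_divide_distrib)
      ultimately show ?thesis by (simp only:)
    qed
    moreover have "((\<lambda>t. exp (- (1/t))) has_real_derivative (1/t)^2 * exp (- (1/t))) (at t)"
      using True by (auto intro!: derivative_eq_intros simp: field_simps power2_eq_square)
    ultimately have "((\<lambda>t. (1/t)^n * exp (- (1/t))) has_real_derivative
        - real n * (1/t)^(n+1) * exp (- (1/t)) + (1/t)^2 * exp (- (1/t)) * (1/t)^n) (at t)"
      by (rule DERIV_mult)
    then show ?thesis using True
      by (simp add: exp_flat_def power_add power2_eq_square algebra_simps)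
  qed
  then show ?thesis
    by (rule has_field_derivative_transform_within_open[where S="{0<..}"]) (auto simp: True exp_flat_def)
next
  case False
  show ?thesis
  proof (cases "t = 0")
    case True
    have "((\<lambda>h. (exp_flat n (0 + h) - exp_flat n 0) / h) \<longlongrightarrow> 0) (at 0)"
      using exp_flat_div_tendsto[of n] by (simp add: exp_flat_def)
    then show ?thesis by (simp add: True DERIV_def exp_flat_def)
  next
    case F: False
    have "((\<lambda>t. 0) has_real_derivative exp_flat (n+2) t - real n * exp_flat (n+1) t) (at t)"
      using F False by (auto simp: exp_flat_def)
    then show ?thesis
      by (rule has_field_derivative_transform_within_open[where S="{..<0}"]) (use F False in \<open>auto simp: exp_flat_def\<close>)
  qed
qed

lemma Ck_one_minus_norm: "Ck k (\<lambda>x::'a::euclidean_space. 1 - x \<bullet> x)"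
proof -
  have "Ck k (\<lambda>x::'a. \<Sum>b\<in>Basis. (x \<bullet> b) * (x \<bullet> b))"
    by (intro Ck_sum Ck_mult Ck_linear bounded_linear_inner_left)
  then show ?thesis by (intro Ck_diff Ck_const) (simp flip: euclidean_inner)
qed

lemma dir_deriv_one_minus_norm:
  "dir_deriv b (\<lambda>x::'a::euclidean_space. 1 - x \<bullet> x) x = - 2 * (x \<bullet> b)"
  by (rule dir_deriv_eqI) (auto intro!: derivative_eq_intros simp: inner_commute)

lemma dir_deriv_exp_flat_norm:
  "dir_deriv b (\<lambda>x::'a::euclidean_space. exp_flat n (1 - x \<bullet> x)) =
    (\<lambda>x. (exp_flat (n+2) (1 - x \<bullet> x) - real n * exp_flat (n+1) (1 - x \<bullet> x)) * (- 2 * (x \<bullet> b)))"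
  by (rule ext, subst dir_deriv_chain_real[OF exp_flat_deriv])
    (auto simp: dir_deriv_one_minus_norm intro: Ck_differentiable[OF Ck_one_minus_norm[of 1]])

lemma Ck_exp_flat_norm: "Ck k (\<lambda>x::'a::euclidean_space. exp_flat n (1 - x \<bullet> x))"
proof (induction k arbitrary: n)
  case 0
  have "continuous_on UNIV (exp_flat n)"
    using exp_flat_deriv DERIV_continuous by (blast intro: continuous_at_imp_continuous_on)
  then show ?case
    by (auto intro!: continuous_on_compose2[of UNIV "exp_flat n"] continuous_intros)
next
  case (Suc k)
  have "Ck k (dir_deriv b (\<lambda>x::'a. exp_flat n (1 - x \<bullet> x)))" for b
    unfolding dir_deriv_exp_flat_norm
    by (intro Ck_mult Ck_diff Suc Ck_const Ck_linear bounded_linear_inner_left)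
  moreover have "(\<lambda>x::'a. exp_flat n (1 - x \<bullet> x)) differentiable (at x)" for x
    by (rule differentiable_chain_real[OF exp_flat_deriv Ck_differentiable[OF Ck_one_minus_norm[of 1]]]) simp
  ultimately show ?case by simp
qed

text \<open>The standard mollifier exp(-1 / (1 - |x|^2)) on the unit ball, normalised to integral
  1.\<close>

definition bump :: "'a::euclidean_space \<Rightarrow> real" where
  "bump x = exp_flat 0 (1 - x \<bullet> x) / (integral\<^sup>L lborel (\<lambda>y::'a. exp_flat 0 (1 - y \<bullet> y)))"

lemma exp_flat_norm_props:
  fixes x :: "'a::euclidean_space"
  shows "exp_flat n (1 - x \<bullet> x) \<ge> 0" "norm x \<ge> 1 \<Longrightarrow> exp_flat n (1 - x \<bullet> x) = 0"
    "norm x < 1 \<Longrightarrow> exp_flat n (1 - x \<bullet> x) > 0"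
  by (auto simp: exp_flat_def norm_eq_sqrt_inner)

lemma integrable_bdd_supp:
  fixes f :: "'a::euclidean_space \<Rightarrow> 'b::euclidean_space"
  assumes "f \<in> borel_measurable borel" "bdd_supp f" "\<And>x. norm (f x) \<le> M"
  shows "integrable lborel f"
proof -
  obtain R where R: "\<And>x. R < norm x \<Longrightarrow> f x = 0" using assms by (auto simp: bdd_supp_def)
  have "integrable lborel (\<lambda>x::'a. indicator (cball 0 R) x *\<^sub>R M)"
    by (intro integrable_scaleR_left integrable_real_indicator) (auto simp: emeasure_lborel_cball_finite[unfolded infinity_ennreal_def])
  then show ?thesis
  proof (rule Bochner_Integration.integrable_bound)
    have "norm (f x) \<le> norm (indicator (cball 0 R) x *\<^sub>R M)" for x
      using assms(3)[of x] R[of x] by (cases "R < norm x") (auto simp: indicator_def)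
    then show "AE x in lborel. norm (f x) \<le> norm (indicator (cball 0 R) x *\<^sub>R M)" by simp
  qed (use assms in simp)
qed

lemma integrable_continuous_bdd_supp:
  fixes f :: "'a::euclidean_space \<Rightarrow> 'b::euclidean_space"
  assumes "continuous_on UNIV f" "bdd_supp f"
  shows "integrable lborel f"
  using bdd_supp_bounded[OF assms(2,1)]
  by (metis integrable_bdd_supp assms borel_measurable_continuous_onI)

lemma bdd_supp_exp_flat: "bdd_supp (\<lambda>x::'a::euclidean_space. exp_flat n (1 - x \<bullet> x))"
  unfolding bdd_supp_def using exp_flat_norm_props(2) by (metis less_imp_le)

text \<open>A nonnegative function with integral 0 vanishes almost everywhere, but this one is
  positive on the unit ball.\<close>

lemma integral_exp_flat_pos: "(integral\<^sup>L lborel (\<lambda>y::'a::euclidean_space. exp_flat 0 (1 - y \<bullet> y))) > 0"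
proof -
  let ?f = "\<lambda>y::'a. exp_flat 0 (1 - y \<bullet> y)"
  have int: "integrable lborel ?f"
    by (intro integrable_continuous_bdd_supp bdd_supp_exp_flat Ck_continuous[OF Ck_exp_flat_norm[of 0]])
  have "\<not> (AE x in lborel. ?f x = 0)"
  proof
    assume "AE x in lborel. ?f x = 0"
    then have "AE x::'a in lborel. x \<notin> ball 0 1"
      by eventually_elim (use exp_flat_norm_props(3)[of _ 0] in \<open>fastforce simp: less_le\<close>)
    then have "emeasure lborel (ball (0::'a) 1) = 0"
      by (subst (asm) AE_iff_measurable[where N="ball 0 1"]) auto
    then show False using content_ball_pos[of 1 "0::'a"]
      by (simp add: measure_def)
  qed
  then show ?thesis
    using integral_nonneg_eq_0_iff_AE[OF int] exp_flat_norm_props(1)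
    by (metis (no_types, lifting) AE_I2 Bochner_Integration.integral_nonneg order_less_le)
qed

lemma Ck_bump: "Ck k bump"
  unfolding bump_def[abs_def] divide_inverse by (intro Ck_mult Ck_exp_flat_norm Ck_const)

lemma bump_nonneg: "bump x \<ge> 0"
  unfolding bump_def by (intro divide_nonneg_pos exp_flat_norm_props(1) integral_exp_flat_pos)

lemma bump_eq_0: "norm x \<ge> 1 \<Longrightarrow> bump x = 0"
  by (simp add: bump_def exp_flat_norm_props(2))

lemma bdd_supp_bump: "bdd_supp bump"
  unfolding bdd_supp_def using bump_eq_0 by (metis less_imp_le)

lemma integrable_bump: "integrable lborel bump"
  by (intro integrable_continuous_bdd_supp bdd_supp_bump Ck_continuous[OF Ck_bump[of 0]])

lemma integral_bump: "(\<integral>x. bump (x::'a::euclidean_space) \<partial>lborel) = 1"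
proof -
  have "(\<integral>x. bump (x::'a) \<partial>lborel) =
      (integral\<^sup>L lborel (\<lambda>x::'a. exp_flat 0 (1 - x \<bullet> x))) / (integral\<^sup>L lborel (\<lambda>y::'a. exp_flat 0 (1 - y \<bullet> y)))"
    unfolding bump_def by (rule integral_divide_zero)
  then show ?thesis using integral_exp_flat_pos[where 'a='a] by simp
qed

text \<open>The one place where symmetry of second derivatives is verified by computation;
  \<open>dir_deriv_commute\<close> transfers it to C^2 functions of bounded support.\<close>

lemma dir_deriv_bump_commute: "dir_deriv b (dir_deriv c bump) = dir_deriv c (dir_deriv b bump)"
proof -
  define I where "I = (integral\<^sup>L lborel (\<lambda>y::'a. exp_flat 0 (1 - y \<bullet> y)))"
  have 0: "dir_deriv c bump = (\<lambda>x::'a. - (2 / I) * (exp_flat 2 (1 - x \<bullet> x) * (x \<bullet> c)))" for c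
  proof
    fix x
    have "dir_deriv c bump x = dir_deriv c (\<lambda>x::'a. inverse I * exp_flat 0 (1 - x \<bullet> x)) x"
      unfolding bump_def[abs_def] I_def by (simp add: field_simps)
    also have "\<dots> = inverse I * dir_deriv c (\<lambda>x::'a. exp_flat 0 (1 - x \<bullet> x)) x"
      by (rule dir_deriv_cmult) (rule Ck_differentiable[OF Ck_exp_flat_norm[of 1]], simp)
    finally show "dir_deriv c bump x = - (2 / I) * (exp_flat 2 (1 - x \<bullet> x) * (x \<bullet> c))"
      by (simp add: dir_deriv_exp_flat_norm field_simps numeral_2_eq_2)
  qed
  have 1: "dir_deriv b (\<lambda>x::'a. - (2 / I) * (exp_flat 2 (1 - x \<bullet> x) * (x \<bullet> c))) x
      = - (2 / I) * (exp_flat 2 (1 - x \<bullet> x) * (b \<bullet> c) +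
          dir_deriv b (\<lambda>x. exp_flat 2 (1 - x \<bullet> x)) x * (x \<bullet> c))" for b c x
  proof -
    have 1: "(\<lambda>x::'a. exp_flat 2 (1 - x \<bullet> x)) differentiable (at x)" for x
      by (rule Ck_differentiable[OF Ck_exp_flat_norm[of 1]]) simp
    have 2: "(\<lambda>x::'a. x \<bullet> c) differentiable (at x)" for x
      by (rule Ck_differentiable[OF Ck_linear[of _ 1]]) (auto intro: bounded_linear_inner_left)
    show ?thesis
      using 1 2 by (subst dir_deriv_cmult)
        (auto simp: dir_deriv_mult dir_deriv_linear[OF bounded_linear_inner_left])
  qed
  show ?thesis
    unfolding 0 by (rule ext, simp only: 1, simp add: dir_deriv_exp_flat_norm inner_commute)
qed

section \<open>Convolution and mollification\<close>

definition conv :: "('a::euclidean_space \<Rightarrow> real) \<Rightarrow> ('a \<Rightarrow> real) \<Rightarrow> 'a \<Rightarrow> real" where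
  "conv h k x = (\<integral>y. h y * k (x - y) \<partial>lborel)"

text \<open>The first derivatives are continuous with bounded support, hence uniformly continuous.
  Uniformity in \<open>x\<close> is what permits differentiating a convolution with a merely
  integrable factor.\<close>

lemma C1_uniform_linearization:
  fixes k :: "'a::euclidean_space \<Rightarrow> real"
  assumes k: "Ck 1 k" "bdd_supp k" and e: "e > 0"
  obtains d where "d > 0"
    "\<And>x v. norm v < d \<Longrightarrow> \<bar>k (x + v) - k x - dir_deriv v k x\<bar> \<le> e * norm v"
proof -
  \<comment> \<open>Each of the \<open>DIM('a)\<close> coordinate derivatives may oscillate by
    \<open>e'\<close>; summed against the coordinates of a vector this gives \<open>e\<close> times
    its norm.\<close>
  define e' where "e' = e / DIM('a)"
  have e': "e' > 0" using e by (simp add: e'_def)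
  have "\<forall>b\<in>Basis. \<forall>\<^sub>F d in at_right 0. \<forall>x y. norm (x - y) < d \<longrightarrow> \<bar>dir_deriv b k x - dir_deriv b k y\<bar> < e'"
  proof
    fix b :: 'a assume b: "b \<in> Basis"
    then have "continuous_on UNIV (dir_deriv b k)" using k by simp
    from bdd_supp_uniformly_continuous[OF bdd_supp_dir_deriv[OF k(2)] this e']
    obtain d where d: "d > 0" "\<And>x y. norm (x - y) < d \<Longrightarrow> norm (dir_deriv b k x - dir_deriv b k y) < e'"
      by blast
    show "\<forall>\<^sub>F d in at_right 0. \<forall>x y. norm (x - y) < d \<longrightarrow> \<bar>dir_deriv b k x - dir_deriv b k y\<bar> < e'"
      unfolding eventually_at_right_field using d by (intro exI[of _ d]) fastforce
  qed
  then have "\<forall>\<^sub>F d in at_right 0. \<forall>b\<in>Basis. \<forall>x y. norm (x - y) < d \<longrightarrow> \<bar>dir_deriv b k x - dir_deriv b k y\<bar> < e'"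
    by (rule eventually_ball_finite[OF finite_Basis])
  then obtain d0 where d0: "d0 > 0"
      "\<And>d. 0 < d \<Longrightarrow> d < d0 \<Longrightarrow> \<forall>b\<in>Basis. \<forall>x y. norm (x - y) < d \<longrightarrow> \<bar>dir_deriv b k x - dir_deriv b k y\<bar> < e'"
    unfolding eventually_at_right_field by blast
  define d where "d = d0 / 2"
  have d: "d > 0" "\<And>b x y. b \<in> Basis \<Longrightarrow> norm (x - y) < d \<Longrightarrow> \<bar>dir_deriv b k x - dir_deriv b k y\<bar> < e'"
    using d0(1) d0(2)[of d] by (auto simp: d_def)
  have diff: "k differentiable (at x)" for x using k(1) by simp
  show ?thesis
  proof
    fix x v :: 'a assume v: "norm v < d"
    have on: "onorm ((\<lambda>w. dir_deriv w k y) - (\<lambda>w. dir_deriv w k x)) \<le> e" if "y \<in> ball x d" for y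
    proof (rule onorm_le)
      fix w
      have "\<bar>dir_deriv w k y - dir_deriv w k x\<bar> = \<bar>\<Sum>b\<in>Basis. (w \<bullet> b) * (dir_deriv b k y - dir_deriv b k x)\<bar>"
        by (subst (1 2) dir_deriv_basis[OF diff]) (simp add: sum_subtractf right_diff_distrib)
      also have "\<dots> \<le> (\<Sum>b\<in>Basis. \<bar>(w \<bullet> b) * (dir_deriv b k y - dir_deriv b k x)\<bar>)"
        by (rule sum_abs)
      also have "\<dots> \<le> (\<Sum>b\<in>(Basis::'a set). norm w * e')"
        using that d(2)[of _ y x]
        by (intro sum_mono) (auto simp: abs_mult dist_norm norm_minus_commute less_imp_le intro!: mult_mono Basis_le_norm)
      finally show "norm (((\<lambda>w. dir_deriv w k y) - (\<lambda>w. dir_deriv w k x)) w) \<le> e * norm w"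
        by (simp add: e'_def mult.commute)
    qed
    have "norm (k (x + v) - k x - dir_deriv (x + v - x) k x) \<le> norm (x + v - x) * e"
    proof (rule differentiable_bound_linearization[where S="ball x d" and f'="\<lambda>y w. dir_deriv w k y"])
      show "x + t *\<^sub>R (x + v - x) \<in> ball x d" if "t \<in> {0..1}" for t
      proof -
        have "\<bar>t\<bar> * norm v \<le> 1 * norm v" using that by (intro mult_right_mono) auto
        then show ?thesis using v by (simp add: dist_norm)
      qed
    qed (use on d(1) has_derivative_at_withinI[OF has_derivative_dir_deriv[OF diff]] in auto)
    then show "\<bar>k (x + v) - k x - dir_deriv v k x\<bar> \<le> e * norm v" by (simp add: mult.commute)
  qed (rule d(1))
qed

lemma integrable_conv:
  fixes h k :: "'a::euclidean_space \<Rightarrow> real"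
  assumes "integrable lborel h" "continuous_on UNIV k" "bdd_supp k"
  shows "integrable lborel (\<lambda>y. h y * k (x - y))"
proof -
  obtain M where M: "\<And>x. norm (k x) \<le> M" using bdd_supp_bounded[OF assms(3,2)] by blast
  have [measurable]: "h \<in> borel_measurable borel" "k \<in> borel_measurable borel"
    using assms borel_measurable_integrable borel_measurable_continuous_onI by auto
  show ?thesis
  proof (rule Bochner_Integration.integrable_bound)
    show "integrable lborel (\<lambda>y. M * h y)" using assms(1) by simp
    have "norm (h y * k (x - y)) \<le> norm (M * h y)" for y
    proof -
      have "\<bar>k (x - y)\<bar> \<le> \<bar>M\<bar>" using M[of "x - y"] by simp
      from mult_right_mono[OF this abs_ge_zero[of "h y"]]
      show ?thesis by (simp add: abs_mult mult.commute)
    qed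
    then show "AE y in lborel. norm (h y * k (x - y)) \<le> norm (M * h y)" by simp
  qed measurable
qed

text \<open>The remainder of the difference is an integral of \<open>h\<close> against the remainder
  of \<open>k\<close>, which is uniformly small by \<open>C1_uniform_linearization\<close>.\<close>

lemma conv_has_derivative:
  fixes h k :: "'a::euclidean_space \<Rightarrow> real"
  assumes h: "integrable lborel h" and k: "Ck 1 k" "bdd_supp k"
  shows "(conv h k has_derivative (\<lambda>v. \<Sum>b\<in>Basis. (v \<bullet> b) * conv h (dir_deriv b k) x)) (at x)"
  unfolding has_derivative_at_alt
proof (intro conjI allI impI)
  show "bounded_linear (\<lambda>v. \<Sum>b\<in>Basis. (v \<bullet> b) * conv h (dir_deriv b k) x)"
    by (intro bounded_linear_sum bounded_linear_mult_const bounded_linear_inner_left)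
next
  fix e :: real assume e: "e > 0"
  define I where "I = (\<integral>y. \<bar>h y\<bar> \<partial>lborel)"
  have I: "I \<ge> 0" by (simp add: I_def)
  \<comment> \<open>The summand 1 keeps the divisor positive when the integral \<open>I\<close> is
    0.\<close>
  obtain d where d: "d > 0"
    "\<And>x v. norm v < d \<Longrightarrow> \<bar>k (x + v) - k x - dir_deriv v k x\<bar> \<le> (e / (1 + I)) * norm v"
    using C1_uniform_linearization[OF k, of "e / (1 + I)"] e I by (auto simp: add_pos_nonneg)
  have diff: "k differentiable (at x)" for x using k(1) by simp
  have int: "integrable lborel (\<lambda>z. h z * dir_deriv b k (x - z))" if "b \<in> Basis" for b
    using k that by (intro integrable_conv h bdd_supp_dir_deriv) auto
  have intk: "integrable lborel (\<lambda>z. h z * k (y - z))" for y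
    by (intro integrable_conv h k Ck_continuous[OF k(1)])
  show "\<exists>d>0. \<forall>y. norm (y - x) < d \<longrightarrow>
      norm (conv h k y - conv h k x - (\<Sum>b\<in>Basis. ((y - x) \<bullet> b) * conv h (dir_deriv b k) x)) \<le> e * norm (y - x)"
  proof (intro exI[of _ d] conjI allI impI d(1))
    fix y assume y: "norm (y - x) < d"
    let ?r = "\<lambda>z. k (y - z) - k (x - z) - dir_deriv (y - x) k (x - z)"
    have D: "h z * dir_deriv (y - x) k (x - z) = (\<Sum>b\<in>Basis. ((y - x) \<bullet> b) * (h z * dir_deriv b k (x - z)))" for z
      by (subst dir_deriv_basis[OF diff]) (simp add: sum_distrib_left mult_ac)
    have intD: "integrable lborel (\<lambda>z. h z * dir_deriv (y - x) k (x - z))"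
      unfolding D by (intro Bochner_Integration.integrable_sum integrable_mult_right int)
    have 1: "(\<integral>z. h z * dir_deriv (y - x) k (x - z) \<partial>lborel) = (\<Sum>b\<in>Basis. ((y - x) \<bullet> b) * conv h (dir_deriv b k) x)"
      unfolding D conv_def using int by (subst Bochner_Integration.integral_sum) auto
    have intr: "integrable lborel (\<lambda>z. h z * ?r z)"
      using intk intD by (simp add: right_diff_distrib)
    have "conv h k y - conv h k x - (\<Sum>b\<in>Basis. ((y - x) \<bullet> b) * conv h (dir_deriv b k) x) = (\<integral>z. h z * ?r z \<partial>lborel)"
      unfolding 1[symmetric] unfolding conv_def using intk intD by (simp add: right_diff_distrib)
    also have "norm \<dots> \<le> (\<integral>z. (e / (1 + I) * norm (y - x)) * \<bar>h z\<bar> \<partial>lborel)"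
    proof (rule Bochner_Integration.integral_norm_bound_integral[OF intr])
      fix z
      have "\<bar>?r z\<bar> \<le> (e / (1 + I)) * norm (y - x)"
        using d(2)[OF y, of "x - z"] by (simp add: algebra_simps)
      then show "norm (h z * ?r z) \<le> (e / (1 + I) * norm (y - x)) * \<bar>h z\<bar>"
        unfolding real_norm_def abs_mult by (subst mult.commute) (intro mult_right_mono, auto)
    qed (use h in simp)
    also have "\<dots> = (I / (1 + I)) * (e * norm (y - x))"
      by (simp add: I_def)
    also have "\<dots> \<le> 1 * (e * norm (y - x))"
      using I e by (intro mult_right_mono) (auto simp: divide_simps)
    finally show "norm (conv h k y - conv h k x - (\<Sum>b\<in>Basis. ((y - x) \<bullet> b) * conv h (dir_deriv b k) x)) \<le> e * norm (y - x)"
      by simp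
  qed
qed

lemma dir_deriv_conv:
  fixes h k :: "'a::euclidean_space \<Rightarrow> real"
  assumes h: "integrable lborel h" and k: "Ck 1 k" "bdd_supp k" and b: "b \<in> Basis"
  shows "dir_deriv b (conv h k) = conv h (dir_deriv b k)"
proof
  fix x
  have "dir_deriv b (conv h k) x = (\<Sum>c\<in>Basis. (b \<bullet> c) * conv h (dir_deriv c k) x)"
    by (rule dir_deriv_eqI[OF conv_has_derivative[OF h k]])
  also have "\<dots> = (\<Sum>c\<in>Basis. if c = b then conv h (dir_deriv c k) x else 0)"
    using b by (intro sum.cong) (auto simp: inner_Basis)
  finally show "dir_deriv b (conv h k) x = conv h (dir_deriv b k) x" using b by simp
qed

text \<open>All derivatives fall on the kernel \<open>k\<close>, so \<open>h\<close> may be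
  discontinuous.\<close>

lemma Ck_conv:
  fixes h k :: "'a::euclidean_space \<Rightarrow> real"
  assumes h: "integrable lborel h"
  shows "(\<And>n. Ck n k) \<Longrightarrow> bdd_supp k \<Longrightarrow> Ck m (conv h k)"
proof (induction m arbitrary: k)
  case 0
  then have "conv h k differentiable (at x)" for x
    using conv_has_derivative[OF h] by (auto simp: differentiable_def simp del: One_nat_def)
  then show ?case
    by (auto intro!: differentiable_imp_continuous_on differentiable_at_imp_differentiable_on)
next
  case (Suc m)
  have "conv h k differentiable (at x)" for x
    using conv_has_derivative[OF h] Suc.prems by (auto simp: differentiable_def simp del: One_nat_def)
  moreover have "Ck m (dir_deriv b (conv h k))" if "b \<in> Basis" for b
    unfolding dir_deriv_conv[OF h Suc.prems that]
    by (rule Suc.IH) (use Suc.prems(1)[of "Suc _"] that bdd_supp_dir_deriv Suc.prems(2) in auto)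
  ultimately show ?case by simp
qed

lemma lborel_integral_reflect:
  fixes f :: "'a::euclidean_space \<Rightarrow> 'b::euclidean_space"
  assumes "f \<in> borel_measurable borel"
  shows "(\<integral>y. f (x - y) \<partial>lborel) = (\<integral>y. f y \<partial>lborel)"
proof -
  have "(lborel :: 'a measure) = density (distr lborel borel (\<lambda>y. x + (-1) *\<^sub>R y)) (\<lambda>_. ennreal (\<bar>-1\<bar>^DIM('a)))"
    by (rule lborel_affine) simp
  also have "\<dots> = distr lborel borel (\<lambda>y. x - y)" by (simp add: density_1)
  finally have "(\<integral>y. f y \<partial>lborel) = (\<integral>y. f y \<partial>distr lborel borel (\<lambda>y. x - y))" by simp
  also have "\<dots> = (\<integral>y. f (x - y) \<partial>lborel)"
    using assms by (subst integral_distr) auto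
  finally show ?thesis by simp
qed

lemma lborel_integrable_reflect:
  fixes f :: "'a::euclidean_space \<Rightarrow> 'b::euclidean_space"
  assumes "integrable lborel f"
  shows "integrable lborel (\<lambda>y. f (x - y))"
proof -
  have "(lborel :: 'a measure) = density (distr lborel borel (\<lambda>y. x + (-1) *\<^sub>R y)) (\<lambda>_. ennreal (\<bar>-1\<bar>^DIM('a)))"
    by (rule lborel_affine) simp
  also have "\<dots> = distr lborel borel (\<lambda>y. x - y)" by (simp add: density_1)
  finally have "integrable (distr lborel borel (\<lambda>y. x - y)) f" using assms by simp
  then show ?thesis by (subst (asm) integrable_distr_eq) (use assms borel_measurable_integrable in auto)
qed

lemma conv_commute:
  assumes "h \<in> borel_measurable borel" "k \<in> borel_measurable borel"
  shows "conv h k x = conv k h x"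
  using lborel_integral_reflect[of "\<lambda>y. h y * k (x - y)" x] assms
  by (simp add: conv_def mult.commute)

text \<open>The bound does not depend on \<open>h\<close>; applied to indicators it gives constants
  that are uniform over all sets.\<close>

lemma abs_conv_le:
  fixes h k :: "'a::euclidean_space \<Rightarrow> real"
  assumes h: "integrable lborel h" "\<And>x. \<bar>h x\<bar> \<le> 1" and k: "continuous_on UNIV k" "bdd_supp k"
  shows "\<bar>conv h k x\<bar> \<le> (\<integral>y. \<bar>k y\<bar> \<partial>lborel)"
proof -
  have ik: "integrable lborel k" by (rule integrable_continuous_bdd_supp[OF k])
  then have [measurable]: "k \<in> borel_measurable borel" using borel_measurable_integrable by auto
  have "norm (conv h k x) \<le> (\<integral>y. \<bar>k (x - y)\<bar> \<partial>lborel)"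
    unfolding conv_def
  proof (rule Bochner_Integration.integral_norm_bound_integral)
    show "integrable lborel (\<lambda>y. h y * k (x - y))" by (rule integrable_conv[OF h(1) k])
    show "integrable lborel (\<lambda>y. \<bar>k (x - y)\<bar>)" using lborel_integrable_reflect[OF ik] by simp
    show "norm (h y * k (x - y)) \<le> \<bar>k (x - y)\<bar>" for y
      using h(2)[of y] by (simp add: abs_mult mult_left_le_one_le)
  qed
  also have "\<dots> = (\<integral>y. \<bar>k y\<bar> \<partial>lborel)" by (rule lborel_integral_reflect[of "\<lambda>y. \<bar>k y\<bar>"]) simp
  finally show ?thesis by simp
qed

text \<open>A common class for the two kinds of functions to be mollified: continuous functions of
  bounded support, and indicators of bounded Borel sets.\<close>

definition bdd_fun :: "('a::euclidean_space \<Rightarrow> real) \<Rightarrow> bool" where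
  "bdd_fun h \<longleftrightarrow> h \<in> borel_measurable borel \<and> bdd_supp h \<and> (\<exists>M. \<forall>x. \<bar>h x\<bar> \<le> M)"

text \<open>Convolution with the rescaled kernel t^(-d) bump(x / t), written after the substitution
  that returns the kernel to unit scale.\<close>

definition moll :: "real \<Rightarrow> ('a::euclidean_space \<Rightarrow> real) \<Rightarrow> 'a \<Rightarrow> real" where
  "moll t h x = (\<integral>z. bump z * h (x - t *\<^sub>R z) \<partial>lborel)"

lemma bdd_fun_integrable: "bdd_fun h \<Longrightarrow> integrable lborel h"
  unfolding bdd_fun_def by (metis integrable_bdd_supp real_norm_def)

lemma bdd_fun_continuous:
  assumes "continuous_on UNIV h" "bdd_supp h"
  shows "bdd_fun h"
  using assms bdd_supp_bounded[OF assms(2,1)] unfolding bdd_fun_def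
  by (metis borel_measurable_continuous_onI real_norm_def)

lemma bdd_fun_indicator:
  fixes S :: "'a::euclidean_space set"
  assumes "S \<in> sets borel" "bounded S" shows "bdd_fun (indicator S)"
proof -
  obtain R where R: "\<And>x. x \<in> S \<Longrightarrow> norm x \<le> R" using assms(2) by (auto simp: bounded_iff)
  have "bdd_supp (indicator S :: 'a \<Rightarrow> real)"
    unfolding bdd_supp_def using R by (intro exI[of _ R]) (auto simp: indicator_def not_le[symmetric])
  moreover have "\<forall>x. \<bar>indicator S x :: real\<bar> \<le> 1" by (auto simp: indicator_def)
  ultimately show ?thesis using assms unfolding bdd_fun_def by auto
qed

lemma bdd_supp_scale:
  fixes h :: "'a::euclidean_space \<Rightarrow> 'b::zero"
  assumes "bdd_supp h" "t > 0" shows "bdd_supp (\<lambda>y. h (t *\<^sub>R y))"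
proof -
  obtain R where R: "\<And>x. R < norm x \<Longrightarrow> h x = 0" using assms by (auto simp: bdd_supp_def)
  show ?thesis unfolding bdd_supp_def
    using assms(2) by (intro exI[of _ "R / t"] allI impI R) (auto simp: divide_simps mult.commute)
qed

lemma bdd_fun_scale:
  assumes "bdd_fun h" "t > 0" shows "bdd_fun (\<lambda>y. h (t *\<^sub>R y))"
  using assms unfolding bdd_fun_def by (auto intro: bdd_supp_scale)

text \<open>Two readings at unit scale, since \<open>conv\<close> is differentiated in its second
  factor: in the first form derivatives fall on \<open>bump\<close>, so \<open>h\<close> may be an
  indicator; in the second they fall on \<open>h\<close>.\<close>

lemma moll_eq_conv:
  assumes "bdd_fun h" "t > 0"
  shows "moll t h = (\<lambda>x. conv (\<lambda>y. h (t *\<^sub>R y)) bump ((1/t) *\<^sub>R x + 0))"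
    and "moll t h = (\<lambda>x. conv bump (\<lambda>y. h (t *\<^sub>R y)) ((1/t) *\<^sub>R x + 0))"
proof -
  show 1: "moll t h = (\<lambda>x. conv bump (\<lambda>y. h (t *\<^sub>R y)) ((1/t) *\<^sub>R x + 0))"
    using assms(2) by (simp add: moll_def conv_def fun_eq_iff scaleR_diff_right)
  show "moll t h = (\<lambda>x. conv (\<lambda>y. h (t *\<^sub>R y)) bump ((1/t) *\<^sub>R x + 0))"
    unfolding 1
    by (intro ext conv_commute)
      (use bdd_fun_scale[OF assms] borel_measurable_continuous_onI[OF Ck_continuous[OF Ck_bump[of 0]]] in \<open>auto simp: bdd_fun_def\<close>)
qed

lemma Ck_moll:
  assumes "bdd_fun h" "t > 0" shows "Ck k (moll t h)"
  unfolding moll_eq_conv(1)[OF assms]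
  by (intro Ck_affine Ck_conv Ck_bump bdd_supp_bump bdd_fun_integrable bdd_fun_scale assms)

lemma smooth_dir_deriv: "(\<And>k. Ck k f) \<Longrightarrow> b \<in> Basis \<Longrightarrow> Ck k (dir_deriv b f)"
  by (metis Ck_on.simps(2))

lemma dir_deriv_moll_bump:
  assumes h: "bdd_fun h" "t > 0" and b: "b \<in> Basis"
  shows "dir_deriv b (moll t h) = (\<lambda>x. (1/t) * conv (\<lambda>y. h (t *\<^sub>R y)) (dir_deriv b bump) ((1/t) *\<^sub>R x + 0))"
proof
  fix x
  have i: "integrable lborel (\<lambda>y. h (t *\<^sub>R y))" by (intro bdd_fun_integrable bdd_fun_scale h)
  show "dir_deriv b (moll t h) x = (1/t) * conv (\<lambda>y. h (t *\<^sub>R y)) (dir_deriv b bump) ((1/t) *\<^sub>R x + 0)"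
    unfolding moll_eq_conv(1)[OF h]
    by (subst dir_deriv_affine)
      (auto simp: dir_deriv_conv[OF i Ck_bump bdd_supp_bump b] intro: Ck_differentiable[OF Ck_conv[OF i Ck_bump bdd_supp_bump, of 1]])
qed

lemma dir_deriv2_moll_bump:
  assumes h: "bdd_fun h" "t > 0" and b: "b \<in> Basis" and c: "c \<in> Basis"
  shows "dir_deriv c (dir_deriv b (moll t h)) =
    (\<lambda>x. (1/t) * ((1/t) * conv (\<lambda>y. h (t *\<^sub>R y)) (dir_deriv c (dir_deriv b bump)) ((1/t) *\<^sub>R x + 0)))"
proof
  fix x
  have i: "integrable lborel (\<lambda>y. h (t *\<^sub>R y))" by (intro bdd_fun_integrable bdd_fun_scale h)
  have B: "Ck k (dir_deriv b bump)" "bdd_supp (dir_deriv b bump)" for k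
    by (intro smooth_dir_deriv Ck_bump b bdd_supp_dir_deriv bdd_supp_bump)+
  let ?g = "conv (\<lambda>y. h (t *\<^sub>R y)) (dir_deriv b bump)"
  have dg: "?g differentiable (at x)" for x by (rule Ck_differentiable[OF Ck_conv[OF i B, of 1]]) simp
  have "dir_deriv c (\<lambda>x. (1/t) * ?g ((1/t) *\<^sub>R x + 0)) x = (1/t) * dir_deriv c (\<lambda>x. ?g ((1/t) *\<^sub>R x + 0)) x"
    by (rule dir_deriv_cmult) (rule Ck_differentiable[OF Ck_affine[OF Ck_conv[OF i B, of 1]]], simp)
  then show "dir_deriv c (dir_deriv b (moll t h)) x =
    (1/t) * ((1/t) * conv (\<lambda>y. h (t *\<^sub>R y)) (dir_deriv c (dir_deriv b bump)) ((1/t) *\<^sub>R x + 0))"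
    unfolding dir_deriv_moll_bump[OF h b] by (simp only: dir_deriv_affine[OF dg] dir_deriv_conv[OF i B c] real_scaleR_def)
qed

text \<open>The factor \<open>1/t\<close> from the rescaled argument cancels the factor
  \<open>t\<close> that the chain rule gives for \<open>h (t *\<^sub>R y)\<close>.\<close>

lemma dir_deriv_moll:
  assumes h: "Ck 1 h" "bdd_supp h" and t: "t > 0" and b: "b \<in> Basis"
  shows "dir_deriv b (moll t h) = moll t (dir_deriv b h)"
proof
  fix x
  have hb: "bdd_fun h" by (intro bdd_fun_continuous h Ck_continuous[OF h(1)])
  have dh: "bdd_fun (dir_deriv b h)" using h b by (intro bdd_fun_continuous bdd_supp_dir_deriv) auto
  have C: "Ck 1 (\<lambda>y. h (t *\<^sub>R y))" using Ck_affine[OF h(1), of t 0] by simp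
  have S: "bdd_supp (\<lambda>y. h (t *\<^sub>R y))" by (rule bdd_supp_scale[OF h(2) t])
  have D: "dir_deriv b (\<lambda>y. h (t *\<^sub>R y)) = (\<lambda>y. t * dir_deriv b h (t *\<^sub>R y))"
    using dir_deriv_affine[of h t _ 0 b] h(1) by (auto simp: fun_eq_iff)
  have "dir_deriv b (moll t h) x = (1/t) * conv bump (dir_deriv b (\<lambda>y. h (t *\<^sub>R y))) ((1/t) *\<^sub>R x + 0)"
    unfolding moll_eq_conv(2)[OF hb t]
    by (subst dir_deriv_affine)
      (use conv_has_derivative[OF integrable_bump C S] in \<open>auto simp: dir_deriv_conv[OF integrable_bump C S b] differentiable_def\<close>)
  also have "\<dots> = moll t (dir_deriv b h) x"
    unfolding D moll_eq_conv(2)[OF dh t] conv_def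
    using t by (simp add: mult.left_commute)
  finally show "dir_deriv b (moll t h) x = moll t (dir_deriv b h) x" .
qed

lemma integrable_moll:
  assumes "bdd_fun h" "t > 0"
  shows "integrable lborel (\<lambda>z. bump z * h (x - t *\<^sub>R z))"
proof -
  obtain M where M: "\<And>x. \<bar>h x\<bar> \<le> M" using assms by (auto simp: bdd_fun_def)
  have [measurable]: "h \<in> borel_measurable borel" using assms by (auto simp: bdd_fun_def)
  have [measurable]: "(bump::'a\<Rightarrow>real) \<in> borel_measurable borel"
    by (rule borel_measurable_continuous_onI[OF Ck_continuous[OF Ck_bump[of 0]]])
  show ?thesis
  proof (rule Bochner_Integration.integrable_bound)
    show "integrable lborel (\<lambda>z::'a. M * bump z)" by (simp add: integrable_bump)
    have "norm (bump z * h (x - t *\<^sub>R z)) \<le> norm (M * bump z)" for z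
    proof -
      have "\<bar>h (x - t *\<^sub>R z)\<bar> \<le> \<bar>M\<bar>" using M[of "x - t *\<^sub>R z"] by simp
      from mult_right_mono[OF this abs_ge_zero[of "bump z"]]
      show ?thesis by (simp add: abs_mult mult.commute)
    qed
    then show "AE z in lborel. norm (bump z * h (x - t *\<^sub>R z)) \<le> norm (M * bump z)" by simp
  qed measurable
qed

text \<open>\<open>bump\<close> is a probability density on the unit ball, so
  \<open>moll t h x\<close> is an average of values of \<open>h\<close> at distance less than
  \<open>t\<close> from \<open>x\<close>. Convergence, the range of mollified indicators and local
  constancy are all instances.\<close>

lemma moll_close:
  fixes h :: "'a::euclidean_space \<Rightarrow> real"
  assumes h: "bdd_fun h" "t > 0" and c: "\<And>y. norm (y - x) < t \<Longrightarrow> \<bar>h y - c\<bar> \<le> e"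
  shows "\<bar>moll t h x - c\<bar> \<le> e"
proof -
  have "moll t h x - c = (\<integral>z. bump z * h (x - t *\<^sub>R z) \<partial>lborel) - (\<integral>z. bump (z::'a) * c \<partial>lborel)"
    by (simp add: moll_def integral_bump)
  also have "\<dots> = (\<integral>z. bump z * h (x - t *\<^sub>R z) - bump z * c \<partial>lborel)"
    using integrable_moll[OF h] by (simp add: integrable_bump)
  also have "norm \<dots> \<le> (\<integral>z. bump (z::'a) * e \<partial>lborel)"
  proof (rule Bochner_Integration.integral_norm_bound_integral)
    fix z
    have "\<bar>h (x - t *\<^sub>R z) - c\<bar> \<le> e" if "norm z < 1"
      using that h(2) by (intro c) simp
    then have "norm (bump z) * \<bar>h (x - t *\<^sub>R z) - c\<bar> \<le> bump z * e"
      using bump_nonneg[of z] bump_eq_0[of z] by (cases "norm z < 1") (auto intro: mult_left_mono)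
    then show "norm (bump z * h (x - t *\<^sub>R z) - bump z * c) \<le> bump z * e"
      by (simp add: abs_mult flip: right_diff_distrib)
  qed (use integrable_moll[OF h] in \<open>auto simp: integrable_bump\<close>)
  also have "\<dots> = e" by (simp add: integral_bump)
  finally show ?thesis by simp
qed

lemma moll_eq:
  assumes "bdd_fun h" "t > 0" "\<And>y. norm (y - x) < t \<Longrightarrow> h y = c"
  shows "moll t h x = c"
  using moll_close[OF assms(1,2), of x c 0] assms(3) by simp

lemma moll_tendsto_unif:
  fixes h :: "'a::euclidean_space \<Rightarrow> real"
  assumes "continuous_on UNIV h" "bdd_supp h" "e > 0"
  shows "\<forall>\<^sub>F t in at_right 0. \<forall>x. \<bar>moll t h x - h x\<bar> \<le> e"
proof -
  obtain d where d: "d > 0" "\<And>x y. norm (x - y) < d \<Longrightarrow> norm (h x - h y) < e"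
    using bdd_supp_uniformly_continuous[OF assms(2,1,3)] by blast
  have hb: "bdd_fun h" by (intro bdd_fun_continuous assms)
  show ?thesis unfolding eventually_at_right_field
  proof (intro exI[of _ d] conjI d(1) allI impI)
    fix t x assume t: "0 < t" "t < d"
    show "\<bar>moll t h x - h x\<bar> \<le> e"
    proof (rule moll_close[OF hb t(1)])
      fix y assume "norm (y - x) < t"
      then show "\<bar>h y - h x\<bar> \<le> e" using d(2)[of y x] t by simp
    qed
  qed
qed

text \<open>Schwarz's theorem by mollification: the mixed derivatives of \<open>moll t h\<close>
  agree because both can be put on \<open>bump\<close>, and they converge to those of
  \<open>h\<close> as \<open>t\<close> tends to 0.\<close>

lemma dir_deriv_commute:
  fixes h :: "'a::euclidean_space \<Rightarrow> real"
  assumes h: "Ck 2 h" "bdd_supp h" and b: "b \<in> Basis" and c: "c \<in> Basis"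
  shows "dir_deriv b (dir_deriv c h) = dir_deriv c (dir_deriv b h)"
proof
  fix x
  have C1: "Ck 1 h" "Ck 1 (dir_deriv b h)" "Ck 1 (dir_deriv c h)"
    using h b c Ck_mono[of 2 h 1] by (auto simp: numeral_2_eq_2)
  have hb: "bdd_fun h" by (intro bdd_fun_continuous h Ck_continuous[OF h(1)])
  have eq: "moll t (dir_deriv b (dir_deriv c h)) x = moll t (dir_deriv c (dir_deriv b h)) x" if "t > 0" for t
  proof -
    have "moll t (dir_deriv b (dir_deriv c h)) = dir_deriv b (dir_deriv c (moll t h))"
      using C1 h b c that by (simp add: dir_deriv_moll bdd_supp_dir_deriv del: One_nat_def)
    also have "\<dots> = dir_deriv c (dir_deriv b (moll t h))"
      unfolding dir_deriv2_moll_bump[OF hb that c b] dir_deriv2_moll_bump[OF hb that b c]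
      by (simp add: dir_deriv_bump_commute[of b c])
    also have "\<dots> = moll t (dir_deriv c (dir_deriv b h))"
      using C1 h b c that by (simp add: dir_deriv_moll bdd_supp_dir_deriv del: One_nat_def)
    finally show ?thesis by simp
  qed
  have *: "\<bar>dir_deriv b (dir_deriv c h) x - dir_deriv c (dir_deriv b h) x\<bar> \<le> e" if e: "e > 0" for e
  proof -
    have ct: "continuous_on UNIV (dir_deriv b (dir_deriv c h))" "continuous_on UNIV (dir_deriv c (dir_deriv b h))"
      using C1 b c by auto
    have "\<forall>\<^sub>F t in at_right 0. t > (0::real) \<and> \<bar>moll t (dir_deriv b (dir_deriv c h)) x - dir_deriv b (dir_deriv c h) x\<bar> \<le> e/2
       \<and> \<bar>moll t (dir_deriv c (dir_deriv b h)) x - dir_deriv c (dir_deriv b h) x\<bar> \<le> e/2"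
    proof (intro eventually_conj)
      show "\<forall>\<^sub>F t in at_right 0. t > (0::real)" by (rule eventually_at_right_less)
      show "\<forall>\<^sub>F t in at_right 0. \<bar>moll t (dir_deriv b (dir_deriv c h)) x - dir_deriv b (dir_deriv c h) x\<bar> \<le> e/2"
        by (rule eventually_mono[OF moll_tendsto_unif[OF ct(1), of "e/2"]]) (use h(2) e in \<open>auto intro!: bdd_supp_dir_deriv\<close>)
      show "\<forall>\<^sub>F t in at_right 0. \<bar>moll t (dir_deriv c (dir_deriv b h)) x - dir_deriv c (dir_deriv b h) x\<bar> \<le> e/2"
        by (rule eventually_mono[OF moll_tendsto_unif[OF ct(2), of "e/2"]]) (use h(2) e in \<open>auto intro!: bdd_supp_dir_deriv\<close>)
    qed
    then obtain t where "t > 0" "\<bar>moll t (dir_deriv b (dir_deriv c h)) x - dir_deriv b (dir_deriv c h) x\<bar> \<le> e/2"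
       "\<bar>moll t (dir_deriv c (dir_deriv b h)) x - dir_deriv c (dir_deriv b h) x\<bar> \<le> e/2"
      by (auto dest!: eventually_happens)
    then show ?thesis using eq[of t] by linarith
  qed
  then show "dir_deriv b (dir_deriv c h) x = dir_deriv c (dir_deriv b h) x"
    using field_le_epsilon[of "\<bar>dir_deriv b (dir_deriv c h) x - dir_deriv c (dir_deriv b h) x\<bar>" 0] by simp
qed

text \<open>With all derivatives on \<open>bump\<close>, the L^1 norms of its derivatives bound
  everything, and each derivative costs one factor \<open>1/t\<close>. Because \<open>K\<close> is
  independent of the set, the boundary cutoffs at all distances share one constant.\<close>

lemma moll_indicator_bounds:
  fixes S :: "'a::euclidean_space set"
  obtains K where "K \<ge> 0"
    "\<And>S t b x. S \<in> sets borel \<Longrightarrow> bounded S \<Longrightarrow> t > 0 \<Longrightarrow> b \<in> Basis \<Longrightarrow> \<bar>dir_deriv b (moll t (indicator S)) (x::'a)\<bar> \<le> K / t"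
    "\<And>S t b c x. S \<in> sets borel \<Longrightarrow> bounded S \<Longrightarrow> t > 0 \<Longrightarrow> b \<in> Basis \<Longrightarrow> c \<in> Basis \<Longrightarrow>
       \<bar>dir_deriv c (dir_deriv b (moll t (indicator S))) (x::'a)\<bar> \<le> K / t^2"
proof -
  define K1 where "K1 b = integral\<^sup>L lborel (\<lambda>y::'a. \<bar>dir_deriv b bump y\<bar>)" for b
  define K2 where "K2 c b = integral\<^sup>L lborel (\<lambda>y::'a. \<bar>dir_deriv c (dir_deriv b bump) y\<bar>)" for c b
  define K where "K = (\<Sum>b\<in>Basis. K1 b) + (\<Sum>b\<in>Basis. \<Sum>c\<in>Basis. K2 c b)"
  have nn: "K1 b \<ge> 0" "K2 c b \<ge> 0" for b c by (auto simp: K1_def K2_def)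
  have n2: "0 \<le> (\<Sum>b\<in>Basis. \<Sum>c\<in>Basis. K2 c b)" "0 \<le> (\<Sum>b\<in>Basis. K1 b)"
    by (intro sum_nonneg nn)+
  have le1: "K1 b \<le> K" if "b \<in> Basis" for b
    using member_le_sum[of b Basis K1] that nn n2 by (auto simp: K_def)
  have le2: "K2 c b \<le> K" if "b \<in> Basis" "c \<in> Basis" for b c
  proof -
    have "K2 c b \<le> (\<Sum>c\<in>Basis. K2 c b)" using member_le_sum[of c Basis "\<lambda>c. K2 c b"] that nn by auto
    also have "\<dots> \<le> (\<Sum>b\<in>Basis. \<Sum>c\<in>Basis. K2 c b)"
      using member_le_sum[of b Basis "\<lambda>b. \<Sum>c\<in>Basis. K2 c b"] that nn by (auto intro: sum_nonneg)
    finally show ?thesis using n2 by (simp add: K_def)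
  qed
  show ?thesis
  proof
    show "K \<ge> 0" using n2 by (simp add: K_def)
    fix S :: "'a set" and t :: real and b x :: 'a assume S: "S \<in> sets borel" "bounded S" and t: "t > 0" and b: "b \<in> Basis"
    have h: "bdd_fun (indicator S)" by (rule bdd_fun_indicator[OF S])
    have i: "integrable lborel (\<lambda>y. indicator S (t *\<^sub>R y) :: real)" by (intro bdd_fun_integrable bdd_fun_scale h t)
    have l: "\<bar>indicator S (t *\<^sub>R y) :: real\<bar> \<le> 1" for y by (simp add: indicator_def)
    have "\<bar>conv (\<lambda>y. indicator S (t *\<^sub>R y)) (dir_deriv b bump) y\<bar> \<le> K1 b" for y
      unfolding K1_def by (intro abs_conv_le i l bdd_supp_dir_deriv bdd_supp_bump Ck_continuous[OF smooth_dir_deriv[OF Ck_bump b, of 0]])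
    then have "\<bar>conv (\<lambda>y. indicator S (t *\<^sub>R y)) (dir_deriv b bump) y\<bar> \<le> K" for y using le1[OF b] order_trans by blast
    then show "\<bar>dir_deriv b (moll t (indicator S)) x\<bar> \<le> K / t"
      unfolding dir_deriv_moll_bump[OF h t b] using t by (auto simp: abs_mult divide_simps)
    fix c :: 'a assume c: "c \<in> Basis"
    have "\<bar>conv (\<lambda>y. indicator S (t *\<^sub>R y)) (dir_deriv c (dir_deriv b bump)) y\<bar> \<le> K2 c b" for y
      unfolding K2_def by (intro abs_conv_le i l bdd_supp_dir_deriv bdd_supp_bump
        Ck_continuous[OF smooth_dir_deriv[OF smooth_dir_deriv[OF Ck_bump b] c, of 0]])
    then have "\<bar>conv (\<lambda>y. indicator S (t *\<^sub>R y)) (dir_deriv c (dir_deriv b bump)) y\<bar> \<le> K" for y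
      using le2[OF b c] order_trans by blast
    then show "\<bar>dir_deriv c (dir_deriv b (moll t (indicator S))) x\<bar> \<le> K / t^2"
      unfolding dir_deriv2_moll_bump[OF h t b c] using t by (auto simp: abs_mult divide_simps power2_eq_square)
  qed
qed

lemma moll_indicator_range:
  fixes S :: "'a::euclidean_space set"
  assumes S: "S \<in> sets borel" "bounded S" and t: "t > 0"
  shows "0 \<le> moll t (indicator S) x" "moll t (indicator S) x \<le> 1"
proof -
  \<comment> \<open>Both bounds at once: the values 0 and 1 are at distance 1/2 from 1/2.\<close>
  have "\<bar>moll t (indicator S) x - 1/2\<bar> \<le> 1/2"
    by (rule moll_close[OF bdd_fun_indicator[OF S] t]) (auto simp: indicator_def)
  then show "0 \<le> moll t (indicator S) x" "moll t (indicator S) x \<le> 1" by linarith+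
qed

section \<open>Integration by parts\<close>

text \<open>Convolving \<open>f\<close> with the indicator of a large ball gives a function that is
  constant near 0, namely the integral of \<open>f\<close>. Its derivative at 0 vanishes, yet equals
  the integral of the derivative after a reflection.\<close>

lemma integral_dir_deriv_real:
  fixes f :: "'a::euclidean_space \<Rightarrow> real"
  assumes f: "Ck 1 f" "bdd_supp f" and b: "b \<in> Basis"
  shows "(\<integral>x. dir_deriv b f x \<partial>lborel) = 0"
proof -
  obtain R where R: "\<And>x. R < norm x \<Longrightarrow> f x = 0" using f by (auto simp: bdd_supp_def)
  have R': "dir_deriv b f x = 0" if "R < norm x" for x
  proof -
    have "dir_deriv b f x = dir_deriv b (\<lambda>x. 0) x"
      using R that by (intro dir_deriv_cong_open[of "{x. R < norm x}"]) (auto intro!: open_Collect_less continuous_intros)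
    then show ?thesis by simp
  qed
  \<comment> \<open>Radius \<open>R + 1\<close> leaves room for shifting the support of
    \<open>f\<close> by a vector of norm less than 1.\<close>
  define h :: "'a \<Rightarrow> real" where "h = indicator (cball 0 (R+1))"
  have h: "integrable lborel h" unfolding h_def
    by (intro bdd_fun_integrable bdd_fun_indicator) auto
  have D: "conv h (dir_deriv b f) = dir_deriv b (conv h f)"
    by (rule dir_deriv_conv[OF h f b, symmetric])
  have fm: "f \<in> borel_measurable borel" "dir_deriv b f \<in> borel_measurable borel"
    using f(1) b by (auto intro!: borel_measurable_continuous_onI Ck_continuous[OF f(1)] Ck_continuous[of 0])
  have c: "conv h f x = (\<integral>x. f x \<partial>lborel)" if "x \<in> ball 0 1" for x
  proof -
    have "h y * f (x - y) = f (x - y)" for y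
    proof (cases "norm y \<le> R + 1")
      case False
      then have "R < norm (x - y)" using that norm_triangle_ineq2[of y x] by (simp add: norm_minus_commute)
      then show ?thesis by (simp add: R)
    qed (simp add: h_def)
    then have "conv h f x = (\<integral>y. f (x - y) \<partial>lborel)" unfolding conv_def by presburger
    then show ?thesis using lborel_integral_reflect[OF fm(1)] by simp
  qed
  have "dir_deriv b (conv h f) 0 = dir_deriv b (\<lambda>x. \<integral>x. f x \<partial>lborel) 0"
    by (rule dir_deriv_cong_open[of "ball 0 1"]) (use c in auto)
  then have "0 = conv h (dir_deriv b f) 0" by (simp add: D)
  also have "\<dots> = (\<integral>y. dir_deriv b f (0 - y) \<partial>lborel)"
  proof -
    have "h y * dir_deriv b f (0 - y) = dir_deriv b f (0 - y)" for y
      using R'[of "- y"] by (auto simp: h_def indicator_def)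
    then show ?thesis unfolding conv_def by presburger
  qed
  also have "\<dots> = (\<integral>y. dir_deriv b f y \<partial>lborel)" by (rule lborel_integral_reflect[OF fm(2)])
  finally show ?thesis by simp
qed

lemma bdd_supp_compose: "bdd_supp f \<Longrightarrow> L 0 = 0 \<Longrightarrow> bdd_supp (\<lambda>x. L (f x))"
  by (auto simp: bdd_supp_def) metis

lemma bdd_supp_scaleR1:
  fixes f :: "'a::real_normed_vector \<Rightarrow> real" and g :: "'a \<Rightarrow> 'b::real_normed_vector"
  assumes "bdd_supp f" shows "bdd_supp (\<lambda>x. f x *\<^sub>R g x)"
proof -
  obtain R where "\<forall>x. R < norm x \<longrightarrow> f x = 0" using assms by (auto simp: bdd_supp_def)
  then show ?thesis unfolding bdd_supp_def by (intro exI[of _ R]) simp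
qed

lemma bdd_supp_scaleR2:
  fixes f :: "'a::real_normed_vector \<Rightarrow> real" and g :: "'a \<Rightarrow> 'b::real_normed_vector"
  assumes "bdd_supp g" shows "bdd_supp (\<lambda>x. f x *\<^sub>R g x)"
proof -
  obtain R where "\<forall>x. R < norm x \<longrightarrow> g x = 0" using assms by (auto simp: bdd_supp_def)
  then show ?thesis unfolding bdd_supp_def by (intro exI[of _ R]) simp
qed

lemma integral_dir_deriv_Basis:
  fixes f :: "'a::euclidean_space \<Rightarrow> 'b::euclidean_space"
  assumes f: "Ck 1 f" "bdd_supp f" and b: "b \<in> Basis"
  shows "(\<integral>x. dir_deriv b f x \<partial>lborel) = 0"
proof (rule euclidean_eqI)
  fix i :: 'b assume i: "i \<in> Basis"
  have bl: "bounded_linear (\<lambda>y. y \<bullet> i)" by (rule bounded_linear_inner_left)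
  have int: "integrable lborel (dir_deriv b f)"
    using f b by (intro integrable_continuous_bdd_supp bdd_supp_dir_deriv) auto
  have "(\<integral>x. dir_deriv b f x \<partial>lborel) \<bullet> i = (\<integral>x. dir_deriv b f x \<bullet> i \<partial>lborel)"
    using int by simp
  also have "\<dots> = (\<integral>x. dir_deriv b (\<lambda>x. f x \<bullet> i) x \<partial>lborel)"
    using f(1) by (intro Bochner_Integration.integral_cong refl dir_deriv_bounded_linear[OF bl, symmetric]) simp
  also have "\<dots> = 0"
    by (intro integral_dir_deriv_real b Ck_bounded_linear[OF bl] f(1) bdd_supp_compose[of f "\<lambda>y. y \<bullet> i"] f(2)) simp
  finally show "(\<integral>x. dir_deriv b f x \<partial>lborel) \<bullet> i = 0 \<bullet> i" by simp
qed

text \<open>Directions outside the basis occur in \<open>layer_integral\<close>, where the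
  derivative is taken along the axis of a chart.\<close>

lemma integral_dir_deriv:
  fixes f :: "'a::euclidean_space \<Rightarrow> 'b::euclidean_space"
  assumes f: "Ck 1 f" "bdd_supp f"
  shows "(\<integral>x. dir_deriv v f x \<partial>lborel) = 0"
proof -
  have i: "integrable lborel (\<lambda>x. (v \<bullet> b) *\<^sub>R dir_deriv b f x)" if "b \<in> Basis" for b
    using f that by (intro integrable_scaleR_right integrable_continuous_bdd_supp bdd_supp_dir_deriv) auto
  have "(\<integral>x. dir_deriv v f x \<partial>lborel) = (\<integral>x. (\<Sum>b\<in>Basis. (v \<bullet> b) *\<^sub>R dir_deriv b f x) \<partial>lborel)"
    using f(1) by (subst dir_deriv_basis) auto
  also have "\<dots> = (\<Sum>b\<in>Basis. \<integral>x. (v \<bullet> b) *\<^sub>R dir_deriv b f x \<partial>lborel)"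
    by (rule Bochner_Integration.integral_sum) (rule i)
  also have "\<dots> = 0" by (simp add: integral_dir_deriv_Basis[OF f])
  finally show ?thesis .
qed

lemma integral_by_parts:
  fixes f :: "'a::euclidean_space \<Rightarrow> real" and g :: "'a \<Rightarrow> 'b::euclidean_space"
  assumes f: "Ck 1 f" and g: "Ck 1 g" and s: "bdd_supp f \<or> bdd_supp g" and b: "b \<in> Basis"
  shows "(\<integral>x. dir_deriv b f x *\<^sub>R g x \<partial>lborel) = - (\<integral>x. f x *\<^sub>R dir_deriv b g x \<partial>lborel)"
proof -
  have D: "dir_deriv b (\<lambda>x. f x *\<^sub>R g x) = (\<lambda>x. f x *\<^sub>R dir_deriv b g x + dir_deriv b f x *\<^sub>R g x)"
    using f g by (intro ext dir_deriv_scaleR) auto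
  have c: "continuous_on UNIV f" "continuous_on UNIV g" "continuous_on UNIV (dir_deriv b f)" "continuous_on UNIV (dir_deriv b g)"
    using Ck_continuous[OF f] Ck_continuous[OF g] f g b by auto
  have 1: "integrable lborel (\<lambda>x. f x *\<^sub>R dir_deriv b g x)"
    using s by (intro integrable_continuous_bdd_supp continuous_on_scaleR c)
      (auto intro: bdd_supp_scaleR1 bdd_supp_scaleR2 bdd_supp_dir_deriv)
  have 2: "integrable lborel (\<lambda>x. dir_deriv b f x *\<^sub>R g x)"
    using s by (intro integrable_continuous_bdd_supp continuous_on_scaleR c)
      (auto intro: bdd_supp_scaleR1 bdd_supp_scaleR2 bdd_supp_dir_deriv)
  have "(\<integral>x. dir_deriv b (\<lambda>x. f x *\<^sub>R g x) x \<partial>lborel) = 0"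
    using s by (intro integral_dir_deriv Ck_scaleR f g) (auto intro: bdd_supp_scaleR1 bdd_supp_scaleR2)
  then show ?thesis unfolding D using 1 2 by (simp add: add_eq_0_iff)
qed

section \<open>Test functions and weak gradients\<close>

lemma test_functionsI:
  assumes "\<And>k. Ck k f" "compact K" "K \<subseteq> \<Omega>" "\<And>x. x \<notin> K \<Longrightarrow> f x = 0"
  shows "f \<in> test_functions \<Omega>"
proof -
  have "closure {x. f x \<noteq> 0} \<subseteq> K"
    using assms(2,4) by (intro closure_minimal) (auto intro: compact_imp_closed)
  moreover from this have "compact (closure {x. f x \<noteq> 0})"
    using assms(2) by (metis closed_closure compact_Int_closed inf.absorb2)
  ultimately show ?thesis using assms by (auto simp: test_functions_def)
qed

lemma test_functionsD:
  assumes "f \<in> test_functions \<Omega>"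
  shows "Ck k f" "x \<notin> \<Omega> \<Longrightarrow> f x = 0" "bdd_supp f"
proof -
  show "Ck k f" using assms by (auto simp: test_functions_def)
  show "x \<notin> \<Omega> \<Longrightarrow> f x = 0" using assms closure_subset[of "{x. f x \<noteq> 0}"] by (auto simp: test_functions_def)
  have "bounded (closure {x. f x \<noteq> 0})" using assms by (auto simp: test_functions_def intro: compact_imp_bounded)
  then obtain R where "\<And>x. x \<in> closure {x. f x \<noteq> 0} \<Longrightarrow> norm x \<le> R" by (auto simp: bounded_iff)
  then show "bdd_supp f" unfolding bdd_supp_def using closure_subset[of "{x. f x \<noteq> 0}"]
    by (intro exI[of _ R]) (fastforce simp: not_le[symmetric])
qed

lemma test_functions_dir_deriv_outside:
  assumes "f \<in> test_functions \<Omega>" "x \<notin> \<Omega>"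
  shows "dir_deriv b f x = 0"
proof -
  have "dir_deriv b f x = dir_deriv b (\<lambda>x. 0) x"
  proof (rule dir_deriv_cong_open[of "- closure {x. f x \<noteq> 0}"])
    show "x \<in> - closure {x. f x \<noteq> 0}" using assms by (auto simp: test_functions_def)
    show "f y = 0" if "y \<in> - closure {x. f x \<noteq> 0}" for y
      using that closure_subset[of "{x. f x \<noteq> 0}"] by auto
  qed auto
  then show ?thesis by simp
qed

text \<open>The calculus so far lives on the whole space with \<open>lborel\<close>; functions that
  vanish off the domain carry it over to the integrals of the weak formulation.\<close>

lemma integral_lebesgue_on_lborel:
  fixes f :: "'a::euclidean_space \<Rightarrow> 'b::euclidean_space"
  assumes "open \<Omega>" "continuous_on UNIV f" "\<And>x. x \<notin> \<Omega> \<Longrightarrow> f x = 0"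
  shows "integral\<^sup>L (lebesgue_on \<Omega>) f = (\<integral>x. f x \<partial>lborel)"
proof -
  have "integral\<^sup>L (lebesgue_on \<Omega>) f = integral\<^sup>L lebesgue (\<lambda>x. indicator \<Omega> x *\<^sub>R f x)"
    using assms(1) by (intro integral_restrict_space) auto
  also have "(\<lambda>x. indicator \<Omega> x *\<^sub>R f x) = f" using assms(3) by (auto simp: indicator_def fun_eq_iff)
  also have "integral\<^sup>L lebesgue f = (\<integral>x. f x \<partial>lborel)"
    using assms(2) by (intro integral_completion) (auto intro: borel_measurable_continuous_onI)
  finally show ?thesis .
qed

section \<open>Integrability and L^2 over a bounded open set\<close>

lemma continuous_measurable_lebesgue_on:
  fixes f :: "'a::euclidean_space \<Rightarrow> 'b::euclidean_space"
  assumes "continuous_on UNIV f"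
  shows "f \<in> borel_measurable (lebesgue_on \<Omega>)"
  using assms by (intro measurable_restrict_space1 measurable_completion) (auto intro: borel_measurable_continuous_onI)

lemma finite_lebesgue_on:
  fixes \<Omega> :: "'a::euclidean_space set"
  assumes "open \<Omega>" "bounded \<Omega>" shows "finite_measure (lebesgue_on \<Omega>)"
  using assms by (intro finite_measure_lebesgue_on lmeasurable_open)

lemma continuous_bounded_on:
  fixes f :: "'a::euclidean_space \<Rightarrow> 'b::real_normed_vector"
  assumes "continuous_on UNIV f" "bounded \<Omega>"
  obtains M where "M > 0" "\<And>x. x \<in> \<Omega> \<Longrightarrow> norm (f x) \<le> M"
proof -
  have "bounded (f ` closure \<Omega>)"
    using assms by (intro compact_imp_bounded compact_continuous_image) (auto intro: continuous_on_subset)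
  then obtain M where "M > 0" "\<And>x. x \<in> closure \<Omega> \<Longrightarrow> norm (f x) \<le> M" by (auto simp: bounded_pos)
  then show ?thesis using closure_subset[of \<Omega>] by (intro that[of M]) auto
qed

lemma integrable_bounded_lebesgue_on:
  fixes f :: "'a::euclidean_space \<Rightarrow> 'b::euclidean_space"
  assumes "open \<Omega>" "bounded \<Omega>" "f \<in> borel_measurable (lebesgue_on \<Omega>)" "\<And>x. x \<in> \<Omega> \<Longrightarrow> norm (f x) \<le> M"
  shows "integrable (lebesgue_on \<Omega>) f"
  using assms by (intro finite_measure.integrable_const_bound[OF finite_lebesgue_on, of \<Omega> _ M]) (auto intro!: AE_I2)

lemma integrable_continuous_lebesgue_on:
  fixes f :: "'a::euclidean_space \<Rightarrow> 'b::euclidean_space"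
  assumes "open \<Omega>" "bounded \<Omega>" "continuous_on UNIV f"
  shows "integrable (lebesgue_on \<Omega>) f"
  using continuous_bounded_on[OF assms(3,2)] integrable_bounded_lebesgue_on[OF assms(1,2) continuous_measurable_lebesgue_on[OF assms(3)]]
  by metis

lemma continuous_L2:
  fixes f :: "'a::euclidean_space \<Rightarrow> 'b::euclidean_space"
  assumes "open \<Omega>" "bounded \<Omega>" "continuous_on UNIV f"
  shows "f \<in> L2 \<Omega>"
proof -
  have "continuous_on UNIV (\<lambda>x. (norm (f x))\<^sup>2)" by (intro continuous_intros assms)
  then show ?thesis
    using continuous_measurable_lebesgue_on[OF assms(3)] integrable_continuous_lebesgue_on[OF assms(1,2)]
    by (auto simp: L2_def)
qed

lemma L2_integrable:
  fixes f :: "'a::euclidean_space \<Rightarrow> 'b::euclidean_space"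
  assumes "open \<Omega>" "bounded \<Omega>" "f \<in> L2 \<Omega>"
  shows "integrable (lebesgue_on \<Omega>) f"
proof (rule Bochner_Integration.integrable_bound)
  interpret finite_measure "lebesgue_on \<Omega>" using finite_lebesgue_on assms by blast
  show "integrable (lebesgue_on \<Omega>) (\<lambda>x. 1 + (norm (f x))\<^sup>2)" using assms(3) by (auto simp: L2_def)
  have "t \<le> 1 + t\<^sup>2" for t :: real using sum_squares_bound[of t 1] by (simp add: power2_eq_square)
      (smt (verit) zero_le_square)
  then show "AE x in lebesgue_on \<Omega>. norm (f x) \<le> norm (1 + (norm (f x))\<^sup>2)"
    by (intro AE_I2) (metis abs_ge_self order_trans real_norm_def)
qed (use assms in \<open>auto simp: L2_def\<close>)

lemma L2_diff:
  fixes f g :: "'a::euclidean_space \<Rightarrow> 'b::euclidean_space"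
  assumes "f \<in> L2 \<Omega>" "g \<in> L2 \<Omega>"
  shows "(\<lambda>x. f x - g x) \<in> L2 \<Omega>"
proof -
  have [measurable]: "f \<in> borel_measurable (lebesgue_on \<Omega>)" "g \<in> borel_measurable (lebesgue_on \<Omega>)"
    using assms by (auto simp: L2_def)
  have "integrable (lebesgue_on \<Omega>) (\<lambda>x. (norm (f x - g x))\<^sup>2)"
  proof (rule Bochner_Integration.integrable_bound)
    show "integrable (lebesgue_on \<Omega>) (\<lambda>x. 2 * (norm (f x))\<^sup>2 + 2 * (norm (g x))\<^sup>2)"
      using assms by (auto simp: L2_def)
    have "(norm (f x - g x))\<^sup>2 \<le> 2 * (norm (f x))\<^sup>2 + 2 * (norm (g x))\<^sup>2" for x
    proof -
      have "(norm (f x - g x))\<^sup>2 \<le> (norm (f x) + norm (g x))\<^sup>2" by (intro power_mono norm_triangle_ineq4) auto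
      also have "\<dots> \<le> 2 * (norm (f x))\<^sup>2 + 2 * (norm (g x))\<^sup>2"
        using sum_squares_bound[of "norm (f x)" "norm (g x)"] by (simp add: power2_sum)
      finally show ?thesis .
    qed
    then show "AE x in lebesgue_on \<Omega>. norm ((norm (f x - g x))\<^sup>2) \<le> norm (2 * (norm (f x))\<^sup>2 + 2 * (norm (g x))\<^sup>2)"
      by (intro AE_I2) simp
  qed measurable
  then show ?thesis by (auto simp: L2_def)
qed

lemma integrable_scaleR_bounded:
  fixes f :: "'a::euclidean_space \<Rightarrow> 'b::euclidean_space" and g :: "'a \<Rightarrow> real"
  assumes "bounded \<Omega>" "continuous_on UNIV g" "integrable (lebesgue_on \<Omega>) f"
  shows "integrable (lebesgue_on \<Omega>) (\<lambda>x. g x *\<^sub>R f x)"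
proof -
  obtain M where M: "M > 0" "\<And>x. x \<in> \<Omega> \<Longrightarrow> norm (g x) \<le> M" using continuous_bounded_on[OF assms(2,1)] by blast
  have [measurable]: "g \<in> borel_measurable (lebesgue_on \<Omega>)" by (rule continuous_measurable_lebesgue_on[OF assms(2)])
  have [measurable]: "f \<in> borel_measurable (lebesgue_on \<Omega>)" using assms(3) by auto
  show ?thesis
  proof (rule Bochner_Integration.integrable_bound)
    show "integrable (lebesgue_on \<Omega>) (\<lambda>x. M *\<^sub>R f x)" using assms(3) by simp
    show "AE x in lebesgue_on \<Omega>. norm (g x *\<^sub>R f x) \<le> norm (M *\<^sub>R f x)"
      using M by (intro AE_I2) (auto intro!: mult_right_mono)
  qed measurable
qed

text \<open>Mollify at scale \<open>r m\<close> the indicator of the closed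
  \<open>r m\<close>-neighbourhood of \<open>K\<close>: thickening first keeps the value 1 on
  \<open>K\<close> exact, and the result vanishes beyond distance \<open>2 * r m\<close>. Only from
  some \<open>N\<close> on does this neighbourhood fit into the open set. The lemma also supplies
  single cutoffs, for charts and for the whole domain.\<close>

lemma indicator_compact_approx:
  fixes K :: "'a::euclidean_space set"
  assumes K: "compact K" "K \<subseteq> \<Omega>" "K \<noteq> {}" and \<Omega>: "open \<Omega>"
  obtains \<psi> :: "nat \<Rightarrow> 'a \<Rightarrow> real" and N where "\<And>m. m \<ge> N \<Longrightarrow> \<psi> m \<in> test_functions \<Omega>"
    "\<And>m x. 0 \<le> \<psi> m x" "\<And>m x. \<psi> m x \<le> 1" "\<And>m x. x \<in> K \<Longrightarrow> \<psi> m x = 1"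
    "\<And>x. (\<lambda>m. \<psi> m x) \<longlonglongrightarrow> indicator K x"
proof -
  define r where "r m = inverse (real (Suc m))" for m
  have r: "r m > 0" for m by (simp add: r_def)
  define S where "S m = {x. infdist x K \<le> r m}" for m
  define \<psi> where "\<psi> m = moll (r m) (indicator (S m))" for m
  have clS: "compact {x. infdist x K \<le> e}" if "e > 0" for e
    using compact_infdist_le[OF K(3,1) that] by simp
  have S: "S m \<in> sets borel" "bounded (S m)" for m
    using clS[OF r[of m]] unfolding S_def by (auto intro: compact_imp_closed borel_closed compact_imp_bounded)
  obtain e where e: "e > 0" "{x. infdist x K \<le> e} \<subseteq> \<Omega>"
    using compact_in_open_separated[OF K(3,1) \<Omega> K(2)] .
  have rlim: "r \<longlonglongrightarrow> 0" unfolding r_def by (rule LIMSEQ_inverse_real_of_nat)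
  have zero: "\<psi> m x = 0" if "infdist x K > 2 * r m" for m x
    unfolding \<psi>_def
  proof (rule moll_eq[OF bdd_fun_indicator[OF S] r])
    fix y assume "norm (y - x) < r m"
    then have "infdist y K > r m" using that infdist_triangle[of x K y] by (simp add: dist_norm norm_minus_commute)
    then show "indicator (S m) y = (0::real)" by (simp add: S_def indicator_def)
  qed
  have one: "\<psi> m x = 1" if "x \<in> K" for m x
    unfolding \<psi>_def
  proof (rule moll_eq[OF bdd_fun_indicator[OF S] r])
    fix y assume "norm (y - x) < r m"
    then have "infdist y K \<le> r m" using that infdist_le[of x K y] by (simp add: dist_norm)
    then show "indicator (S m) y = (1::real)" by (simp add: S_def indicator_def)
  qed
  have small: "\<exists>N. \<forall>m\<ge>N. 2 * r m < d" if "d > 0" for d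
  proof -
    have "\<forall>\<^sub>F m in sequentially. r m < d / 2" using order_tendstoD(2)[OF rlim, of "d/2"] that by simp
    then show ?thesis unfolding eventually_sequentially by (metis less_divide_eq_numeral1(1) mult.commute)
  qed
  obtain N where N: "\<And>m. m \<ge> N \<Longrightarrow> 2 * r m < e" using small[OF e(1)] by blast
  show ?thesis
  proof
    show "\<psi> m \<in> test_functions \<Omega>" if "m \<ge> N" for m
    proof (rule test_functionsI[OF _ clS[OF e(1)] e(2)])
      show "Ck k (\<psi> m)" for k unfolding \<psi>_def by (rule Ck_moll[OF bdd_fun_indicator[OF S] r])
      show "\<psi> m x = 0" if "x \<notin> {x. infdist x K \<le> e}" for x
        using that N[OF \<open>m \<ge> N\<close>] by (intro zero) auto
    qed
    show "0 \<le> \<psi> m x" "\<psi> m x \<le> 1" for m x unfolding \<psi>_def by (rule moll_indicator_range[OF S r])+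
    show "\<psi> m x = 1" if "x \<in> K" for m x by (rule one[OF that])
    show "(\<lambda>m. \<psi> m x) \<longlonglongrightarrow> indicator K x" for x
    proof (cases "x \<in> K")
      case True then show ?thesis by (simp add: one)
    next
      case False
      then have "infdist x K > 0"
        using K(1,3) by (metis compact_imp_closed in_closed_iff_infdist_zero infdist_nonneg less_le)
      then obtain M where "\<And>m. m \<ge> M \<Longrightarrow> 2 * r m < infdist x K" using small by blast
      then have "\<forall>\<^sub>F m in sequentially. \<psi> m x = 0"
        unfolding eventually_sequentially using zero by blast
      then show ?thesis using False by (simp add: tendsto_eventually)
    qed
  qed
qed

text \<open>On a compact \<open>K\<close> inside the set where \<open>g > 0\<close>, test functions
  tending to the indicator show that the integral of \<open>g\<close> over \<open>K\<close> is 0, so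
  \<open>K\<close> is null. Inner regularity then makes the whole set null.\<close>

lemma fundamental_lemma_nonpos:
  fixes g :: "'a::euclidean_space \<Rightarrow> real"
  assumes \<Omega>: "open \<Omega>" "bounded \<Omega>" and g: "integrable (lebesgue_on \<Omega>) g"
    and 0: "\<And>\<psi>. \<psi> \<in> test_functions \<Omega> \<Longrightarrow> integral\<^sup>L (lebesgue_on \<Omega>) (\<lambda>x. \<psi> x * g x) = 0"
  shows "AE x in lebesgue_on \<Omega>. g x \<le> 0"
proof -
  have [measurable]: "g \<in> borel_measurable (lebesgue_on \<Omega>)" using g by auto
  define A where "A = {x \<in> \<Omega>. g x > 0}"
  have A: "A \<in> sets (lebesgue_on \<Omega>)" unfolding A_def
    using measurable_sets_Collect[of "\<lambda>x. g x > 0" "lebesgue_on \<Omega>"] by auto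
  then have A': "A \<in> sets lebesgue"
    using \<Omega>(1) by (metis borel_open inf_top.right_neutral sets_completionI_sets sets_lborel sets_restrict_space_iff space_borel space_completion space_lborel)
  have null: "emeasure lebesgue K = 0" if K: "compact K" "K \<subseteq> A" for K
  proof (cases "K = {}")
    case False
    have KO: "K \<subseteq> \<Omega>" using K(2) by (auto simp: A_def)
    obtain \<psi> :: "nat \<Rightarrow> 'a \<Rightarrow> real" and N where \<psi>: "\<And>m. m \<ge> N \<Longrightarrow> \<psi> m \<in> test_functions \<Omega>"
      "\<And>m x. 0 \<le> \<psi> m x" "\<And>m x. \<psi> m x \<le> 1" "\<And>x. (\<lambda>m. \<psi> m x) \<longlonglongrightarrow> indicator K x"
      using indicator_compact_approx[OF K(1) KO False \<Omega>(1)] by metis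
    have Kl: "K \<in> sets lebesgue" using K(1) by (simp add: compact_imp_closed)
    have [measurable]: "K \<in> sets (lebesgue_on \<Omega>)"
      using KO Kl \<Omega>(1) by (simp add: sets_restrict_space_iff)
    have "(\<lambda>m. integral\<^sup>L (lebesgue_on \<Omega>) (\<lambda>x. \<psi> (m + N) x * g x)) \<longlonglongrightarrow>
        integral\<^sup>L (lebesgue_on \<Omega>) (\<lambda>x. indicator K x * g x)"
    proof (rule integral_dominated_convergence[where w="\<lambda>x. \<bar>g x\<bar>"])
      show "(\<lambda>x. \<psi> (m + N) x * g x) \<in> borel_measurable (lebesgue_on \<Omega>)" for m
        using continuous_measurable_lebesgue_on[OF Ck_continuous[OF test_functionsD(1)[OF \<psi>(1), of "m+N" 0]]] by auto
      show "AE x in lebesgue_on \<Omega>. (\<lambda>m. \<psi> (m + N) x * g x) \<longlonglongrightarrow> indicator K x * g x"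
        using \<psi>(4) by (intro AE_I2 tendsto_mult tendsto_const LIMSEQ_ignore_initial_segment)
      show "AE x in lebesgue_on \<Omega>. norm (\<psi> (m + N) x * g x) \<le> \<bar>g x\<bar>" for m
        using \<psi>(2,3) by (intro AE_I2) (simp add: abs_mult mult_left_le_one_le)
    qed (use g in auto)
    moreover have "integral\<^sup>L (lebesgue_on \<Omega>) (\<lambda>x. \<psi> (m + N) x * g x) = 0" for m
      by (intro 0 \<psi>(1)) simp
    ultimately have I: "integral\<^sup>L (lebesgue_on \<Omega>) (\<lambda>x. indicator K x * g x) = 0"
      by (simp add: LIMSEQ_const_iff)
    have int: "integrable (lebesgue_on \<Omega>) (\<lambda>x. indicator K x * g x)"
      using integrable_real_mult_indicator[OF _ g, of K] by (simp add: mult.commute)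
    have "AE x in lebesgue_on \<Omega>. 0 \<le> indicator K x * g x"
      using K(2) by (intro AE_I2) (auto simp: indicator_def A_def)
    then have "AE x in lebesgue_on \<Omega>. indicator K x * g x = 0"
      using integral_nonneg_eq_0_iff_AE[OF int] I by blast
    then have "AE x in lebesgue_on \<Omega>. x \<notin> K"
      by eventually_elim (use K(2) in \<open>auto simp: A_def indicator_def\<close>)
    then have "emeasure (lebesgue_on \<Omega>) K = 0"
      using KO by (subst (asm) AE_iff_measurable[where N=K]) auto
    then show ?thesis using KO Kl \<Omega>(1) by (simp add: emeasure_restrict_space)
  qed simp
  have "emeasure lebesgue A = 0"
  proof (rule ccontr)
    assume "emeasure lebesgue A \<noteq> 0"
    moreover have "A \<in> lmeasurable" using A' \<Omega>(2) by (intro bounded_set_imp_lmeasurable) (auto simp: A_def intro: bounded_subset)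
    ultimately have pos: "measure lebesgue A > 0"
      by (metis emeasure_eq_measure2 ennreal_0 fmeasurableD2 measure_nonneg order_le_less)
    \<comment> \<open>The tolerance is the measure of \<open>A\<close> itself: \<open>T\<close> is
      compact, hence null, so removing it cannot lower the measure, a contradiction.\<close>
    obtain T where T: "closed T" "T \<subseteq> A" "A - T \<in> lmeasurable" "emeasure lebesgue (A - T) < ennreal (measure lebesgue A)"
      using sets_lebesgue_inner_closed[OF A' pos] .
    have "compact T" using T(1,2) \<Omega>(2) by (auto simp: compact_eq_bounded_closed A_def intro: bounded_subset)
    then have "emeasure lebesgue T = 0" using null T(2) by blast
    then have "emeasure lebesgue A = emeasure lebesgue (A - T)"
      using A' T(1) by (subst emeasure_Diff_null_set) auto
    also have "\<dots> < emeasure lebesgue A"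
      using T(4) \<open>A \<in> lmeasurable\<close> by (simp add: emeasure_eq_measure2 fmeasurableD2)
    finally show False by simp
  qed
  then have "emeasure (lebesgue_on \<Omega>) A = 0"
    using \<Omega>(1) by (subst emeasure_restrict_space) (auto simp: A_def)
  then show ?thesis by (intro AE_I[of _ _ A]) (use A in \<open>auto simp: A_def\<close>)
qed

lemma fundamental_lemma:
  fixes g :: "'a::euclidean_space \<Rightarrow> 'b::euclidean_space"
  assumes \<Omega>: "open \<Omega>" "bounded \<Omega>" and g: "integrable (lebesgue_on \<Omega>) g"
    and 0: "\<And>\<psi>. \<psi> \<in> test_functions \<Omega> \<Longrightarrow> integral\<^sup>L (lebesgue_on \<Omega>) (\<lambda>x. \<psi> x *\<^sub>R g x) = 0"
  shows "AE x in lebesgue_on \<Omega>. g x = 0"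
proof -
  have "AE x in lebesgue_on \<Omega>. g x \<bullet> i = 0" if "i \<in> Basis" for i
  proof -
    have eq: "integral\<^sup>L (lebesgue_on \<Omega>) (\<lambda>x. \<psi> x * (g x \<bullet> i)) = 0" if \<psi>: "\<psi> \<in> test_functions \<Omega>" for \<psi>
    proof -
      have int: "integrable (lebesgue_on \<Omega>) (\<lambda>x. \<psi> x *\<^sub>R g x)"
        by (rule integrable_scaleR_bounded[OF \<Omega>(2) Ck_continuous[OF test_functionsD(1)[OF \<psi>, of 0]] g])
      have "integral\<^sup>L (lebesgue_on \<Omega>) (\<lambda>x. (\<psi> x *\<^sub>R g x) \<bullet> i) = 0"
        using int 0[OF \<psi>] by (subst integral_inner_left) auto
      then show ?thesis by simp
    qed
    have "AE x in lebesgue_on \<Omega>. g x \<bullet> i \<le> 0"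
      by (rule fundamental_lemma_nonpos[OF \<Omega>]) (use g eq in auto)
    moreover have "AE x in lebesgue_on \<Omega>. - (g x \<bullet> i) \<le> 0"
      by (rule fundamental_lemma_nonpos[OF \<Omega>]) (use g eq in auto)
    ultimately show ?thesis by eventually_elim simp
  qed
  then have "AE x in lebesgue_on \<Omega>. \<forall>i\<in>Basis. g x \<bullet> i = 0"
    by (intro AE_finite_allI) auto
  then show ?thesis by eventually_elim (auto intro: euclidean_eqI)
qed

text \<open>\<open>weak_grad\<close> is an arbitrary choice among representatives. Uniqueness almost
  everywhere allows replacing it by a classical gradient under integrals and in
  \<open>H1_norm\<close>.\<close>

lemma has_weak_grad_unique:
  assumes \<Omega>: "open \<Omega>" "bounded \<Omega>" and G: "has_weak_grad \<Omega> u G" "has_weak_grad \<Omega> u G'"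
  shows "AE x in lebesgue_on \<Omega>. G x = G' x"
proof -
  have L: "G \<in> L2 \<Omega>" "G' \<in> L2 \<Omega>" using G by (auto simp: has_weak_grad_def)
  note int = L2_integrable[OF \<Omega> L(1)] L2_integrable[OF \<Omega> L(2)]
  have bl: "bounded_linear (\<lambda>x. x $ i)" for i by (rule bounded_linear_vec_nth)
  have "AE x in lebesgue_on \<Omega>. G x $ i - G' x $ i = 0" for i
  proof (rule fundamental_lemma[OF \<Omega>])
    note int' = integrable_bounded_linear[OF bl[of i] int(1)] integrable_bounded_linear[OF bl[of i] int(2)]
    show "integrable (lebesgue_on \<Omega>) (\<lambda>x. G x $ i - G' x $ i)" using int' by simp
    fix \<psi> :: "real^'a \<Rightarrow> real" assume \<psi>: "\<psi> \<in> test_functions \<Omega>"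
    note c = Ck_continuous[OF test_functionsD(1)[OF \<psi>, of 0]]
    have "integral\<^sup>L (lebesgue_on \<Omega>) (\<lambda>x. \<psi> x *\<^sub>R (G x $ i)) = integral\<^sup>L (lebesgue_on \<Omega>) (\<lambda>x. \<psi> x *\<^sub>R (G' x $ i))"
    proof -
      let ?A = "integral\<^sup>L (lebesgue_on \<Omega>) (\<lambda>x. dir_deriv (axis i 1) \<psi> x *\<^sub>R u x)"
      have "?A = - integral\<^sup>L (lebesgue_on \<Omega>) (\<lambda>x. \<psi> x *\<^sub>R (G x $ i))"
        using G(1) \<psi> unfolding has_weak_grad_def by blast
      moreover have "?A = - integral\<^sup>L (lebesgue_on \<Omega>) (\<lambda>x. \<psi> x *\<^sub>R (G' x $ i))"
        using G(2) \<psi> unfolding has_weak_grad_def by blast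
      ultimately show ?thesis by simp
    qed
    then show "integral\<^sup>L (lebesgue_on \<Omega>) (\<lambda>x. \<psi> x *\<^sub>R (G x $ i - G' x $ i)) = 0"
      unfolding scaleR_diff_right
      using integrable_scaleR_bounded[OF \<Omega>(2) c int'(1)] integrable_scaleR_bounded[OF \<Omega>(2) c int'(2)] by simp
  qed
  then have "AE x in lebesgue_on \<Omega>. \<forall>i\<in>UNIV. G x $ i - G' x $ i = 0"
    by (intro AE_finite_allI) auto
  then show ?thesis by eventually_elim (simp add: vec_eq_iff)
qed

lemma weak_grad_AE:
  assumes "open \<Omega>" "bounded \<Omega>" "has_weak_grad \<Omega> u G"
  shows "AE x in lebesgue_on \<Omega>. weak_grad \<Omega> u x = G x"
  using assms has_weak_grad_unique someI[of "has_weak_grad \<Omega> u"] unfolding weak_grad_def by blast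

lemma weak_grad_works: "u \<in> H1 \<Omega> \<Longrightarrow> has_weak_grad \<Omega> u (weak_grad \<Omega> u)"
  unfolding H1_def weak_grad_def using someI[of "has_weak_grad \<Omega> u"] by blast

lemma has_weak_grad_diff:
  assumes \<Omega>: "open \<Omega>" "bounded \<Omega>" and u: "u \<in> L2 \<Omega>" "v \<in> L2 \<Omega>"
    and G: "has_weak_grad \<Omega> u G" "has_weak_grad \<Omega> v H"
  shows "has_weak_grad \<Omega> (\<lambda>x. u x - v x) (\<lambda>x. G x - H x)"
proof -
  have L: "G \<in> L2 \<Omega>" "H \<in> L2 \<Omega>" using G by (auto simp: has_weak_grad_def)
  note intG = L2_integrable[OF \<Omega> L(1)] L2_integrable[OF \<Omega> L(2)]
  note intu = L2_integrable[OF \<Omega> u(1)] L2_integrable[OF \<Omega> u(2)]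
  have bl: "bounded_linear (\<lambda>x. x $ i)" for i by (rule bounded_linear_vec_nth)
  show ?thesis unfolding has_weak_grad_def
  proof (intro conjI ballI allI L2_diff L)
    fix \<psi> :: "real^'a \<Rightarrow> real" and i assume \<psi>: "\<psi> \<in> test_functions \<Omega>"
    note c = Ck_continuous[OF test_functionsD(1)[OF \<psi>, of 0]]
    have c': "continuous_on UNIV (dir_deriv (axis i 1) \<psi>)"
      using test_functionsD(1)[OF \<psi>, of 1] by (auto simp: axis_in_Basis_iff)
    note int' = integrable_bounded_linear[OF bl[of i] intG(1)] integrable_bounded_linear[OF bl[of i] intG(2)]
    show "integral\<^sup>L (lebesgue_on \<Omega>) (\<lambda>x. dir_deriv (axis i 1) \<psi> x *\<^sub>R (u x - v x)) =
        - integral\<^sup>L (lebesgue_on \<Omega>) (\<lambda>x. \<psi> x *\<^sub>R (G x - H x) $ i)"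
      unfolding scaleR_diff_right vector_minus_component
      using G \<psi> integrable_scaleR_bounded[OF \<Omega>(2) c int'(1)] integrable_scaleR_bounded[OF \<Omega>(2) c int'(2)]
        integrable_scaleR_bounded[OF \<Omega>(2) c' intu(1)] integrable_scaleR_bounded[OF \<Omega>(2) c' intu(2)]
      by (simp add: has_weak_grad_def)
  qed
qed

definition grad :: "(real^'n \<Rightarrow> complex^'n) \<Rightarrow> real^'n \<Rightarrow> complex^'n^'n" where
  "grad u x = (\<chi> i. dir_deriv (axis i 1) u x)"

lemma continuous_grad: "Ck 1 u \<Longrightarrow> continuous_on S (grad u)"
  unfolding grad_def[abs_def]
  by (rule continuous_on_subset[OF _ subset_UNIV], rule continuous_on_vec_lambda) auto

lemma has_weak_grad_grad:
  assumes \<Omega>: "open \<Omega>" "bounded \<Omega>" and u: "Ck 1 u"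
  shows "has_weak_grad \<Omega> u (grad u)"
  unfolding has_weak_grad_def
proof (intro conjI ballI allI)
  show "grad u \<in> L2 \<Omega>" by (intro continuous_L2 \<Omega> continuous_grad u)
  fix \<psi> :: "real^'a \<Rightarrow> real" and i assume \<psi>: "\<psi> \<in> test_functions \<Omega>"
  have b: "axis i 1 \<in> (Basis :: (real^'a) set)" by (simp add: axis_in_Basis_iff)
  have c: "continuous_on UNIV (\<lambda>x. dir_deriv (axis i 1) \<psi> x *\<^sub>R u x)" "continuous_on UNIV (\<lambda>x. \<psi> x *\<^sub>R dir_deriv (axis i 1) u x)"
    using test_functionsD(1)[OF \<psi>, of 1] test_functionsD(1)[OF \<psi>, of 0] u b Ck_continuous[OF u]
    by (auto intro!: continuous_on_scaleR)
  have "integral\<^sup>L (lebesgue_on \<Omega>) (\<lambda>x. dir_deriv (axis i 1) \<psi> x *\<^sub>R u x) = (\<integral>x. dir_deriv (axis i 1) \<psi> x *\<^sub>R u x \<partial>lborel)"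
    by (rule integral_lebesgue_on_lborel[OF \<Omega>(1) c(1)]) (simp add: test_functions_dir_deriv_outside[OF \<psi>])
  also have "\<dots> = - (\<integral>x. \<psi> x *\<^sub>R dir_deriv (axis i 1) u x \<partial>lborel)"
    by (rule integral_by_parts) (use test_functionsD[OF \<psi>] u b in auto)
  also have "\<dots> = - integral\<^sup>L (lebesgue_on \<Omega>) (\<lambda>x. \<psi> x *\<^sub>R dir_deriv (axis i 1) u x)"
    by (subst integral_lebesgue_on_lborel[OF \<Omega>(1) c(2)]) (simp_all add: test_functionsD(2)[OF \<psi>])
  finally show "integral\<^sup>L (lebesgue_on \<Omega>) (\<lambda>x. dir_deriv (axis i 1) \<psi> x *\<^sub>R u x) =
      - integral\<^sup>L (lebesgue_on \<Omega>) (\<lambda>x. \<psi> x *\<^sub>R grad u x $ i)"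
    by (simp add: grad_def)
qed

lemma L2_norm_cong_AE:
  assumes "AE x in lebesgue_on \<Omega>. f x = g x" "f \<in> L2 \<Omega>" "g \<in> L2 \<Omega>"
  shows "L2_norm \<Omega> f = L2_norm \<Omega> g"
  unfolding L2_norm_def using assms
  by (intro arg_cong[where f=sqrt] integral_cong_AE) (auto simp: L2_def)

lemma H1_norm_eq:
  assumes "open \<Omega>" "bounded \<Omega>" "has_weak_grad \<Omega> u G"
  shows "H1_norm \<Omega> u = sqrt ((L2_norm \<Omega> u)\<^sup>2 + (L2_norm \<Omega> G)\<^sup>2)"
proof -
  have "has_weak_grad \<Omega> u (weak_grad \<Omega> u)" using someI[of "has_weak_grad \<Omega> u" G, OF assms(3)] by (simp add: weak_grad_def)
  then have "L2_norm \<Omega> (weak_grad \<Omega> u) = L2_norm \<Omega> G"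
    using assms weak_grad_AE by (intro L2_norm_cong_AE) (auto simp: has_weak_grad_def)
  then show ?thesis by (simp add: H1_norm_def)
qed

section \<open>Approximation by test functions\<close>

lemma onorm_dir_deriv_le:
  fixes f :: "'a::euclidean_space \<Rightarrow> real" and M :: real
  assumes "f differentiable (at x)" "\<And>b. b \<in> Basis \<Longrightarrow> \<bar>dir_deriv b f x\<bar> \<le> M"
  shows "onorm (\<lambda>v. dir_deriv v f x) \<le> DIM('a) * M"
proof (rule onorm_le)
  fix v
  have "norm (dir_deriv v f x) = \<bar>\<Sum>b\<in>Basis. (v \<bullet> b) * dir_deriv b f x\<bar>"
    by (subst dir_deriv_basis[OF assms(1)]) simp
  also have "\<dots> \<le> (\<Sum>b\<in>(Basis::'a set). norm v * M)"
    by (rule order_trans[OF sum_abs], rule sum_mono)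
      (auto simp: abs_mult intro!: mult_mono Basis_le_norm assms)
  finally show "norm (dir_deriv v f x) \<le> DIM('a) * M * norm v" by (simp add: mult_ac)
qed

lemma C1_bound:
  fixes f :: "'a::euclidean_space \<Rightarrow> real"
  assumes f: "Ck 1 f" and S: "bounded S"
  obtains M where "M \<ge> 0" "\<And>b x. b \<in> Basis \<Longrightarrow> x \<in> S \<Longrightarrow> \<bar>dir_deriv b f x\<bar> \<le> M"
proof -
  have "\<exists>M. \<forall>x\<in>S. \<bar>dir_deriv b f x\<bar> \<le> M" if "b \<in> Basis" for b
  proof -
    have "continuous_on UNIV (dir_deriv b f)" using f that by simp
    from continuous_bounded_on[OF this S] show ?thesis by (metis real_norm_def)
  qed
  then obtain M where M: "\<And>b x. b \<in> Basis \<Longrightarrow> x \<in> S \<Longrightarrow> \<bar>dir_deriv b f x\<bar> \<le> M b" by metis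
  show ?thesis
  proof
    show "(\<Sum>b\<in>Basis. \<bar>M b\<bar>) \<ge> 0" by (simp add: sum_nonneg)
    fix b :: 'a and x assume "b \<in> Basis" "x \<in> S"
    then show "\<bar>dir_deriv b f x\<bar> \<le> (\<Sum>b\<in>Basis. \<bar>M b\<bar>)"
      using M[of b x] member_le_sum[of b Basis "\<lambda>b. \<bar>M b\<bar>"] by fastforce
  qed
qed

text \<open>For use on a ball around the closure of the domain: the mean value theorem needs a
  convex set, and the domain may not be convex.\<close>

lemma C1_Lipschitz_cball:
  fixes f :: "'a::euclidean_space \<Rightarrow> real"
  assumes f: "Ck 1 f"
  obtains L where "L \<ge> 0" "\<And>x y. x \<in> cball 0 R \<Longrightarrow> y \<in> cball 0 R \<Longrightarrow> \<bar>f x - f y\<bar> \<le> L * dist x y"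
proof -
  obtain M where M: "M \<ge> 0" "\<And>b x. b \<in> Basis \<Longrightarrow> x \<in> cball 0 R \<Longrightarrow> \<bar>dir_deriv b f x\<bar> \<le> M"
    using C1_bound[OF f bounded_cball[of 0 R]] by blast
  have diff: "f differentiable (at x)" for x using f by simp
  show ?thesis
  proof
    show "DIM('a) * M \<ge> 0" using M(1) by simp
    fix x y :: 'a assume "x \<in> cball 0 R" "y \<in> cball 0 R"
    then show "\<bar>f x - f y\<bar> \<le> DIM('a) * M * dist x y"
      using differentiable_bound[OF convex_cball[of 0 R] has_derivative_at_withinI[OF has_derivative_dir_deriv[OF diff]]
        onorm_dir_deriv_le[OF diff M(2)], of x y] by (simp add: dist_norm)
  qed
qed

text \<open>The segment from \<open>x\<close> to a nearest point of the complement crosses the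
  frontier. This converts vanishing on the frontier into decay in terms of
  \<open>infdist x (- \<Omega>)\<close>, the quantity from which the cutoffs are built.\<close>

lemma near_frontier:
  fixes \<Omega> :: "'a::euclidean_space set"
  assumes \<Omega>: "open \<Omega>" "bounded \<Omega>" and x: "x \<in> \<Omega>"
  obtains z where "z \<in> frontier \<Omega>" "dist x z \<le> infdist x (- \<Omega>)"
proof -
  have "- \<Omega> \<noteq> {}" using \<Omega>(2) not_bounded_UNIV by (metis Compl_empty_eq double_complement)
  then obtain y where y: "y \<in> - \<Omega>" "infdist x (- \<Omega>) = dist x y"
    using infdist_attains_inf[of "- \<Omega>" x] \<Omega>(1) by (auto simp: closed_Compl)
  have "closed_segment x y \<inter> frontier \<Omega> \<noteq> {}"
    using x y(1) by (intro connected_Int_frontier) auto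
  then obtain z where "z \<in> closed_segment x y" "z \<in> frontier \<Omega>" by blast
  then show ?thesis using that[of z] y(2) segment_bound1[of z x y]
    by (simp add: dist_norm norm_minus_commute)
qed

lemma infdist_Compl_pos:
  fixes \<Omega> :: "'a::euclidean_space set"
  assumes \<Omega>: "open \<Omega>" "bounded \<Omega>" shows "x \<in> \<Omega> \<longleftrightarrow> infdist x (- \<Omega>) > 0"
proof -
  have "- \<Omega> \<noteq> {}" using \<Omega>(2) not_bounded_UNIV by (metis Compl_empty_eq double_complement)
  then show ?thesis
    using in_closed_iff_infdist_zero[of "- \<Omega>" x] \<Omega>(1) infdist_nonneg[of x "- \<Omega>"] by (auto simp: closed_Compl less_le)
qed

lemma vanishing_first_order:
  fixes c :: "'a::euclidean_space \<Rightarrow> real"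
  assumes \<Omega>: "open \<Omega>" "bounded \<Omega>" and c: "Ck 1 c" "\<And>z. z \<in> frontier \<Omega> \<Longrightarrow> c z = 0"
  obtains L where "L \<ge> 0" "\<And>x. x \<in> \<Omega> \<Longrightarrow> \<bar>c x\<bar> \<le> L * infdist x (- \<Omega>)"
proof -
  obtain R where R: "closure \<Omega> \<subseteq> cball 0 R"
    using bounded_closure[OF \<Omega>(2)] by (auto simp: bounded_iff subset_iff)
  obtain L where L: "L \<ge> 0" "\<And>x y. x \<in> cball 0 R \<Longrightarrow> y \<in> cball 0 R \<Longrightarrow> \<bar>c x - c y\<bar> \<le> L * dist x y"
    using C1_Lipschitz_cball[OF c(1), of R] by blast
  show ?thesis
  proof
    fix x assume x: "x \<in> \<Omega>"
    obtain z where z: "z \<in> frontier \<Omega>" "dist x z \<le> infdist x (- \<Omega>)" using near_frontier[OF \<Omega> x] .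
    have "x \<in> cball 0 R" "z \<in> cball 0 R" using x z(1) R closure_subset[of \<Omega>] by (auto simp: frontier_def)
    then have "\<bar>c x\<bar> \<le> L * dist x z" using L(2)[of x z] c(2)[OF z(1)] by simp
    also have "\<dots> \<le> L * infdist x (- \<Omega>)" using z(2) L(1) by (rule mult_left_mono)
    finally show "\<bar>c x\<bar> \<le> L * infdist x (- \<Omega>)" .
  qed (rule L(1))
qed

text \<open>The first derivatives are Lipschitz and vanish at a near frontier point
  \<open>z\<close>, so on the segment from \<open>x\<close> to \<open>z\<close> they are at most a
  multiple of \<open>dist x z\<close>; the mean value theorem along this segment adds the second
  factor.\<close>

lemma vanishing_second_order:
  fixes c :: "'a::euclidean_space \<Rightarrow> real"
  assumes \<Omega>: "open \<Omega>" "bounded \<Omega>" and c: "Ck 2 c" "\<And>z. z \<in> frontier \<Omega> \<Longrightarrow> c z = 0"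
    "\<And>z b. z \<in> frontier \<Omega> \<Longrightarrow> b \<in> Basis \<Longrightarrow> dir_deriv b c z = 0"
  obtains L where "L \<ge> 0" "\<And>x. x \<in> \<Omega> \<Longrightarrow> \<bar>c x\<bar> \<le> L * (infdist x (- \<Omega>))\<^sup>2"
    "\<And>x b. x \<in> \<Omega> \<Longrightarrow> b \<in> Basis \<Longrightarrow> \<bar>dir_deriv b c x\<bar> \<le> L * infdist x (- \<Omega>)"
proof -
  obtain R where R: "closure \<Omega> \<subseteq> cball 0 R"
    using bounded_closure[OF \<Omega>(2)] by (auto simp: bounded_iff subset_iff)
  have C1: "Ck 1 (dir_deriv b c)" if "b \<in> Basis" for b using c(1) that by (simp add: numeral_2_eq_2)
  have "\<exists>L\<ge>0. \<forall>x\<in>cball 0 R. \<forall>y\<in>cball 0 R. \<bar>dir_deriv b c x - dir_deriv b c y\<bar> \<le> L * dist x y" if "b \<in> Basis" for b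
    using C1_Lipschitz_cball[OF C1[OF that], of R] by metis
  then obtain M where M: "\<And>b. b \<in> Basis \<Longrightarrow> M b \<ge> 0"
    "\<And>b x y. b \<in> Basis \<Longrightarrow> x \<in> cball 0 R \<Longrightarrow> y \<in> cball 0 R \<Longrightarrow> \<bar>dir_deriv b c x - dir_deriv b c y\<bar> \<le> M b * dist x y"
    by metis
  define L where "L = (\<Sum>b\<in>Basis. M b)"
  have L0: "L \<ge> 0" using M(1) by (simp add: L_def sum_nonneg)
  have L: "\<bar>dir_deriv b c x - dir_deriv b c y\<bar> \<le> L * dist x y" if "b \<in> Basis" "x \<in> cball 0 R" "y \<in> cball 0 R" for b x y
  proof -
    have "M b \<le> L" unfolding L_def using that(1) M(1) by (intro member_le_sum) auto
    then show ?thesis using M(2)[OF that] mult_right_mono[of "M b" L "dist x y"] by simp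
  qed
  have diff: "c differentiable (at x)" for x using c(1) by (simp add: numeral_2_eq_2)
  \<comment> \<open>Lets the constant \<open>DIM('a) * L\<close> of the function bound serve for the
    derivatives too.\<close>
  have L1: "L \<le> DIM('a) * L" using L0 mult_right_mono[of 1 "real DIM('a)" L] by (simp add: Suc_le_eq)
  show ?thesis
  proof
    show "DIM('a) * L \<ge> 0" using L0 by simp
    fix x assume x: "x \<in> \<Omega>"
    obtain z where z: "z \<in> frontier \<Omega>" "dist x z \<le> infdist x (- \<Omega>)" using near_frontier[OF \<Omega> x] .
    have xz: "x \<in> cball 0 R" "z \<in> cball 0 R" using x z(1) R closure_subset[of \<Omega>] by (auto simp: frontier_def)
    show "\<bar>dir_deriv b c x\<bar> \<le> DIM('a) * L * infdist x (- \<Omega>)" if b: "b \<in> Basis" for b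
    proof -
      have "\<bar>dir_deriv b c x\<bar> \<le> L * dist x z" using L[OF b xz] c(3)[OF z(1) b] by simp
      also have "\<dots> \<le> DIM('a) * L * infdist x (- \<Omega>)" using z(2) L0 L1 by (intro mult_mono) auto
      finally show ?thesis .
    qed
    have seg: "closed_segment x z \<subseteq> cball 0 R" using xz by (intro closed_segment_subset convex_cball)
    have "norm (c x - c z) \<le> DIM('a) * (L * dist x z) * norm (x - z)"
    proof (rule differentiable_bound[OF convex_closed_segment has_derivative_at_withinI[OF has_derivative_dir_deriv[OF diff]]
          onorm_dir_deriv_le[OF diff]])
      fix y and b :: 'a assume y: "y \<in> closed_segment x z" and b: "b \<in> Basis"
      have "\<bar>dir_deriv b c y\<bar> \<le> L * dist y z" using L[OF b, of y z] c(3)[OF z(1) b] seg y xz by auto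
      also have "\<dots> \<le> L * dist x z"
        using L0 segment_bound(2)[OF y] by (intro mult_left_mono) (auto simp: dist_norm norm_minus_commute)
      finally show "\<bar>dir_deriv b c y\<bar> \<le> L * dist x z" .
    qed auto
    then have "\<bar>c x\<bar> \<le> DIM('a) * L * (dist x z)\<^sup>2" using c(2)[OF z(1)]
      by (simp add: dist_norm power2_eq_square mult_ac)
    also have "\<dots> \<le> DIM('a) * L * (infdist x (- \<Omega>))\<^sup>2"
      using z(2) L0 by (intro mult_left_mono power_mono) auto
    finally show "\<bar>c x\<bar> \<le> DIM('a) * L * (infdist x (- \<Omega>))\<^sup>2" .
  qed
qed

section \<open>Cutoffs near the boundary and approximation by smooth functions\<close>

lemma compact_infdist_ge:
  fixes \<Omega> :: "'a::euclidean_space set"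
  assumes "open \<Omega>" "bounded \<Omega>" "d > 0"
  shows "compact {x. d \<le> infdist x (- \<Omega>)}" "{x. d \<le> infdist x (- \<Omega>)} \<subseteq> \<Omega>"
proof -
  show s: "{x. d \<le> infdist x (- \<Omega>)} \<subseteq> \<Omega>" using infdist_Compl_pos[OF assms(1,2)] assms(3) by fastforce
  have "closed {x. d \<le> infdist x (- \<Omega>)}" by (intro closed_Collect_le continuous_intros)
  then show "compact {x. d \<le> infdist x (- \<Omega>)}"
    using s assms(2) by (auto simp: compact_eq_bounded_closed intro: bounded_subset)
qed

lemma smooth_cutoff:
  fixes \<Omega> :: "'a::euclidean_space set"
  assumes \<Omega>: "open \<Omega>" "bounded \<Omega>"
  obtains K and \<eta> :: "real \<Rightarrow> 'a \<Rightarrow> real" where "K \<ge> 0" "\<And>d k. d > 0 \<Longrightarrow> Ck k (\<eta> d)"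
    "\<And>d x. d > 0 \<Longrightarrow> infdist x (- \<Omega>) < d \<Longrightarrow> \<eta> d x = 0"
    "\<And>d x. d > 0 \<Longrightarrow> infdist x (- \<Omega>) > 3 * d \<Longrightarrow> \<eta> d x = 1"
    "\<And>d x. d > 0 \<Longrightarrow> \<bar>\<eta> d x\<bar> \<le> 1"
    "\<And>d b x. d > 0 \<Longrightarrow> b \<in> Basis \<Longrightarrow> \<bar>dir_deriv b (\<eta> d) x\<bar> \<le> K / d"
    "\<And>d b c x. d > 0 \<Longrightarrow> b \<in> Basis \<Longrightarrow> c \<in> Basis \<Longrightarrow> \<bar>dir_deriv c (dir_deriv b (\<eta> d)) x\<bar> \<le> K / d^2"
proof -
  \<comment> \<open>The threshold lies halfway between \<open>d\<close> and \<open>3 * d\<close>: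
    mollifying at scale \<open>d\<close> moves values by at most that distance, so the result is 0
    below \<open>d\<close> and 1 above \<open>3 * d\<close>.\<close>
  define S where "S d = {x. 2 * d \<le> infdist x (- \<Omega>)}" for d
  have S: "S d \<in> sets borel" "bounded (S d)" if "d > 0" for d
    using compact_infdist_ge[OF \<Omega>, of "2 * d"] that unfolding S_def
    by (auto intro: compact_imp_closed borel_closed compact_imp_bounded)
  define \<eta> where "\<eta> d = moll d (indicator (S d))" for d
  obtain K where K: "K \<ge> 0"
    "\<And>S t b x. S \<in> sets borel \<Longrightarrow> bounded S \<Longrightarrow> t > 0 \<Longrightarrow> b \<in> Basis \<Longrightarrow> \<bar>dir_deriv b (moll t (indicator S)) (x::'a)\<bar> \<le> K / t"
    "\<And>S t b c x. S \<in> sets borel \<Longrightarrow> bounded S \<Longrightarrow> t > 0 \<Longrightarrow> b \<in> Basis \<Longrightarrow> c \<in> Basis \<Longrightarrow>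
       \<bar>dir_deriv c (dir_deriv b (moll t (indicator S))) (x::'a)\<bar> \<le> K / t^2"
    by (rule moll_indicator_bounds; rule that; blast)
  show ?thesis
  proof (rule that[OF K(1), of \<eta>])
    fix d :: real and x :: 'a assume d: "d > 0"
    note h = bdd_fun_indicator[OF S[OF d]]
    show "Ck k (\<eta> d)" for k unfolding \<eta>_def by (rule Ck_moll[OF h d])
    show "\<eta> d x = 0" if "infdist x (- \<Omega>) < d"
      unfolding \<eta>_def
    proof (rule moll_eq[OF h d])
      fix y assume "norm (y - x) < d"
      then have "infdist y (- \<Omega>) < 2 * d" using that infdist_triangle[of y "- \<Omega>" x] by (simp add: dist_norm)
      then show "indicator (S d) y = (0::real)" by (simp add: S_def indicator_def)
    qed
    show "\<eta> d x = 1" if "infdist x (- \<Omega>) > 3 * d"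
      unfolding \<eta>_def
    proof (rule moll_eq[OF h d])
      fix y assume "norm (y - x) < d"
      then have "infdist y (- \<Omega>) > 2 * d" using that infdist_triangle[of x "- \<Omega>" y] by (simp add: dist_norm norm_minus_commute)
      then show "indicator (S d) y = (1::real)" by (simp add: S_def indicator_def)
    qed
    show "\<bar>\<eta> d x\<bar> \<le> 1" using moll_indicator_range[OF S[OF d] d, of x] by (simp add: \<eta>_def)
    show "\<bar>dir_deriv b (\<eta> d) x\<bar> \<le> K / d" if "b \<in> Basis" for b
      unfolding \<eta>_def by (rule K(2)[OF S[OF d] d that])
    show "\<bar>dir_deriv c (dir_deriv b (\<eta> d)) x\<bar> \<le> K / d^2" if "b \<in> Basis" "c \<in> Basis" for b c
      unfolding \<eta>_def by (rule K(3)[OF S[OF d] d that])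
  qed
qed

text \<open>Mollifying at a scale below \<open>d / 2\<close> keeps the support at distance at least
  \<open>d / 2\<close> from the complement. The second-order estimate is conditional, so that one
  approximation serves C^1 and C^2 data alike.\<close>

lemma smooth_approximation:
  fixes h :: "'a::euclidean_space \<Rightarrow> real"
  assumes \<Omega>: "open \<Omega>" "bounded \<Omega>" and h: "Ck 1 h" and d: "d > 0"
    and z: "\<And>x. infdist x (- \<Omega>) < d \<Longrightarrow> h x = 0" and e: "e > 0"
  obtains \<xi> where "\<xi> \<in> test_functions \<Omega>"
    "\<And>b x. b \<in> Basis \<Longrightarrow> \<bar>dir_deriv b \<xi> x - dir_deriv b h x\<bar> \<le> e"
    "\<And>b c x. Ck 2 h \<Longrightarrow> b \<in> Basis \<Longrightarrow> c \<in> Basis \<Longrightarrow>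
       \<bar>dir_deriv c (dir_deriv b \<xi>) x - dir_deriv c (dir_deriv b h) x\<bar> \<le> e"
proof -
  obtain R where R: "\<And>x. x \<in> \<Omega> \<Longrightarrow> norm x \<le> R" using \<Omega>(2) by (auto simp: bounded_iff)
  have hs: "bdd_supp h"
    unfolding bdd_supp_def
  proof (intro exI[of _ R] allI impI)
    fix x :: 'a assume "R < norm x"
    then have "x \<notin> \<Omega>" using R[of x] by auto
    then have "infdist x (- \<Omega>) = 0" by simp
    then show "h x = 0" using z d by simp
  qed
  have hb: "bdd_fun h" by (intro bdd_fun_continuous hs Ck_continuous[OF h])
  have E1: "\<forall>\<^sub>F t in at_right 0. \<forall>b\<in>Basis. \<forall>x. \<bar>moll t (dir_deriv b h) x - dir_deriv b h x\<bar> \<le> e"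
    using h by (intro eventually_ball_finite ballI moll_tendsto_unif bdd_supp_dir_deriv hs e) auto
  have E2: "\<forall>\<^sub>F t in at_right 0. Ck 2 h \<longrightarrow> (\<forall>b\<in>Basis. \<forall>c\<in>Basis. \<forall>x. \<bar>moll t (dir_deriv c (dir_deriv b h)) x - dir_deriv c (dir_deriv b h) x\<bar> \<le> e)"
  proof (cases "Ck 2 h")
    case True
    then have "\<forall>\<^sub>F t in at_right 0. \<forall>b\<in>Basis. \<forall>c\<in>Basis. \<forall>x. \<bar>moll t (dir_deriv c (dir_deriv b h)) x - dir_deriv c (dir_deriv b h) x\<bar> \<le> e"
      by (intro eventually_ball_finite ballI moll_tendsto_unif bdd_supp_dir_deriv hs e) (auto simp: numeral_2_eq_2)
    then show ?thesis by eventually_elim simp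
  qed simp
  have E3: "\<forall>\<^sub>F t in at_right 0. 0 < t \<and> t < d / 2"
    using d by (intro eventually_conj eventually_at_right_less) (auto intro: eventually_at_rightI[of 0 "d/2"])
  have "\<forall>\<^sub>F t in at_right 0. (\<forall>b\<in>Basis. \<forall>x. \<bar>moll t (dir_deriv b h) x - dir_deriv b h x\<bar> \<le> e)
    \<and> (Ck 2 h \<longrightarrow> (\<forall>b\<in>Basis. \<forall>c\<in>Basis. \<forall>x. \<bar>moll t (dir_deriv c (dir_deriv b h)) x - dir_deriv c (dir_deriv b h) x\<bar> \<le> e))
    \<and> 0 < t \<and> t < d / 2"
    by (intro eventually_conj E1 E2 E3[THEN eventually_mono]) auto
  from eventually_happens'[OF trivial_limit_at_right_real this] obtain t where t1: "\<forall>b\<in>Basis. \<forall>x. \<bar>moll t (dir_deriv b h) x - dir_deriv b h x\<bar> \<le> e"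
    and t2: "Ck 2 h \<longrightarrow> (\<forall>b\<in>Basis. \<forall>c\<in>Basis. \<forall>x. \<bar>moll t (dir_deriv c (dir_deriv b h)) x - dir_deriv c (dir_deriv b h) x\<bar> \<le> e)"
    and t: "0 < t" "t < d / 2"
    by blast
  have D1: "dir_deriv b (moll t h) = moll t (dir_deriv b h)" if "b \<in> Basis" for b
    by (rule dir_deriv_moll[OF h hs t(1) that])
  show ?thesis
  proof
    show "moll t h \<in> test_functions \<Omega>"
    proof (rule test_functionsI)
      show "Ck k (moll t h)" for k by (rule Ck_moll[OF hb t(1)])
      show "compact {x. d/2 \<le> infdist x (- \<Omega>)}" "{x. d/2 \<le> infdist x (- \<Omega>)} \<subseteq> \<Omega>"
        using compact_infdist_ge[OF \<Omega>, of "d/2"] d by auto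
      fix x assume x: "x \<notin> {x. d/2 \<le> infdist x (- \<Omega>)}"
      show "moll t h x = 0"
      proof (rule moll_eq[OF hb t(1)])
        fix y assume "norm (y - x) < t"
        then have "infdist y (- \<Omega>) < d" using x t infdist_triangle[of y "- \<Omega>" x] by (simp add: dist_norm)
        then show "h y = 0" by (rule z)
      qed
    qed
    show "\<bar>dir_deriv b (moll t h) x - dir_deriv b h x\<bar> \<le> e" if "b \<in> Basis" for b x
      using t1 that by (simp add: D1)
    fix b c :: 'a and x assume 2: "Ck 2 h" "b \<in> Basis" "c \<in> Basis"
    have "dir_deriv c (dir_deriv b (moll t h)) = moll t (dir_deriv c (dir_deriv b h))"
      unfolding D1[OF 2(2)] using 2 by (intro dir_deriv_moll bdd_supp_dir_deriv hs t) (auto simp: numeral_2_eq_2)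
    then show "\<bar>dir_deriv c (dir_deriv b (moll t h)) x - dir_deriv c (dir_deriv b h) x\<bar> \<le> e"
      using t2 2 by simp
  qed
qed

text \<open>Multiply \<open>c\<close> by a cutoff at distance \<open>r m\<close>, then mollify.
  Where the cutoff varies, the distance to the complement is at most \<open>3 * r m\<close>, so a
  factor of order 1 / r is met by c = O(r), and one of order 1 / r^2 by c = O(r^2) or by first
  derivatives of \<open>c\<close> of order r together with 1 / r. The derivatives stay bounded and
  converge pointwise, which dominated convergence turns into L^2 convergence.\<close>

lemma vanishing_approximation:
  fixes c :: "'a::euclidean_space \<Rightarrow> real"
  assumes \<Omega>: "open \<Omega>" "bounded \<Omega>" and c: "Ck 1 c" "\<And>z. z \<in> frontier \<Omega> \<Longrightarrow> c z = 0"
  obtains \<xi> :: "nat \<Rightarrow> 'a \<Rightarrow> real" and B where "\<And>m. \<xi> m \<in> test_functions \<Omega>"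
    "\<And>m b x. b \<in> Basis \<Longrightarrow> x \<in> \<Omega> \<Longrightarrow> \<bar>dir_deriv b (\<xi> m) x\<bar> \<le> B"
    "\<And>b x. b \<in> Basis \<Longrightarrow> x \<in> \<Omega> \<Longrightarrow> (\<lambda>m. dir_deriv b (\<xi> m) x) \<longlonglongrightarrow> dir_deriv b c x"
    "Ck 2 c \<and> (\<forall>b\<in>Basis. \<forall>z\<in>frontier \<Omega>. dir_deriv b c z = 0) \<longrightarrow>
      (\<forall>m. \<forall>b\<in>Basis. \<forall>b'\<in>Basis. \<forall>x\<in>\<Omega>. \<bar>dir_deriv b' (dir_deriv b (\<xi> m)) x\<bar> \<le> B) \<and>
      (\<forall>b\<in>Basis. \<forall>b'\<in>Basis. \<forall>x\<in>\<Omega>. (\<lambda>m. dir_deriv b' (dir_deriv b (\<xi> m)) x) \<longlonglongrightarrow> dir_deriv b' (dir_deriv b c) x)"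
proof (rule smooth_cutoff[OF \<Omega>])
  fix K and \<eta> :: "real \<Rightarrow> 'a \<Rightarrow> real"
  assume K: "K \<ge> 0" and \<eta>: "\<And>d k. d > 0 \<Longrightarrow> Ck k (\<eta> d)"
    and \<eta>0: "\<And>d x. d > 0 \<Longrightarrow> infdist x (- \<Omega>) < d \<Longrightarrow> \<eta> d x = 0"
    and \<eta>1: "\<And>d x. d > 0 \<Longrightarrow> infdist x (- \<Omega>) > 3 * d \<Longrightarrow> \<eta> d x = 1"
    and \<eta>a: "\<And>d x. d > 0 \<Longrightarrow> \<bar>\<eta> d x\<bar> \<le> 1"
    and D\<eta>: "\<And>d b x. d > 0 \<Longrightarrow> b \<in> Basis \<Longrightarrow> \<bar>dir_deriv b (\<eta> d) x\<bar> \<le> K / d"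
    and DD\<eta>: "\<And>d b c x. d > 0 \<Longrightarrow> b \<in> Basis \<Longrightarrow> c \<in> Basis \<Longrightarrow> \<bar>dir_deriv c (dir_deriv b (\<eta> d)) x\<bar> \<le> K / d^2"
  have op: "open {x. infdist x (- \<Omega>) > 3 * d}" for d by (intro open_Collect_less continuous_intros)
  have D\<eta>0: "dir_deriv b (\<eta> d) x = 0" if "d > 0" "infdist x (- \<Omega>) > 3 * d" for b d x
  proof -
    have "dir_deriv b (\<eta> d) x = dir_deriv b (\<lambda>x. 1) x"
      by (rule dir_deriv_cong_open[OF op[of d]]) (use that \<eta>1 in auto)
    then show ?thesis by simp
  qed
  have DD\<eta>0: "dir_deriv b' (dir_deriv b (\<eta> d)) x = 0" if "d > 0" "infdist x (- \<Omega>) > 3 * d" for b b' d x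
  proof -
    have "dir_deriv b' (dir_deriv b (\<eta> d)) x = dir_deriv b' (\<lambda>x. 0) x"
      by (rule dir_deriv_cong_open[OF op[of d]]) (use that D\<eta>0 in auto)
    then show ?thesis by simp
  qed
  define r where "r m = inverse (real (Suc m))" for m
  have r: "0 < r m" "r m \<le> 1" for m by (auto simp: r_def divide_simps)
  have rlim: "r \<longlonglongrightarrow> 0" unfolding r_def by (rule LIMSEQ_inverse_real_of_nat)
  define h where "h m x = \<eta> (r m) x * c x" for m x
  have h1: "Ck 1 (h m)" for m unfolding h_def[abs_def] by (intro Ck_mult \<eta> r c)
  have dc: "c differentiable (at x)" for x using c(1) by simp
  have d\<eta>: "\<eta> (r m) differentiable (at x)" for m x by (rule Ck_differentiable[OF \<eta>[OF r(1), of 1]]) simp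
  have Dh: "dir_deriv b (h m) = (\<lambda>x. \<eta> (r m) x * dir_deriv b c x + dir_deriv b (\<eta> (r m)) x * c x)" for b m
    unfolding h_def[abs_def] by (intro ext dir_deriv_mult dc d\<eta>)
  have "\<exists>\<xi>. \<xi> \<in> test_functions \<Omega> \<and> (\<forall>b\<in>Basis. \<forall>x. \<bar>dir_deriv b \<xi> x - dir_deriv b (h m) x\<bar> \<le> r m) \<and>
      (Ck 2 (h m) \<longrightarrow> (\<forall>b\<in>Basis. \<forall>b'\<in>Basis. \<forall>x. \<bar>dir_deriv b' (dir_deriv b \<xi>) x - dir_deriv b' (dir_deriv b (h m)) x\<bar> \<le> r m))" for m
  proof -
    have "h m x = 0" if "infdist x (- \<Omega>) < r m" for x using \<eta>0[OF r(1) that] by (simp add: h_def)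
    from smooth_approximation[OF \<Omega> h1 r(1) this r(1)] show ?thesis by metis
  qed
  then obtain \<xi> where \<xi>: "\<And>m. \<xi> m \<in> test_functions \<Omega>"
    and \<xi>1: "\<And>m b x. b \<in> Basis \<Longrightarrow> \<bar>dir_deriv b (\<xi> m) x - dir_deriv b (h m) x\<bar> \<le> r m"
    and \<xi>2: "\<And>m b b' x. Ck 2 (h m) \<Longrightarrow> b \<in> Basis \<Longrightarrow> b' \<in> Basis \<Longrightarrow> \<bar>dir_deriv b' (dir_deriv b (\<xi> m)) x - dir_deriv b' (dir_deriv b (h m)) x\<bar> \<le> r m"
    by metis
  obtain M where M: "M \<ge> 0" "\<And>b x. b \<in> Basis \<Longrightarrow> x \<in> \<Omega> \<Longrightarrow> \<bar>dir_deriv b c x\<bar> \<le> M"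
    using C1_bound[OF c(1) \<Omega>(2)] by blast
  obtain L where L: "L \<ge> 0" "\<And>x. x \<in> \<Omega> \<Longrightarrow> \<bar>c x\<bar> \<le> L * infdist x (- \<Omega>)"
    using vanishing_first_order[OF \<Omega> c] by blast
  have Dhb: "\<bar>dir_deriv b (h m) x\<bar> \<le> M + 3 * K * L" if "b \<in> Basis" "x \<in> \<Omega>" for b m x
  proof -
    have 1: "\<bar>\<eta> (r m) x * dir_deriv b c x\<bar> \<le> 1 * M"
      unfolding abs_mult using \<eta>a[OF r(1)] M(2)[OF that] by (intro mult_mono) auto
    have 2: "\<bar>dir_deriv b (\<eta> (r m)) x * c x\<bar> \<le> 3 * K * L"
    proof (cases "infdist x (- \<Omega>) > 3 * r m")
      case True then show ?thesis using D\<eta>0[OF r(1)] K L by simp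
    next
      case False
      have "\<bar>c x\<bar> \<le> L * (3 * r m)" using L(2)[OF that(2)] mult_left_mono[of "infdist x (- \<Omega>)" "3 * r m" L] L(1) False by simp
      then have "\<bar>dir_deriv b (\<eta> (r m)) x * c x\<bar> \<le> K / r m * (L * (3 * r m))"
        unfolding abs_mult using D\<eta>[OF r(1) that(1)] K r(1)[of m] by (intro mult_mono) auto
      also have "\<dots> = 3 * K * L" using r(1)[of m] by (simp add: field_simps)
      finally show ?thesis .
    qed
    show ?thesis unfolding Dh using 1 2 by linarith
  qed
  have ev: "\<forall>\<^sub>F m in sequentially. infdist x (- \<Omega>) > 3 * r m" if "x \<in> \<Omega>" for x
  proof -
    have "infdist x (- \<Omega>) / 3 > 0" using infdist_Compl_pos[OF \<Omega>] that by simp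
    from order_tendstoD(2)[OF rlim this] show ?thesis by eventually_elim simp
  qed
  have conv_aux: "f \<longlonglongrightarrow> l" if "\<forall>\<^sub>F m in sequentially. \<bar>f m - l\<bar> \<le> r m" for f :: "nat \<Rightarrow> real" and l
  proof (rule LIM_zero_cancel)
    show "(\<lambda>m. f m - l) \<longlonglongrightarrow> 0"
      by (rule Lim_null_comparison[OF _ rlim]) (use that in simp)
  qed
  have lim1: "(\<lambda>m. dir_deriv b (\<xi> m) x) \<longlonglongrightarrow> dir_deriv b c x" if "b \<in> Basis" "x \<in> \<Omega>" for b x
  proof (rule conv_aux)
    show "\<forall>\<^sub>F m in sequentially. \<bar>dir_deriv b (\<xi> m) x - dir_deriv b c x\<bar> \<le> r m"
      using ev[OF that(2)]
    proof eventually_elim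
      case (elim m)
      then have "dir_deriv b (h m) x = dir_deriv b c x" using D\<eta>0[OF r(1)] \<eta>1[OF r(1)] by (simp add: Dh)
      then show ?case using \<xi>1[OF that(1), of m x] by simp
    qed
  qed
  show ?thesis
  proof (cases "Ck 2 c \<and> (\<forall>b\<in>Basis. \<forall>z\<in>frontier \<Omega>. dir_deriv b c z = 0)")
    case False
    show ?thesis
    proof (rule that[of \<xi> "M + 3 * K * L + 1"])
      fix m b x assume "b \<in> (Basis :: 'a set)" "x \<in> \<Omega>"
      then show "\<bar>dir_deriv b (\<xi> m) x\<bar> \<le> M + 3 * K * L + 1"
        using Dhb[of b x m] \<xi>1[of b m x] r(2)[of m] by linarith
    qed (use False \<xi> lim1 in auto)
  next
    case True
    then have c2: "Ck 2 c" "\<And>z b. z \<in> frontier \<Omega> \<Longrightarrow> b \<in> Basis \<Longrightarrow> dir_deriv b c z = 0" by auto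
    have h2: "Ck 2 (h m)" for m unfolding h_def[abs_def] by (intro Ck_mult \<eta> r c2)
    have Dc1: "Ck 1 (dir_deriv b c)" if "b \<in> Basis" for b using c2(1) that by (simp add: numeral_2_eq_2)
    have D\<eta>1: "Ck 1 (dir_deriv b (\<eta> (r m)))" if "b \<in> Basis" for b m using \<eta>[OF r(1), of 2 m] that by (simp add: numeral_2_eq_2)
    have DDh: "dir_deriv b' (dir_deriv b (h m)) x = \<eta> (r m) x * dir_deriv b' (dir_deriv b c) x + dir_deriv b' (\<eta> (r m)) x * dir_deriv b c x
      + (dir_deriv b (\<eta> (r m)) x * dir_deriv b' c x + dir_deriv b' (dir_deriv b (\<eta> (r m))) x * c x)"
      if "b \<in> Basis" for b b' m x
    proof -
      have 1: "dir_deriv b c differentiable (at x)" "dir_deriv b (\<eta> (r m)) differentiable (at x)" for x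
        using Dc1[OF that] D\<eta>1[OF that] by auto
      have 2: "(\<lambda>x. \<eta> (r m) x * dir_deriv b c x) differentiable (at x)" "(\<lambda>x. dir_deriv b (\<eta> (r m)) x * c x) differentiable (at x)"
        using 1 dc d\<eta> by (auto intro!: derivative_intros)
      show ?thesis unfolding Dh dir_deriv_add[OF 2] by (simp only: dir_deriv_mult[OF d\<eta> 1(1)] dir_deriv_mult[OF 1(2) dc])
    qed
    have "\<exists>M2. \<forall>b'\<in>Basis. \<forall>x\<in>\<Omega>. \<bar>dir_deriv b' (dir_deriv b c) x\<bar> \<le> M2" if "b \<in> Basis" for b
      using C1_bound[OF Dc1[OF that] \<Omega>(2)] by metis
    then obtain M2 where M2: "\<And>b b' x. b \<in> Basis \<Longrightarrow> b' \<in> Basis \<Longrightarrow> x \<in> \<Omega> \<Longrightarrow> \<bar>dir_deriv b' (dir_deriv b c) x\<bar> \<le> M2 b"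
      by metis
    define M' where "M' = (\<Sum>b\<in>Basis. \<bar>M2 b\<bar>)"
    have M': "\<bar>dir_deriv b' (dir_deriv b c) x\<bar> \<le> M'" if "b \<in> Basis" "b' \<in> Basis" "x \<in> \<Omega>" for b b' x
      using M2[OF that] member_le_sum[of b Basis "\<lambda>b. \<bar>M2 b\<bar>"] that unfolding M'_def by fastforce
    obtain N where N: "N \<ge> 0" "\<And>x. x \<in> \<Omega> \<Longrightarrow> \<bar>c x\<bar> \<le> N * (infdist x (- \<Omega>))\<^sup>2"
      "\<And>x b. x \<in> \<Omega> \<Longrightarrow> b \<in> Basis \<Longrightarrow> \<bar>dir_deriv b c x\<bar> \<le> N * infdist x (- \<Omega>)"
      using vanishing_second_order[OF \<Omega> c2(1) c(2) c2(2)] by blast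
    \<comment> \<open>15 = 3 + 3 + 9: two products of first derivatives, each at most
      \<open>3 * K * N\<close>, and the second derivative of the cutoff times \<open>c\<close>,
      where the squared distance gives 9.\<close>
    have DDhb: "\<bar>dir_deriv b' (dir_deriv b (h m)) x\<bar> \<le> M' + 15 * K * N" if "b \<in> Basis" "b' \<in> Basis" "x \<in> \<Omega>" for b b' m x
    proof -
      have 1: "\<bar>\<eta> (r m) x * dir_deriv b' (dir_deriv b c) x\<bar> \<le> 1 * M'"
        unfolding abs_mult using \<eta>a[OF r(1)] M'[OF that] by (intro mult_mono) auto
      have 2: "\<bar>dir_deriv b1 (\<eta> (r m)) x * dir_deriv b2 c x\<bar> \<le> 3 * K * N" if "b1 \<in> Basis" "b2 \<in> Basis" for b1 b2
      proof (cases "infdist x (- \<Omega>) > 3 * r m")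
        case True then show ?thesis using D\<eta>0[OF r(1)] K N by simp
      next
        case False
        have "\<bar>dir_deriv b2 c x\<bar> \<le> N * (3 * r m)"
          using N(3)[OF \<open>x \<in> \<Omega>\<close> that(2)] mult_left_mono[of "infdist x (- \<Omega>)" "3 * r m" N] N(1) False by simp
        then have "\<bar>dir_deriv b1 (\<eta> (r m)) x * dir_deriv b2 c x\<bar> \<le> K / r m * (N * (3 * r m))"
          unfolding abs_mult using D\<eta>[OF r(1) that(1)] K r(1)[of m] by (intro mult_mono) auto
        also have "\<dots> = 3 * K * N" using r(1)[of m] by (simp add: field_simps)
        finally show ?thesis .
      qed
      have 3: "\<bar>dir_deriv b' (dir_deriv b (\<eta> (r m))) x * c x\<bar> \<le> 9 * K * N"
      proof (cases "infdist x (- \<Omega>) > 3 * r m")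
        case True then show ?thesis using DD\<eta>0[OF r(1)] K N by simp
      next
        case False
        then have "(infdist x (- \<Omega>))\<^sup>2 \<le> (3 * r m)\<^sup>2" by (intro power_mono) (auto simp: infdist_nonneg)
        then have "\<bar>c x\<bar> \<le> N * (3 * r m)\<^sup>2"
          using N(2)[OF \<open>x \<in> \<Omega>\<close>] mult_left_mono[of "(infdist x (- \<Omega>))\<^sup>2" "(3 * r m)\<^sup>2" N] N(1) by simp
        then have "\<bar>dir_deriv b' (dir_deriv b (\<eta> (r m))) x * c x\<bar> \<le> K / (r m)\<^sup>2 * (N * (3 * r m)\<^sup>2)"
          unfolding abs_mult using DD\<eta>[OF r(1) that(1,2)] K r(1)[of m] by (intro mult_mono) auto
        also have "\<dots> = 9 * K * N" using r(1)[of m] by (simp add: field_simps power2_eq_square)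
        finally show ?thesis .
      qed
      show ?thesis unfolding DDh[OF that(1)] using 1 2[OF that(2,1)] 2[OF that(1,2)] 3 by linarith
    qed
    have lim2: "(\<lambda>m. dir_deriv b' (dir_deriv b (\<xi> m)) x) \<longlonglongrightarrow> dir_deriv b' (dir_deriv b c) x"
      if "b \<in> Basis" "b' \<in> Basis" "x \<in> \<Omega>" for b b' x
    proof (rule conv_aux)
      show "\<forall>\<^sub>F m in sequentially. \<bar>dir_deriv b' (dir_deriv b (\<xi> m)) x - dir_deriv b' (dir_deriv b c) x\<bar> \<le> r m"
        using ev[OF that(3)]
      proof eventually_elim
        case (elim m)
        then have "dir_deriv b' (dir_deriv b (h m)) x = dir_deriv b' (dir_deriv b c) x"
          using D\<eta>0[OF r(1)] DD\<eta>0[OF r(1)] \<eta>1[OF r(1)] by (simp add: DDh[OF that(1)])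
        then show ?case using \<xi>2[OF h2 that(1,2), of m x] by simp
      qed
    qed
    define B where "B = M + 3 * K * L + M' + 15 * K * N + 1"
    have M'0: "M' \<ge> 0" by (simp add: M'_def sum_nonneg)
    have pos: "0 \<le> 3 * K * L" "0 \<le> 15 * K * N" using K L N by auto
    show ?thesis
    proof (rule that[of \<xi> B])
      show "\<bar>dir_deriv b (\<xi> m) x\<bar> \<le> B" if "b \<in> Basis" "x \<in> \<Omega>" for m b x
        using Dhb[OF that, of m] \<xi>1[OF that(1), of m x] r(2)[of m] M'0 pos unfolding B_def by linarith
      have "\<bar>dir_deriv b' (dir_deriv b (\<xi> m)) x\<bar> \<le> B" if "b \<in> Basis" "b' \<in> Basis" "x \<in> \<Omega>" for m b b' x
        using DDhb[OF that, of m] \<xi>2[OF h2 that(1,2), of m x] r(2)[of m] M(1) pos unfolding B_def by linarith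
      then show "Ck 2 c \<and> (\<forall>b\<in>Basis. \<forall>z\<in>frontier \<Omega>. dir_deriv b c z = 0) \<longrightarrow>
        (\<forall>m. \<forall>b\<in>Basis. \<forall>b'\<in>Basis. \<forall>x\<in>\<Omega>. \<bar>dir_deriv b' (dir_deriv b (\<xi> m)) x\<bar> \<le> B) \<and>
        (\<forall>b\<in>Basis. \<forall>b'\<in>Basis. \<forall>x\<in>\<Omega>. (\<lambda>m. dir_deriv b' (dir_deriv b (\<xi> m)) x) \<longlonglongrightarrow> dir_deriv b' (dir_deriv b c) x)"
        using lim2 by blast
    qed (use \<xi> lim1 in auto)
  qed
qed

section \<open>Strong solutions are weak solutions\<close>

text \<open>All fields of the construction are real; complex vectors appear only at the interface
  with the function spaces. Taking the component index first leaves a scalar function for each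
  component.\<close>

definition cvec :: "('n::finite \<Rightarrow> 'a \<Rightarrow> real) \<Rightarrow> 'a \<Rightarrow> complex^'n" where
  "cvec u x = (\<chi> j. complex_of_real (u j x))"

lemma cvec_eq_sum: "cvec u x = (\<Sum>j\<in>UNIV. u j x *\<^sub>R axis j 1)"
  by (simp add: vec_eq_iff cvec_def axis_def if_distrib[of "(*\<^sub>R) _"] sum.delta of_real_def cong: if_cong)

lemma Ck_cvec: "(\<And>j. Ck k (u j)) \<Longrightarrow> Ck k (cvec u)"
  unfolding cvec_eq_sum[abs_def] by (intro Ck_sum Ck_scaleR Ck_const)

lemma dir_deriv_cvec:
  assumes "\<And>j. u j differentiable (at x)"
  shows "dir_deriv b (cvec u) x = cvec (\<lambda>j. dir_deriv b (u j)) x"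
  unfolding cvec_eq_sum[abs_def]
  using assms by (subst dir_deriv_sum) (auto simp: dir_deriv_scaleR)

lemma L2_norm_tendsto_0:
  fixes F :: "'a::euclidean_space \<Rightarrow> 'b::euclidean_space"
  assumes \<Omega>: "open \<Omega>" "bounded \<Omega>" and F: "continuous_on UNIV F" and G: "\<And>m. continuous_on UNIV (G m)"
    and lim: "\<And>x. x \<in> \<Omega> \<Longrightarrow> (\<lambda>m. G m x) \<longlonglongrightarrow> F x"
    and B: "\<And>m x. x \<in> \<Omega> \<Longrightarrow> norm (G m x) \<le> B"
  shows "(\<lambda>m. L2_norm \<Omega> (\<lambda>x. F x - G m x)) \<longlonglongrightarrow> 0"
proof -
  obtain C where C: "\<And>x. x \<in> \<Omega> \<Longrightarrow> norm (F x) \<le> C" using continuous_bounded_on[OF F \<Omega>(2)] by blast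
  interpret finite_measure "lebesgue_on \<Omega>" using finite_lebesgue_on \<Omega> by blast
  have "(\<lambda>m. integral\<^sup>L (lebesgue_on \<Omega>) (\<lambda>x. (norm (F x - G m x))\<^sup>2)) \<longlonglongrightarrow> integral\<^sup>L (lebesgue_on \<Omega>) (\<lambda>x. 0)"
  proof (rule integral_dominated_convergence[where w="\<lambda>x. (C + B)\<^sup>2"])
    show "(\<lambda>x. (norm (F x - G m x))\<^sup>2) \<in> borel_measurable (lebesgue_on \<Omega>)" for m
      by (intro continuous_measurable_lebesgue_on continuous_intros F G)
    show "AE x in lebesgue_on \<Omega>. (\<lambda>m. (norm (F x - G m x))\<^sup>2) \<longlonglongrightarrow> 0"
    proof (intro AE_I2)
      fix x assume "x \<in> space (lebesgue_on \<Omega>)"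
      then have "(\<lambda>m. (norm (F x - G m x))\<^sup>2) \<longlonglongrightarrow> (norm (F x - F x))\<^sup>2"
        by (intro tendsto_intros lim) simp
      then show "(\<lambda>m. (norm (F x - G m x))\<^sup>2) \<longlonglongrightarrow> 0" by simp
    qed
    show "AE x in lebesgue_on \<Omega>. norm ((norm (F x - G m x))\<^sup>2) \<le> (C + B)\<^sup>2" for m
    proof (intro AE_I2)
      fix x assume "x \<in> space (lebesgue_on \<Omega>)"
      then have "norm (F x - G m x) \<le> C + B"
        using B[of x m] C[of x] norm_triangle_ineq4[of "F x" "G m x"] by simp
      then show "norm ((norm (F x - G m x))\<^sup>2) \<le> (C + B)\<^sup>2" by (simp add: power_mono)
    qed
  qed auto
  then have "(\<lambda>m. sqrt (integral\<^sup>L (lebesgue_on \<Omega>) (\<lambda>x. (norm (F x - G m x))\<^sup>2))) \<longlonglongrightarrow> sqrt 0"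
    by (intro tendsto_real_sqrt) simp
  then show ?thesis by (simp add: L2_norm_def)
qed

text \<open>Integrates the elementary inequality |f| \<le> e + |f|^2 / e, a substitute for the
  Cauchy-Schwarz inequality that is sharp enough for density arguments.\<close>

lemma integral_norm_le_L2_norm:
  fixes f :: "'a::euclidean_space \<Rightarrow> 'b::euclidean_space"
  assumes \<Omega>: "open \<Omega>" "bounded \<Omega>" and f: "f \<in> L2 \<Omega>" and e: "e > 0" "L2_norm \<Omega> f < e"
  shows "integral\<^sup>L (lebesgue_on \<Omega>) (\<lambda>x. norm (f x)) \<le> e * (1 + measure (lebesgue_on \<Omega>) \<Omega>)"
proof -
  interpret finite_measure "lebesgue_on \<Omega>" using finite_lebesgue_on \<Omega> by blast
  have i: "integrable (lebesgue_on \<Omega>) (\<lambda>x. (norm (f x))\<^sup>2)" using f by (simp add: L2_def)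
  define I where "I = integral\<^sup>L (lebesgue_on \<Omega>) (\<lambda>x. (norm (f x))\<^sup>2)"
  have "sqrt I < e" using e(2) by (simp add: L2_norm_def I_def)
  then have "I < e\<^sup>2" using e(1) real_sqrt_less_iff[of I "e\<^sup>2"] by simp
  have "integral\<^sup>L (lebesgue_on \<Omega>) (\<lambda>x. norm (f x)) \<le> integral\<^sup>L (lebesgue_on \<Omega>) (\<lambda>x. e + (1/e) * (norm (f x))\<^sup>2)"
  proof (rule integral_mono)
    show "integrable (lebesgue_on \<Omega>) (\<lambda>x. norm (f x))" using L2_integrable[OF \<Omega> f] by simp
    fix x
    have "0 \<le> (e - norm (f x))\<^sup>2 + e * norm (f x)" using e(1) by simp
    also have "\<dots> = e * (e + (1/e) * (norm (f x))\<^sup>2) - e * norm (f x)"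
      using e(1) by (simp add: power2_eq_square algebra_simps)
    finally have "e * norm (f x) \<le> e * (e + (1/e) * (norm (f x))\<^sup>2)" by simp
    then show "norm (f x) \<le> e + (1/e) * (norm (f x))\<^sup>2" using e(1) by simp
  qed (use i in auto)
  also have "\<dots> = e * measure (lebesgue_on \<Omega>) \<Omega> + (1/e) * I"
    using i by (simp add: I_def)
  also have "\<dots> \<le> e * measure (lebesgue_on \<Omega>) \<Omega> + e"
    using \<open>I < e\<^sup>2\<close> e(1) by (simp add: field_simps power2_eq_square)
  finally show ?thesis by (simp add: algebra_simps)
qed

lemma integrable_mult_cnj:
  fixes g h :: "'a::euclidean_space \<Rightarrow> complex"
  assumes "bounded \<Omega>" "continuous_on UNIV g" "integrable (lebesgue_on \<Omega>) h"
  shows "integrable (lebesgue_on \<Omega>) (\<lambda>x. g x * cnj (h x))"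
proof -
  obtain M where M: "M > 0" "\<And>x. x \<in> \<Omega> \<Longrightarrow> norm (g x) \<le> M" using continuous_bounded_on[OF assms(2,1)] by blast
  have [measurable]: "g \<in> borel_measurable (lebesgue_on \<Omega>)" by (rule continuous_measurable_lebesgue_on[OF assms(2)])
  have ih: "integrable (lebesgue_on \<Omega>) (\<lambda>x. cnj (h x))" using assms(3) by simp
  then have [measurable]: "(\<lambda>x. cnj (h x)) \<in> borel_measurable (lebesgue_on \<Omega>)" by (rule borel_measurable_integrable)
  show ?thesis
  proof (rule Bochner_Integration.integrable_bound)
    show "integrable (lebesgue_on \<Omega>) (\<lambda>x. M *\<^sub>R h x)" using assms(3) by simp
    show "AE x in lebesgue_on \<Omega>. norm (g x * cnj (h x)) \<le> norm (M *\<^sub>R h x)"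
      using M by (intro AE_I2) (auto simp: norm_mult intro!: mult_right_mono)
  qed measurable
qed

text \<open>Multiply the equation by the conjugate components of the test field and shift one
  derivative in the Laplacian and in the pressure term; the compact support of \<open>\<phi>\<close>
  removes all boundary terms.\<close>

lemma cvec_test_identity:
  fixes u f :: "'n::finite \<Rightarrow> real^'n \<Rightarrow> real" and p :: "real^'n \<Rightarrow> real" and \<phi> :: "real^'n \<Rightarrow> complex^'n"
  assumes \<Omega>: "open \<Omega>" "bounded \<Omega>" and u: "\<And>j. Ck 2 (u j)" and p: "Ck 1 p"
    and f: "\<And>j x. f j x = lam * u j x - (\<Sum>i\<in>UNIV. dir_deriv (axis i 1) (dir_deriv (axis i 1) (u j)) x) + dir_deriv (axis j 1) p x"
    and fc: "\<And>j. continuous_on UNIV (f j)"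
    and \<phi>: "\<phi> \<in> test_functions \<Omega>"
  shows "of_real lam * integral\<^sup>L (lebesgue_on \<Omega>) (\<lambda>x. \<Sum>j\<in>UNIV. cvec u x $ j * cnj (\<phi> x $ j))
      + integral\<^sup>L (lebesgue_on \<Omega>) (\<lambda>x. \<Sum>i\<in>UNIV. \<Sum>j\<in>UNIV. grad (cvec u) x $ i $ j * cnj (grad \<phi> x $ i $ j))
      - integral\<^sup>L (lebesgue_on \<Omega>) (\<lambda>x. complex_of_real (p x) * cnj (\<Sum>i\<in>UNIV. grad \<phi> x $ i $ i))
      = integral\<^sup>L (lebesgue_on \<Omega>) (\<lambda>x. \<Sum>j\<in>UNIV. cvec f x $ j * cnj (\<phi> x $ j))"
proof -
  define e where "e i = (axis i 1 :: real^'n)" for i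
  have e: "e i \<in> Basis" for i by (simp add: e_def)
  define P where "P j x = cnj (\<phi> x $ j)" for j x
  have bl: "bounded_linear (\<lambda>y::complex^'n. cnj (y $ j))" for j
    using bounded_linear_compose[OF bounded_linear_cnj bounded_linear_vec_nth] .
  have P: "Ck k (P j)" for k j unfolding P_def[abs_def] by (rule Ck_bounded_linear[OF bl test_functionsD(1)[OF \<phi>]])
  have d\<phi>: "\<phi> differentiable (at x)" for x by (rule Ck_differentiable[OF test_functionsD(1)[OF \<phi>, of 1]]) simp
  have DP: "dir_deriv b (P j) x = cnj (dir_deriv b \<phi> x $ j)" for b j x
    unfolding P_def[abs_def] by (rule dir_deriv_bounded_linear[OF bl d\<phi>])
  have Pz: "P j x = 0" "dir_deriv b (P j) x = 0" if "x \<notin> \<Omega>" for b j x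
    using that test_functionsD(2)[OF \<phi>] test_functions_dir_deriv_outside[OF \<phi>] unfolding DP by (auto simp: P_def)
  have Ps: "bdd_supp (P j)" for j
    unfolding P_def[abs_def] using test_functionsD(3)[OF \<phi>] by (rule bdd_supp_compose[where L="\<lambda>y. cnj (y $ j)"]) simp
  have DPc: "continuous_on UNIV (dir_deriv (e i) (P j))" for i j using P[of 1 j] e by simp
  have u1: "Ck 1 (dir_deriv (e i) (u j))" for i j using u[of j] e by (simp add: numeral_2_eq_2)
  have du: "u j differentiable (at x)" for j x using u[of j] by (simp add: numeral_2_eq_2)
  note uc = Ck_continuous[OF u] and u1c = Ck_continuous[OF u1] and Pc = Ck_continuous[OF P[of 0]] and pc = Ck_continuous[OF p]
  have u2c: "continuous_on UNIV (dir_deriv (e i) (dir_deriv (e i) (u j)))" for i j using u1[of i j] e by simp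
  have Dpc: "continuous_on UNIV (dir_deriv (e i) p)" for i using p e by simp
  have on: "integral\<^sup>L (lebesgue_on \<Omega>) (\<lambda>x. q x *\<^sub>R Q x) = (\<integral>x. q x *\<^sub>R Q x \<partial>lborel)"
    if "continuous_on UNIV q" "continuous_on UNIV Q" "\<And>x. x \<notin> \<Omega> \<Longrightarrow> Q x = 0" for q :: "real^'n \<Rightarrow> real" and Q :: "real^'n \<Rightarrow> complex"
    using that by (intro integral_lebesgue_on_lborel \<Omega> continuous_on_scaleR) auto
  have io: "integrable (lebesgue_on \<Omega>) (\<lambda>x. q x *\<^sub>R Q x)"
    if "continuous_on UNIV q" "continuous_on UNIV Q" for q :: "real^'n \<Rightarrow> real" and Q :: "real^'n \<Rightarrow> complex"
    using that by (intro integrable_continuous_lebesgue_on \<Omega> continuous_on_scaleR)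
  have il: "integrable lborel (\<lambda>x. q x *\<^sub>R P j x)" if "continuous_on UNIV q" for q :: "real^'n \<Rightarrow> real" and j
    using that by (intro integrable_continuous_bdd_supp continuous_on_scaleR Pc bdd_supp_scaleR2 Ps)
  define A where "A j = (\<integral>x. u j x *\<^sub>R P j x \<partial>lborel)" for j
  define B where "B i j = (\<integral>x. dir_deriv (e i) (u j) x *\<^sub>R dir_deriv (e i) (P j) x \<partial>lborel)" for i j
  define C where "C i = (\<integral>x. p x *\<^sub>R dir_deriv (e i) (P i) x \<partial>lborel)" for i
  define F where "F j = (\<integral>x. f j x *\<^sub>R P j x \<partial>lborel)" for j
  have IA: "integral\<^sup>L (lebesgue_on \<Omega>) (\<lambda>x. \<Sum>j\<in>UNIV. cvec u x $ j * cnj (\<phi> x $ j)) = (\<Sum>j\<in>UNIV. A j)"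
  proof -
    have "(\<lambda>x. \<Sum>j\<in>UNIV. cvec u x $ j * cnj (\<phi> x $ j)) = (\<lambda>x. \<Sum>j\<in>UNIV. u j x *\<^sub>R P j x)"
      by (simp add: cvec_def P_def scaleR_conv_of_real)
    then show ?thesis unfolding A_def
      by (simp add: Bochner_Integration.integral_sum io uc Pc on Pz)
  qed
  have IF: "integral\<^sup>L (lebesgue_on \<Omega>) (\<lambda>x. \<Sum>j\<in>UNIV. cvec f x $ j * cnj (\<phi> x $ j)) = (\<Sum>j\<in>UNIV. F j)"
  proof -
    have "(\<lambda>x. \<Sum>j\<in>UNIV. cvec f x $ j * cnj (\<phi> x $ j)) = (\<lambda>x. \<Sum>j\<in>UNIV. f j x *\<^sub>R P j x)"
      by (simp add: cvec_def P_def scaleR_conv_of_real)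
    then show ?thesis unfolding F_def
      by (simp add: Bochner_Integration.integral_sum io fc Pc on Pz)
  qed
  have IB: "integral\<^sup>L (lebesgue_on \<Omega>) (\<lambda>x. \<Sum>i\<in>UNIV. \<Sum>j\<in>UNIV. grad (cvec u) x $ i $ j * cnj (grad \<phi> x $ i $ j)) = (\<Sum>i\<in>UNIV. \<Sum>j\<in>UNIV. B i j)"
  proof -
    have "(\<lambda>x. \<Sum>i\<in>UNIV. \<Sum>j\<in>UNIV. grad (cvec u) x $ i $ j * cnj (grad \<phi> x $ i $ j)) =
        (\<lambda>x. \<Sum>i\<in>UNIV. \<Sum>j\<in>UNIV. dir_deriv (e i) (u j) x *\<^sub>R dir_deriv (e i) (P j) x)"
      by (simp add: grad_def dir_deriv_cvec du DP e_def scaleR_conv_of_real) (simp add: cvec_def)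
    then show ?thesis unfolding B_def
      by (simp add: Bochner_Integration.integral_sum Bochner_Integration.integrable_sum io u1c DPc on Pz)
  qed
  have IC: "integral\<^sup>L (lebesgue_on \<Omega>) (\<lambda>x. complex_of_real (p x) * cnj (\<Sum>i\<in>UNIV. grad \<phi> x $ i $ i)) = (\<Sum>i\<in>UNIV. C i)"
  proof -
    have "(\<lambda>x. complex_of_real (p x) * cnj (\<Sum>i\<in>UNIV. grad \<phi> x $ i $ i)) = (\<lambda>x. \<Sum>i\<in>UNIV. p x *\<^sub>R dir_deriv (e i) (P i) x)"
      by (simp add: grad_def DP e_def scaleR_conv_of_real sum_distrib_left)
    then show ?thesis unfolding C_def
      by (simp add: Bochner_Integration.integral_sum io pc DPc on Pz)
  qed
  have B: "B i j = - (\<integral>x. dir_deriv (e i) (dir_deriv (e i) (u j)) x *\<^sub>R P j x \<partial>lborel)" for i j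
    using integral_by_parts[OF u1[of i j] P[of 1 j] disjI2[OF Ps[of j]] e[of i]] by (simp add: B_def)
  have C: "C i = - (\<integral>x. dir_deriv (e i) p x *\<^sub>R P i x \<partial>lborel)" for i
    using integral_by_parts[OF p P[of 1 i] disjI2[OF Ps[of i]] e[of i]] by (simp add: C_def)
  have F: "F j = of_real lam * A j + (\<Sum>i\<in>UNIV. B i j) - C j" for j
  proof -
    have i1: "integrable lborel (\<lambda>x. lam *\<^sub>R (u j x *\<^sub>R P j x))" by (intro integrable_scaleR_right il uc)
    have i2: "integrable lborel (\<lambda>x. \<Sum>i\<in>UNIV. dir_deriv (e i) (dir_deriv (e i) (u j)) x *\<^sub>R P j x)"
      by (intro Bochner_Integration.integrable_sum il u2c)
    have i3: "integrable lborel (\<lambda>x. dir_deriv (e j) p x *\<^sub>R P j x)" by (rule il[OF Dpc])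
    have "F j = (\<integral>x. lam *\<^sub>R (u j x *\<^sub>R P j x) - (\<Sum>i\<in>UNIV. dir_deriv (e i) (dir_deriv (e i) (u j)) x *\<^sub>R P j x) + dir_deriv (e j) p x *\<^sub>R P j x \<partial>lborel)"
      unfolding F_def f e_def by (simp add: scaleR_add_left scaleR_diff_left scaleR_sum_left)
    also have "\<dots> = (\<integral>x. lam *\<^sub>R (u j x *\<^sub>R P j x) \<partial>lborel) - (\<integral>x. (\<Sum>i\<in>UNIV. dir_deriv (e i) (dir_deriv (e i) (u j)) x *\<^sub>R P j x) \<partial>lborel)
        + (\<integral>x. dir_deriv (e j) p x *\<^sub>R P j x \<partial>lborel)"
      by (simp only: Bochner_Integration.integral_add[OF Bochner_Integration.integrable_diff[OF i1 i2] i3]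
        Bochner_Integration.integral_diff[OF i1 i2])
    also have "(\<integral>x. (\<Sum>i\<in>UNIV. dir_deriv (e i) (dir_deriv (e i) (u j)) x *\<^sub>R P j x) \<partial>lborel) = - (\<Sum>i\<in>UNIV. B i j)"
      by (subst Bochner_Integration.integral_sum) (auto simp: B sum_negf intro: il u2c)
    finally show ?thesis by (simp add: A_def C scaleR_conv_of_real)
  qed
  have "(\<Sum>j\<in>UNIV. F j) = of_real lam * (\<Sum>j\<in>UNIV. A j) + (\<Sum>i\<in>UNIV. \<Sum>j\<in>UNIV. B i j) - (\<Sum>i\<in>UNIV. C i)"
    by (subst sum.swap) (simp add: F sum_subtractf sum.distrib sum_distrib_left)
  then show ?thesis unfolding IA IB IC IF by simp
qed

text \<open>The defect of the weak formulation is additive in the test field and bounded by L^1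
  norms of the field and its gradient. It vanishes on test functions, hence on their closure
  \<open>H1_0 \<Omega>\<close>.\<close>

lemma strong_solution_is_weak:
  fixes u f :: "'n::finite \<Rightarrow> real^'n \<Rightarrow> real" and p :: "real^'n \<Rightarrow> real"
  assumes \<Omega>: "open \<Omega>" "bounded \<Omega>" and u: "\<And>j. Ck 2 (u j)" and p: "Ck 1 p"
    and f: "\<And>j x. f j x = lam * u j x - (\<Sum>i\<in>UNIV. dir_deriv (axis i 1) (dir_deriv (axis i 1) (u j)) x) + dir_deriv (axis j 1) p x"
    and fc: "\<And>j. continuous_on UNIV (f j)"
    and uH: "cvec u \<in> H1_0_sigma \<Omega>" and pL: "(\<lambda>x. complex_of_real (p x)) \<in> L2_zero \<Omega>"
  shows "stokes_resolvent_solution \<Omega> (of_real lam) (cvec f) (cvec u) (\<lambda>x. complex_of_real (p x))"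
  unfolding stokes_resolvent_solution_def
proof (intro conjI uH pL ballI)
  fix v assume v: "v \<in> H1_0 \<Omega>"
  let ?M = "lebesgue_on \<Omega>"
  define U where "U = grad (cvec u)"
  have cu2: "Ck 2 (cvec u)" by (rule Ck_cvec[OF u])
  have cu1: "Ck 1 (cvec u)" by (rule Ck_mono[OF cu2]) simp
  have cu: "continuous_on UNIV (cvec u)" and cf: "continuous_on UNIV (cvec f)" and cU: "continuous_on UNIV U"
    using Ck_continuous[OF cu2] Ck_cvec[of 0 f] fc continuous_grad[OF cu1] by (auto simp: U_def)
  have cp: "continuous_on UNIV (\<lambda>x. complex_of_real (p x))" using Ck_continuous[OF p] by (intro continuous_intros)
  have cn: "continuous_on UNIV (\<lambda>x. g x $ j)" if "continuous_on UNIV g" for g :: "real^'n \<Rightarrow> 'z::topological_space^'n" and j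
    using that by (rule continuous_on_component)
  \<comment> \<open>The defect of the weak formulation. The gradient is a separate argument, so that
    a classical gradient can stand in for the chosen \<open>weak_grad\<close>.\<close>
  define E where "E w G = of_real lam * integral\<^sup>L ?M (\<lambda>x. \<Sum>j\<in>UNIV. cvec u x $ j * cnj (w x $ j))
      + integral\<^sup>L ?M (\<lambda>x. \<Sum>i\<in>UNIV. \<Sum>j\<in>UNIV. U x $ i $ j * cnj (G x $ i $ j))
      - integral\<^sup>L ?M (\<lambda>x. complex_of_real (p x) * cnj (\<Sum>i\<in>UNIV. G x $ i $ i))
      - integral\<^sup>L ?M (\<lambda>x. \<Sum>j\<in>UNIV. cvec f x $ j * cnj (w x $ j))" for w and G :: "real^'n \<Rightarrow> complex^'n^'n"
  have int1: "integrable ?M (\<lambda>x. w x $ j)" if "integrable ?M w" for w :: "real^'n \<Rightarrow> complex^'n" and j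
    using integrable_bounded_linear[OF bounded_linear_vec_nth that] .
  have int2: "integrable ?M (\<lambda>x. G x $ i $ j)" if "integrable ?M G" for G :: "real^'n \<Rightarrow> complex^'n^'n" and i j
    using integrable_bounded_linear[OF bounded_linear_compose[OF bounded_linear_vec_nth bounded_linear_vec_nth] that] .
  have ints: "integrable ?M (\<lambda>x. \<Sum>j\<in>UNIV. cvec u x $ j * cnj (w x $ j))"
     "integrable ?M (\<lambda>x. \<Sum>i\<in>UNIV. \<Sum>j\<in>UNIV. U x $ i $ j * cnj (G x $ i $ j))"
     "integrable ?M (\<lambda>x. complex_of_real (p x) * cnj (\<Sum>i\<in>UNIV. G x $ i $ i))"
     "integrable ?M (\<lambda>x. \<Sum>j\<in>UNIV. cvec f x $ j * cnj (w x $ j))"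
    if "integrable ?M w" "integrable ?M G" for w :: "real^'n \<Rightarrow> complex^'n" and G :: "real^'n \<Rightarrow> complex^'n^'n"
  proof -
    show "integrable ?M (\<lambda>x. \<Sum>j\<in>UNIV. cvec u x $ j * cnj (w x $ j))"
      by (intro Bochner_Integration.integrable_sum integrable_mult_cnj \<Omega> cn cu int1 that)
    show "integrable ?M (\<lambda>x. \<Sum>i\<in>UNIV. \<Sum>j\<in>UNIV. U x $ i $ j * cnj (G x $ i $ j))"
      by (intro Bochner_Integration.integrable_sum integrable_mult_cnj \<Omega> cn cU int2 that)
    show "integrable ?M (\<lambda>x. complex_of_real (p x) * cnj (\<Sum>i\<in>UNIV. G x $ i $ i))"
      by (intro integrable_mult_cnj Bochner_Integration.integrable_sum \<Omega> cp int2 that)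
    show "integrable ?M (\<lambda>x. \<Sum>j\<in>UNIV. cvec f x $ j * cnj (w x $ j))"
      by (intro Bochner_Integration.integrable_sum integrable_mult_cnj \<Omega> cn cf int1 that)
  qed
  \<comment> \<open>The integrand of the defect: additivity and the bound by \<open>Q\<close> are
    pointwise statements about it.\<close>
  define \<Theta> where "\<Theta> w G x = of_real lam * (\<Sum>j\<in>UNIV. cvec u x $ j * cnj (w x $ j))
      + (\<Sum>i\<in>UNIV. \<Sum>j\<in>UNIV. U x $ i $ j * cnj (G x $ i $ j))
      - complex_of_real (p x) * cnj (\<Sum>i\<in>UNIV. G x $ i $ i)
      - (\<Sum>j\<in>UNIV. cvec f x $ j * cnj (w x $ j))" for w and G :: "real^'n \<Rightarrow> complex^'n^'n" and x
  have E\<Theta>: "E w G = integral\<^sup>L ?M (\<Theta> w G)" "integrable ?M (\<Theta> w G)" if "integrable ?M w" "integrable ?M G" for w G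
    unfolding E_def \<Theta>_def[abs_def] using ints[OF that] by simp_all
  have \<Theta>diff: "\<Theta> (\<lambda>x. w x - w' x) (\<lambda>x. G x - G' x) = (\<lambda>x. \<Theta> w G x - \<Theta> w' G' x)" for w w' G G'
    by (rule ext) (simp add: \<Theta>_def sum_subtractf right_diff_distrib)
  obtain M1 where M1: "M1 > 0" "\<And>x. x \<in> \<Omega> \<Longrightarrow> norm (cvec u x) \<le> M1" using continuous_bounded_on[OF cu \<Omega>(2)] by blast
  obtain M2 where M2: "M2 > 0" "\<And>x. x \<in> \<Omega> \<Longrightarrow> norm (U x) \<le> M2" using continuous_bounded_on[OF cU \<Omega>(2)] by blast
  obtain M3 where M3: "M3 > 0" "\<And>x. x \<in> \<Omega> \<Longrightarrow> norm (complex_of_real (p x)) \<le> M3" using continuous_bounded_on[OF cp \<Omega>(2)] by blast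
  obtain M4 where M4: "M4 > 0" "\<And>x. x \<in> \<Omega> \<Longrightarrow> norm (cvec f x) \<le> M4" using continuous_bounded_on[OF cf \<Omega>(2)] by blast
  define N where "N = real CARD('n)"
  have vb: "norm (\<Sum>j\<in>UNIV. a $ j * cnj (b $ j)) \<le> N * (m * norm b)" if "norm a \<le> m" for a b :: "complex^'n" and m
  proof -
    have "norm (\<Sum>j\<in>UNIV. a $ j * cnj (b $ j)) \<le> (\<Sum>j\<in>(UNIV::'n set). m * norm b)"
    proof (rule sum_norm_le)
      fix j
      have "norm (a $ j) \<le> m" "norm (b $ j) \<le> norm b"
        using Finite_Cartesian_Product.norm_nth_le[of a j] Finite_Cartesian_Product.norm_nth_le[of b j] that by linarith+
      moreover have "0 \<le> m" using that norm_ge_zero order_trans by blast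
      ultimately show "norm (a $ j * cnj (b $ j)) \<le> m * norm b" by (simp add: norm_mult mult_mono)
    qed
    then show ?thesis by (simp add: N_def)
  qed
  have Gb: "norm (\<Sum>i\<in>UNIV. \<Sum>j\<in>UNIV. a $ i $ j * cnj (b $ i $ j)) \<le> N * (N * (m * norm b))" if "norm a \<le> m" for a b :: "complex^'n^'n" and m
  proof -
    have "norm (\<Sum>j\<in>UNIV. a $ i $ j * cnj (b $ i $ j)) \<le> N * (m * norm b)" for i
    proof -
      have m0: "0 \<le> m" using that norm_ge_zero order_trans by blast
      have "norm (\<Sum>j\<in>UNIV. a $ i $ j * cnj (b $ i $ j)) \<le> N * (m * norm (b $ i))"
        using that by (intro vb order_trans[OF Finite_Cartesian_Product.norm_nth_le])
      also have "\<dots> \<le> N * (m * norm b)" using m0 by (intro mult_left_mono Finite_Cartesian_Product.norm_nth_le) (auto simp: N_def)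
      finally show ?thesis .
    qed
    then have "norm (\<Sum>i\<in>UNIV. \<Sum>j\<in>UNIV. a $ i $ j * cnj (b $ i $ j)) \<le> (\<Sum>i\<in>(UNIV::'n set). N * (m * norm b))"
      by (intro sum_norm_le)
    then show ?thesis by (simp add: N_def)
  qed
  have tb: "norm (cnj (\<Sum>i\<in>UNIV. b $ i $ i)) \<le> N * norm b" for b :: "complex^'n^'n"
  proof -
    have "norm (\<Sum>i\<in>UNIV. b $ i $ i) \<le> (\<Sum>i\<in>(UNIV::'n set). norm b)"
      by (intro sum_norm_le order_trans[OF Finite_Cartesian_Product.norm_nth_le Finite_Cartesian_Product.norm_nth_le])
    then show ?thesis unfolding complex_mod_cnj by (simp add: N_def)
  qed
  define Q where "Q = \<bar>lam\<bar> * (N * M1) + N * (N * M2) + M3 * N + N * M4"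
  have N0: "N \<ge> 0" by (simp add: N_def)
  have Q0: "Q \<ge> 0" using M1 M2 M3 M4 N0 by (simp add: Q_def)
  have \<Theta>b: "norm (\<Theta> w G x) \<le> Q * (norm (w x) + norm (G x))" if x: "x \<in> \<Omega>" for w G x
  proof -
    have 1: "norm (of_real lam * (\<Sum>j\<in>UNIV. cvec u x $ j * cnj (w x $ j))) \<le> \<bar>lam\<bar> * (N * (M1 * norm (w x)))"
      unfolding norm_mult using vb[OF M1(2)[OF x]] by (simp add: mult_left_mono)
    have 2: "norm (\<Sum>i\<in>UNIV. \<Sum>j\<in>UNIV. U x $ i $ j * cnj (G x $ i $ j)) \<le> N * (N * (M2 * norm (G x)))"
      by (rule Gb[OF M2(2)[OF x]])
    have 3: "norm (complex_of_real (p x) * cnj (\<Sum>i\<in>UNIV. G x $ i $ i)) \<le> M3 * (N * norm (G x))"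
      unfolding norm_mult using M3 x tb by (intro mult_mono) auto
    have 4: "norm (\<Sum>j\<in>UNIV. cvec f x $ j * cnj (w x $ j)) \<le> N * (M4 * norm (w x))"
      by (rule vb[OF M4(2)[OF x]])
    have "norm (\<Theta> w G x) \<le> \<bar>lam\<bar> * (N * (M1 * norm (w x))) + N * (N * (M2 * norm (G x))) + M3 * (N * norm (G x)) + N * (M4 * norm (w x))"
      unfolding \<Theta>_def using 1 2 3 4
      by (intro order_trans[OF norm_triangle_ineq4] add_mono order_trans[OF norm_triangle_ineq])
    also have "\<dots> = (\<bar>lam\<bar> * (N * M1) + N * M4) * norm (w x) + (N * (N * M2) + M3 * N) * norm (G x)"
      by (simp add: algebra_simps)
    also have "\<dots> \<le> Q * norm (w x) + Q * norm (G x)"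
      using M1 M2 M3 M4 N0 by (intro add_mono mult_right_mono) (auto simp: Q_def)
    finally show ?thesis by (simp add: algebra_simps)
  qed
  have vH: "v \<in> H1 \<Omega>" and vL: "v \<in> L2 \<Omega>" using v by (auto simp: H1_0_def H1_def)
  define W where "W = weak_grad \<Omega> v"
  have W: "has_weak_grad \<Omega> v W" unfolding W_def by (rule weak_grad_works[OF vH])
  then have WL: "W \<in> L2 \<Omega>" by (simp add: has_weak_grad_def)
  have iv: "integrable ?M v" "integrable ?M W" by (intro L2_integrable \<Omega> vL WL)+
  \<comment> \<open>The defect vanishes at a test field close to \<open>v\<close>, so only the
    difference contributes. The factor 2 in \<open>R\<close> counts the L^1 norms of the difference
    and of its gradient.\<close>
  have small: "norm (E v W) \<le> e" if e: "e > 0" for e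
  proof -
    define R where "R = Q * (2 * (1 + measure ?M \<Omega>))"
    have R0: "R \<ge> 0" using Q0 by (simp add: R_def)
    define d where "d = e / (1 + R)"
    have d: "d > 0" using e R0 by (simp add: d_def)
    obtain \<phi> where \<phi>: "\<phi> \<in> test_functions \<Omega>" "H1_norm \<Omega> (\<lambda>x. v x - \<phi> x) < d"
      using v d by (auto simp: H1_0_def)
    have \<phi>1: "Ck 1 \<phi>" by (rule test_functionsD(1)[OF \<phi>(1)])
    have c\<phi>: "continuous_on UNIV \<phi>" "continuous_on UNIV (grad \<phi>)" by (rule Ck_continuous[OF \<phi>1], rule continuous_grad[OF \<phi>1])
    have i\<phi>: "integrable ?M \<phi>" "integrable ?M (grad \<phi>)" by (intro integrable_continuous_lebesgue_on \<Omega> c\<phi>)+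
    have L\<phi>: "\<phi> \<in> L2 \<Omega>" "grad \<phi> \<in> L2 \<Omega>" by (intro continuous_L2 \<Omega> c\<phi>)+
    let ?w = "\<lambda>x. v x - \<phi> x" and ?H = "\<lambda>x. W x - grad \<phi> x"
    have wL: "?w \<in> L2 \<Omega>" "?H \<in> L2 \<Omega>" by (intro L2_diff vL WL L\<phi>)+
    have "has_weak_grad \<Omega> ?w ?H"
      by (rule has_weak_grad_diff[OF \<Omega> vL L\<phi>(1) W has_weak_grad_grad[OF \<Omega> \<phi>1]])
    then have "sqrt ((L2_norm \<Omega> ?w)\<^sup>2 + (L2_norm \<Omega> ?H)\<^sup>2) < d"
      using H1_norm_eq[OF \<Omega>] \<phi>(2) by simp
    then have n: "L2_norm \<Omega> ?w < d" "L2_norm \<Omega> ?H < d"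
      using real_sqrt_sum_squares_ge1[of "L2_norm \<Omega> ?w" "L2_norm \<Omega> ?H"] real_sqrt_sum_squares_ge2[of "L2_norm \<Omega> ?H" "L2_norm \<Omega> ?w"] by linarith+
    note iw = L2_integrable[OF \<Omega> wL(1)] L2_integrable[OF \<Omega> wL(2)]
    have "E \<phi> (grad \<phi>) = 0"
      using cvec_test_identity[OF \<Omega> u p f fc \<phi>(1)] by (simp add: E_def U_def)
    then have "E v W = E v W - E \<phi> (grad \<phi>)" by simp
    also have "\<dots> = integral\<^sup>L ?M (\<Theta> ?w ?H)"
      unfolding \<Theta>diff using E\<Theta>[OF iv] E\<Theta>[OF i\<phi>] by simp
    finally have "norm (E v W) = norm (integral\<^sup>L ?M (\<Theta> ?w ?H))" by simp
    also have "\<dots> \<le> integral\<^sup>L ?M (\<lambda>x. Q * (norm (?w x) + norm (?H x)))"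
      by (rule Bochner_Integration.integral_norm_bound_integral) (use iw E\<Theta>(2)[OF iw] \<Theta>b in auto)
    also have "\<dots> = Q * (integral\<^sup>L ?M (\<lambda>x. norm (?w x)) + integral\<^sup>L ?M (\<lambda>x. norm (?H x)))"
      using iw by simp
    also have "\<dots> \<le> Q * (d * (1 + measure ?M \<Omega>) + d * (1 + measure ?M \<Omega>))"
      using Q0 by (intro mult_left_mono add_mono integral_norm_le_L2_norm \<Omega> wL d n)
    also have "\<dots> = R * d" by (simp add: R_def algebra_simps)
    also have "\<dots> \<le> e" using e R0 by (simp add: d_def field_simps)
    finally show ?thesis .
  qed
  have "E v W = 0" using field_le_epsilon[of "norm (E v W)" 0] small by simp
  \<comment> \<open>The weak formulation contains the chosen \<open>weak_grad\<close> of the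
    velocity, the computation its classical gradient \<open>U\<close>; they agree almost
    everywhere.\<close>
  moreover have "integral\<^sup>L ?M (\<lambda>x. \<Sum>i\<in>UNIV. \<Sum>j\<in>UNIV. weak_grad \<Omega> (cvec u) x $ i $ j * cnj (weak_grad \<Omega> v x $ i $ j))
     = integral\<^sup>L ?M (\<lambda>x. \<Sum>i\<in>UNIV. \<Sum>j\<in>UNIV. U x $ i $ j * cnj (W x $ i $ j))"
  proof (rule integral_cong_AE)
    have wg: "has_weak_grad \<Omega> (cvec u) (grad (cvec u))"
      by (intro has_weak_grad_grad \<Omega> Ck_mono[OF Ck_cvec[OF u]]) simp
    have ae: "AE x in ?M. weak_grad \<Omega> (cvec u) x = U x" unfolding U_def by (rule weak_grad_AE[OF \<Omega> wg])
    then show "AE x in ?M. (\<Sum>i\<in>UNIV. \<Sum>j\<in>UNIV. weak_grad \<Omega> (cvec u) x $ i $ j * cnj (weak_grad \<Omega> v x $ i $ j))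
       = (\<Sum>i\<in>UNIV. \<Sum>j\<in>UNIV. U x $ i $ j * cnj (W x $ i $ j))"
      by eventually_elim (simp add: W_def)
    show "(\<lambda>x. \<Sum>i\<in>UNIV. \<Sum>j\<in>UNIV. U x $ i $ j * cnj (W x $ i $ j)) \<in> borel_measurable ?M"
      using ints(2)[OF iv] by auto
    have "cvec u \<in> H1 \<Omega>" using uH by (simp add: H1_0_sigma_def)
    then have "weak_grad \<Omega> (cvec u) \<in> L2 \<Omega>" using weak_grad_works by (auto simp: has_weak_grad_def)
    then have 1: "integrable ?M (weak_grad \<Omega> (cvec u))" by (rule L2_integrable[OF \<Omega>])
    have [measurable]: "(\<lambda>x. weak_grad \<Omega> (cvec u) x $ i $ j) \<in> borel_measurable ?M" for i j using int2[OF 1] by auto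
    have [measurable]: "(\<lambda>x. cnj (weak_grad \<Omega> v x $ i $ j)) \<in> borel_measurable ?M" for i j
      using int2[OF iv(2), of i j] unfolding W_def by (intro borel_measurable_integrable) simp
    show "(\<lambda>x. \<Sum>i\<in>UNIV. \<Sum>j\<in>UNIV. weak_grad \<Omega> (cvec u) x $ i $ j * cnj (weak_grad \<Omega> v x $ i $ j)) \<in> borel_measurable ?M"
      by measurable
  qed
  ultimately show "of_real lam * integral\<^sup>L ?M (\<lambda>x. \<Sum>j\<in>UNIV. cvec u x $ j * cnj (v x $ j))
        + integral\<^sup>L ?M (\<lambda>x. \<Sum>i\<in>UNIV. \<Sum>j\<in>UNIV. weak_grad \<Omega> (cvec u) x $ i $ j * cnj (weak_grad \<Omega> v x $ i $ j))
        - integral\<^sup>L ?M (\<lambda>x. complex_of_real (p x) * cnj (weak_div \<Omega> v x))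
        = integral\<^sup>L ?M (\<lambda>x. \<Sum>j\<in>UNIV. cvec f x $ j * cnj (v x $ j))"
    by (simp add: E_def W_def weak_div_def)
qed

section \<open>Stream functions\<close>

definition perp :: "'n::finite \<Rightarrow> 'n \<Rightarrow> (real^'n \<Rightarrow> real) \<Rightarrow> 'n \<Rightarrow> real^'n \<Rightarrow> real" where
  "perp i1 i2 c j = (if j = i1 then dir_deriv (axis i2 1) c
     else if j = i2 then (\<lambda>x. - dir_deriv (axis i1 1) c x) else (\<lambda>x. 0))"

definition lap :: "(real^'n \<Rightarrow> real) \<Rightarrow> real^'n \<Rightarrow> real" where
  "lap a x = (\<Sum>i\<in>UNIV. dir_deriv (axis i 1) (dir_deriv (axis i 1) a) x)"

lemma Ck_perp: "Ck (Suc k) c \<Longrightarrow> Ck k (perp i1 i2 c j)"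
  unfolding perp_def by (auto intro: Ck_minus)

lemma Ck_lap:
  fixes a :: "real^'n \<Rightarrow> real"
  assumes "Ck (Suc (Suc k)) a" shows "Ck k (lap a)"
  unfolding lap_def[abs_def] using assms by (intro Ck_sum) auto

lemma dir_deriv_uminus:
  fixes f :: "'a::euclidean_space \<Rightarrow> real"
  shows "f differentiable (at x) \<Longrightarrow> dir_deriv b (\<lambda>x. - f x) x = - dir_deriv b f x"
  using dir_deriv_cmult[of f x b "-1"] by simp

lemma dir_deriv_perp:
  assumes "Ck 2 c"
  shows "dir_deriv b (perp i1 i2 c j) x = (if j = i1 then dir_deriv b (dir_deriv (axis i2 1) c) x
     else if j = i2 then - dir_deriv b (dir_deriv (axis i1 1) c) x else 0)"
proof -
  have "dir_deriv (axis i 1) c differentiable (at x)" for i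
    using assms by (simp add: numeral_2_eq_2)
  then show ?thesis by (auto simp: perp_def dir_deriv_uminus)
qed

text \<open>Although \<open>c\<close> may depend on all coordinates, only its mixed derivative in
  the directions \<open>i1\<close> and \<open>i2\<close> enters the divergence, twice and with
  opposite signs.\<close>

lemma perp_solenoidal:
  fixes c :: "real^'n \<Rightarrow> real"
  assumes c: "c \<in> test_functions \<Omega>" and i: "i1 \<noteq> i2"
  shows "cvec (perp i1 i2 c) \<in> solenoidal_test_functions \<Omega>"
proof -
  define K where "K = closure {x. c x \<noteq> 0}"
  have K: "compact K" "K \<subseteq> \<Omega>" using c by (auto simp: test_functions_def K_def)
  have Ks: "closed K" by (simp add: K_def)
  have c0: "c x = 0" if "x \<notin> K" for x using that closure_subset[of "{x. c x \<noteq> 0}"] by (auto simp: K_def)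
  have D0: "dir_deriv b c x = 0" if "x \<notin> K" for x b
  proof -
    have "dir_deriv b c x = dir_deriv b (\<lambda>x. 0) x"
      by (rule dir_deriv_cong_open[of "- K"]) (use that Ks c0 in auto)
    then show ?thesis by simp
  qed
  have P: "Ck k (perp i1 i2 c j)" for k j by (rule Ck_perp[OF test_functionsD(1)[OF c]])
  have "cvec (perp i1 i2 c) \<in> test_functions \<Omega>"
  proof (rule test_functionsI[OF _ K])
    show "Ck k (cvec (perp i1 i2 c))" for k by (rule Ck_cvec[OF P])
    show "cvec (perp i1 i2 c) x = 0" if "x \<notin> K" for x
      using D0[OF that] by (simp add: cvec_def perp_def vec_eq_iff)
  qed
  moreover have "divergence (cvec (perp i1 i2 c)) x = 0" for x
  proof -
    have d: "perp i1 i2 c j differentiable (at x)" for j by (rule Ck_differentiable[OF P[of 1]]) simp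
    have "dir_deriv (axis i1 1) (dir_deriv (axis i2 1) c) = dir_deriv (axis i2 1) (dir_deriv (axis i1 1) c)"
      using test_functionsD[OF c] by (intro dir_deriv_commute) auto
    then have "dir_deriv (axis j 1) (perp i1 i2 c j) x =
        (if j = i1 then dir_deriv (axis i1 1) (dir_deriv (axis i2 1) c) x else 0)
        + (if j = i2 then - dir_deriv (axis i1 1) (dir_deriv (axis i2 1) c) x else 0)" for j
      using i by (simp add: dir_deriv_perp[OF test_functionsD(1)[OF c]])
    then have "(\<Sum>j\<in>UNIV. dir_deriv (axis j 1) (perp i1 i2 c j) x) = 0"
      by (simp add: sum.distrib sum.delta)
    then show ?thesis
      unfolding divergence_def dir_deriv_cvec[OF d] by (simp add: cvec_def flip: of_real_sum)
  qed
  ultimately show ?thesis by (simp add: solenoidal_test_functions_def)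
qed

lemma norm_vec_le_sum:
  fixes x :: "'a::real_normed_vector^'n" shows "norm x \<le> (\<Sum>i\<in>UNIV. norm (x $ i))"
  by (simp add: norm_vec_def L2_set_le_sum)

lemma norm_cvec_le:
  fixes w :: "'n::finite \<Rightarrow> 'a \<Rightarrow> real" and B :: real
  assumes "\<And>j. \<bar>w j x\<bar> \<le> B" shows "norm (cvec w x) \<le> CARD('n) * B"
proof -
  have "norm (cvec w x) \<le> (\<Sum>j\<in>UNIV. norm (cvec w x $ j))" by (rule norm_vec_le_sum)
  also have "\<dots> \<le> (\<Sum>j\<in>(UNIV::'n set). B)" using assms by (intro sum_mono) (simp add: cvec_def)
  finally show ?thesis by simp
qed

lemma tendsto_cvec:
  assumes "\<And>j. (\<lambda>m. w m j x) \<longlonglongrightarrow> v j x"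
  shows "(\<lambda>m. cvec (w m) x) \<longlonglongrightarrow> cvec v x"
  by (rule vec_tendstoI) (simp add: cvec_def assms tendsto_of_real)

text \<open>A function that is 0 on the boundary has no tangential derivative there, so its rotated
  gradient has zero normal component, the boundary condition encoded in \<open>L2_sigma\<close>.
  First-order control of the approximating stream functions is enough for L^2 convergence.\<close>

lemma perp_in_L2_sigma:
  fixes c :: "real^'n \<Rightarrow> real"
  assumes \<Omega>: "open \<Omega>" "bounded \<Omega>" and c: "Ck 1 c" "\<And>z. z \<in> frontier \<Omega> \<Longrightarrow> c z = 0" and i: "i1 \<noteq> i2"
  shows "cvec (perp i1 i2 c) \<in> L2_sigma \<Omega>"
proof (rule vanishing_approximation[OF \<Omega> c])
  fix \<xi> :: "nat \<Rightarrow> real^'n \<Rightarrow> real" and B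
  assume \<xi>: "\<And>m. \<xi> m \<in> test_functions \<Omega>"
    "\<And>m b x. b \<in> Basis \<Longrightarrow> x \<in> \<Omega> \<Longrightarrow> \<bar>dir_deriv b (\<xi> m) x\<bar> \<le> B"
    "\<And>b x. b \<in> Basis \<Longrightarrow> x \<in> \<Omega> \<Longrightarrow> (\<lambda>m. dir_deriv b (\<xi> m) x) \<longlonglongrightarrow> dir_deriv b c x"
  have cf: "continuous_on UNIV (cvec (perp i1 i2 c))"
    using c(1) by (intro Ck_continuous[of 0] Ck_cvec Ck_perp) simp
  have lim: "(\<lambda>m. L2_norm \<Omega> (\<lambda>x. cvec (perp i1 i2 c) x - cvec (perp i1 i2 (\<xi> m)) x)) \<longlonglongrightarrow> 0"
  proof (rule L2_norm_tendsto_0[OF \<Omega> cf])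
    show "continuous_on UNIV (cvec (perp i1 i2 (\<xi> m)))" for m
      by (intro Ck_continuous[of 0] Ck_cvec Ck_perp test_functionsD(1)[OF \<xi>(1)])
    fix x assume x: "x \<in> \<Omega>"
    show "(\<lambda>m. cvec (perp i1 i2 (\<xi> m)) x) \<longlonglongrightarrow> cvec (perp i1 i2 c) x"
      using \<xi>(3)[OF _ x] by (intro tendsto_cvec) (auto simp: perp_def intro!: tendsto_minus)
    have "\<bar>perp i1 i2 (\<xi> m) j x\<bar> \<le> \<bar>B\<bar>" for m j
      using \<xi>(2)[OF _ x, of "axis i1 1" m] \<xi>(2)[OF _ x, of "axis i2 1" m] by (auto simp: perp_def)
    then show "norm (cvec (perp i1 i2 (\<xi> m)) x) \<le> CARD('n) * \<bar>B\<bar>" for m by (rule norm_cvec_le)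
  qed
  have "\<exists>\<phi>\<in>solenoidal_test_functions \<Omega>. L2_norm \<Omega> (\<lambda>x. cvec (perp i1 i2 c) x - \<phi> x) < e" if e: "e > 0" for e
  proof -
    obtain m where "L2_norm \<Omega> (\<lambda>x. cvec (perp i1 i2 c) x - cvec (perp i1 i2 (\<xi> m)) x) < e"
      using order_tendstoD(2)[OF lim e] by (auto dest!: eventually_happens)
    then show ?thesis using perp_solenoidal[OF \<xi>(1) i] by blast
  qed
  then show ?thesis using continuous_L2[OF \<Omega> cf] by (auto simp: L2_sigma_def)
qed

lemma grad_cvec:
  assumes "\<And>j. w j differentiable (at x)"
  shows "grad (cvec w) x = (\<chi> i. cvec (\<lambda>j. dir_deriv (axis i 1) (w j)) x)"
  by (simp add: grad_def dir_deriv_cvec[OF assms])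

text \<open>Vanishing of the gradient of \<open>a\<close> gives the field zero boundary values. It
  also bounds the second derivatives of the approximating stream functions, so that the gradients of
  the fields converge in L^2.\<close>

lemma perp_in_H1_0_sigma:
  fixes a :: "real^'n \<Rightarrow> real"
  assumes \<Omega>: "open \<Omega>" "bounded \<Omega>" and a: "Ck 2 a" "\<And>z. z \<in> frontier \<Omega> \<Longrightarrow> a z = 0"
    "\<And>z b. z \<in> frontier \<Omega> \<Longrightarrow> b \<in> Basis \<Longrightarrow> dir_deriv b a z = 0" and i: "i1 \<noteq> i2"
  shows "cvec (perp i1 i2 a) \<in> H1_0_sigma \<Omega>"
proof (rule vanishing_approximation[OF \<Omega> Ck_mono[OF a(1)] a(2)])
  fix \<xi> :: "nat \<Rightarrow> real^'n \<Rightarrow> real" and B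
  assume \<xi>: "\<And>m. \<xi> m \<in> test_functions \<Omega>"
    and B1: "\<And>m b x. b \<in> Basis \<Longrightarrow> x \<in> \<Omega> \<Longrightarrow> \<bar>dir_deriv b (\<xi> m) x\<bar> \<le> B"
    and l1: "\<And>b x. b \<in> Basis \<Longrightarrow> x \<in> \<Omega> \<Longrightarrow> (\<lambda>m. dir_deriv b (\<xi> m) x) \<longlonglongrightarrow> dir_deriv b a x"
    and 2: "Ck 2 a \<and> (\<forall>b\<in>Basis. \<forall>z\<in>frontier \<Omega>. dir_deriv b a z = 0) \<longrightarrow>
      (\<forall>m. \<forall>b\<in>Basis. \<forall>b'\<in>Basis. \<forall>x\<in>\<Omega>. \<bar>dir_deriv b' (dir_deriv b (\<xi> m)) x\<bar> \<le> B) \<and>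
      (\<forall>b\<in>Basis. \<forall>b'\<in>Basis. \<forall>x\<in>\<Omega>. (\<lambda>m. dir_deriv b' (dir_deriv b (\<xi> m)) x) \<longlonglongrightarrow> dir_deriv b' (dir_deriv b a) x)"
  have B2: "\<bar>dir_deriv b' (dir_deriv b (\<xi> m)) x\<bar> \<le> B"
    and l2: "(\<lambda>m. dir_deriv b' (dir_deriv b (\<xi> m)) x) \<longlonglongrightarrow> dir_deriv b' (dir_deriv b a) x"
    if "b \<in> Basis" "b' \<in> Basis" "x \<in> \<Omega>" for m b b' x
    using 2 a that by blast+
  let ?u = "cvec (perp i1 i2 a)" and ?v = "\<lambda>m. cvec (perp i1 i2 (\<xi> m))"
  have \<xi>2: "Ck 2 (\<xi> m)" for m by (rule test_functionsD(1)[OF \<xi>])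
  have P1: "Ck 1 (perp i1 i2 a j)" "Ck 1 (perp i1 i2 (\<xi> m) j)" for j m
    using a(1) \<xi>2[of m] Ck_perp[of 1 a i1 i2 j] Ck_perp[of 1 "\<xi> m" i1 i2 j] by (auto simp: numeral_2_eq_2)
  have u1: "Ck 1 ?u" "Ck 1 (?v m)" for m by (intro Ck_cvec P1)+
  have dP: "perp i1 i2 a j differentiable (at x)" "perp i1 i2 (\<xi> m) j differentiable (at x)" for j m x
    using P1 by auto
  have cu: "continuous_on UNIV ?u" "continuous_on UNIV (?v m)" for m by (rule Ck_continuous[OF u1(1)], rule Ck_continuous[OF u1(2)])
  have cg: "continuous_on UNIV (grad ?u)" "continuous_on UNIV (grad (?v m))" for m by (intro continuous_grad u1)+
  have L1: "(\<lambda>m. L2_norm \<Omega> (\<lambda>x. ?u x - ?v m x)) \<longlonglongrightarrow> 0"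
  proof (rule L2_norm_tendsto_0[OF \<Omega> cu])
    fix x assume x: "x \<in> \<Omega>"
    show "(\<lambda>m. ?v m x) \<longlonglongrightarrow> ?u x"
      using l1[OF _ x] by (intro tendsto_cvec) (auto simp: perp_def intro!: tendsto_minus)
    have "\<bar>perp i1 i2 (\<xi> m) j x\<bar> \<le> \<bar>B\<bar>" for m j
      using B1[OF _ x, of "axis i1 1" m] B1[OF _ x, of "axis i2 1" m] by (auto simp: perp_def)
    then show "norm (?v m x) \<le> CARD('n) * \<bar>B\<bar>" for m by (rule norm_cvec_le)
  qed
  have L2: "(\<lambda>m. L2_norm \<Omega> (\<lambda>x. grad ?u x - grad (?v m) x)) \<longlonglongrightarrow> 0"
  proof (rule L2_norm_tendsto_0[OF \<Omega> cg])
    fix x assume x: "x \<in> \<Omega>"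
    show "(\<lambda>m. grad (?v m) x) \<longlonglongrightarrow> grad ?u x"
    proof (rule vec_tendstoI)
      fix i
      have "(\<lambda>m. cvec (\<lambda>j. dir_deriv (axis i 1) (perp i1 i2 (\<xi> m) j)) x) \<longlonglongrightarrow> cvec (\<lambda>j. dir_deriv (axis i 1) (perp i1 i2 a j)) x"
        using l2[OF _ _ x] by (intro tendsto_cvec) (auto simp: dir_deriv_perp[OF a(1)] dir_deriv_perp[OF \<xi>2] intro!: tendsto_minus)
      then show "(\<lambda>m. grad (?v m) x $ i) \<longlonglongrightarrow> grad ?u x $ i"
        by (simp add: grad_cvec[OF dP(1)] grad_cvec[OF dP(2)])
    qed
    show "norm (grad (?v m) x) \<le> CARD('n) * (CARD('n) * \<bar>B\<bar>)" for m
    proof -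
      have b: "\<bar>dir_deriv (axis i 1) (perp i1 i2 (\<xi> m) j) x\<bar> \<le> \<bar>B\<bar>" for i j
        using B2[OF _ _ x, of "axis i1 1" "axis i 1" m] B2[OF _ _ x, of "axis i2 1" "axis i 1" m]
        by (auto simp: dir_deriv_perp[OF \<xi>2])
      have "norm (grad (?v m) x) \<le> (\<Sum>i\<in>UNIV. norm (grad (?v m) x $ i))" by (rule norm_vec_le_sum)
      also have "\<dots> \<le> (\<Sum>i\<in>(UNIV::'n set). CARD('n) * \<bar>B\<bar>)"
      proof (rule sum_mono)
        show "norm (grad (?v m) x $ i) \<le> CARD('n) * \<bar>B\<bar>" for i
          unfolding grad_cvec[OF dP(2)] vec_lambda_beta by (rule norm_cvec_le) (rule b)
      qed
      finally show ?thesis by simp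
    qed
  qed
  have H: "H1_norm \<Omega> (\<lambda>x. ?u x - ?v m x) = sqrt ((L2_norm \<Omega> (\<lambda>x. ?u x - ?v m x))\<^sup>2 + (L2_norm \<Omega> (\<lambda>x. grad ?u x - grad (?v m) x))\<^sup>2)" for m
    by (intro H1_norm_eq \<Omega> has_weak_grad_diff has_weak_grad_grad u1 continuous_L2 cu)
  have "(\<lambda>m. H1_norm \<Omega> (\<lambda>x. ?u x - ?v m x)) \<longlonglongrightarrow> sqrt (0\<^sup>2 + 0\<^sup>2)"
    unfolding H by (intro tendsto_intros L1 L2)
  then have lim: "(\<lambda>m. H1_norm \<Omega> (\<lambda>x. ?u x - ?v m x)) \<longlonglongrightarrow> 0" by simp
  have "\<exists>\<phi>\<in>solenoidal_test_functions \<Omega>. H1_norm \<Omega> (\<lambda>x. ?u x - \<phi> x) < e" if e: "e > 0" for e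
  proof -
    obtain m where "H1_norm \<Omega> (\<lambda>x. ?u x - ?v m x) < e"
      using order_tendstoD(2)[OF lim e] by (auto dest!: eventually_happens)
    then show ?thesis using perp_solenoidal[OF \<xi> i] by blast
  qed
  moreover have "?u \<in> H1 \<Omega>" unfolding H1_def
    using continuous_L2[OF \<Omega> cu(1)] has_weak_grad_grad[OF \<Omega> u1(1)] by blast
  ultimately show ?thesis by (auto simp: H1_0_sigma_def)
qed auto

lemma dir_deriv_nth: "dir_deriv b (\<lambda>x::real^'n. x $ i) x = b $ i"
  by (rule dir_deriv_linear[OF bounded_linear_vec_nth])

lemma Ck_nth: "Ck k (\<lambda>x::real^'n. x $ i)"
  by (rule Ck_linear[OF bounded_linear_vec_nth])

text \<open>If \<open>a\<close> vanishes to second order on the boundary, \<open>u = \<nabla>\<^sup>\<bottom>a\<close> solves the Stokes resolvent problem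
  with the linear pressure \<open>x\<^sub>1 - m\<close>, because \<open>\<nabla>x\<^sub>1 = \<nabla>\<^sup>\<bottom>x\<^sub>2\<close>.\<close>

lemma stream_function_solution:
  fixes a :: "real^'n \<Rightarrow> real"
  assumes \<Omega>: "open \<Omega>" "bounded \<Omega>" and i: "i1 \<noteq> i2"
    and a: "Ck 3 a" "bdd_supp a" "\<And>z. z \<in> frontier \<Omega> \<Longrightarrow> a z = 0"
      "\<And>z b. z \<in> frontier \<Omega> \<Longrightarrow> b \<in> Basis \<Longrightarrow> dir_deriv b a z = 0"
      "\<And>z. z \<in> frontier \<Omega> \<Longrightarrow> lap a z = z $ i2"
    and c: "\<And>x. c x = lam * a x - lap a x + x $ i2"
    and m: "(\<lambda>x. complex_of_real (x $ i1 - m)) \<in> L2_zero \<Omega>"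
  shows "cvec (perp i1 i2 c) \<in> L2_sigma \<Omega>"
    "associated_pressure \<Omega> (of_real lam) (cvec (perp i1 i2 c)) (\<lambda>x. complex_of_real (x $ i1 - m))"
proof -
  have c_eq: "c = (\<lambda>x. lam * a x - lap a x + x $ i2)" using c by auto
  have a': "Ck 2 a" "Ck 1 a" by (rule Ck_mono[OF a(1)], simp)+
  have lap1: "Ck 1 (lap a)" using a(1) by (intro Ck_lap) (simp add: eval_nat_numeral)
  have c1: "Ck 1 c" unfolding c_eq by (intro Ck_add Ck_diff Ck_cmult a' lap1 Ck_nth)
  have c0: "c z = 0" if "z \<in> frontier \<Omega>" for z using a(3,5)[OF that] by (simp add: c)
  show "cvec (perp i1 i2 c) \<in> L2_sigma \<Omega>" by (rule perp_in_L2_sigma[OF \<Omega> c1 c0 i])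
  define e where "e i = (axis i 1 :: real^'n)" for i
  have e: "e i \<in> Basis" for i by (simp add: e_def)
  have Da: "Ck 2 (dir_deriv (e i) a)" for i using a(1) e by (simp add: eval_nat_numeral)
  have DDa: "Ck 1 (dir_deriv (e i) (dir_deriv (e j) a))" for i j using Da[of j] e by (simp add: numeral_2_eq_2)
  have D2d: "dir_deriv (e i) (dir_deriv (e j) a) differentiable (at x)" for i j x using DDa by auto
  \<comment> \<open>Moves \<open>e k\<close> past both derivatives of the Laplacian. The first
    exchange applies symmetry to a derivative of \<open>a\<close>, which is where C^3 is used; the
    second applies it to \<open>a\<close>.\<close>
  have swap: "dir_deriv (e k) (dir_deriv (e i) (dir_deriv (e i) a)) = dir_deriv (e i) (dir_deriv (e i) (dir_deriv (e k) a))" for i k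
  proof -
    have "dir_deriv (e k) (dir_deriv (e i) (dir_deriv (e i) a)) = dir_deriv (e i) (dir_deriv (e k) (dir_deriv (e i) a))"
      by (intro dir_deriv_commute Da bdd_supp_dir_deriv a(2) e)
    also have "dir_deriv (e k) (dir_deriv (e i) a) = dir_deriv (e i) (dir_deriv (e k) a)"
      by (intro dir_deriv_commute a' a(2) e)
    finally show ?thesis .
  qed
  have Dlap: "dir_deriv (e k) (lap a) x = (\<Sum>i\<in>UNIV. dir_deriv (e i) (dir_deriv (e i) (dir_deriv (e k) a)) x)" for k x
  proof -
    have "lap a = (\<lambda>x. \<Sum>i\<in>UNIV. dir_deriv (e i) (dir_deriv (e i) a) x)" by (simp add: lap_def[abs_def] e_def)
    then have "dir_deriv (e k) (lap a) x = (\<Sum>i\<in>UNIV. dir_deriv (e k) (dir_deriv (e i) (dir_deriv (e i) a)) x)"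
      using D2d by (simp add: dir_deriv_sum)
    then show ?thesis by (simp add: swap)
  qed
  have da: "a differentiable (at x)" and dl: "lap a differentiable (at x)" and dn: "(\<lambda>x::real^'n. x $ i2) differentiable (at x)" for x
    using Ck_differentiable[OF a'(2)] Ck_differentiable[OF lap1] Ck_differentiable[OF Ck_nth[of 1 i2]] by auto
  have Dc: "dir_deriv (e k) c x = lam * dir_deriv (e k) a x - dir_deriv (e k) (lap a) x + e k $ i2" for k x
  proof -
    have d1: "(\<lambda>x. lam * a x) differentiable (at x)" using da by (auto intro!: derivative_intros)
    have d2: "(\<lambda>x. lam * a x - lap a x) differentiable (at x)" using d1 dl by (auto intro!: derivative_intros)
    show ?thesis unfolding c_eq
      by (simp only: dir_deriv_add[OF d2 dn] dir_deriv_diff[OF d1 dl] dir_deriv_cmult[OF da] dir_deriv_nth)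
  qed
  have DDperp: "dir_deriv (e k) (dir_deriv (e k) (perp i1 i2 a j)) x = (if j = i1 then dir_deriv (e k) (dir_deriv (e k) (dir_deriv (e i2) a)) x
      else if j = i2 then - dir_deriv (e k) (dir_deriv (e k) (dir_deriv (e i1) a)) x else 0)" for j k x
  proof -
    have "dir_deriv (e k) (perp i1 i2 a j) = (if j = i1 then dir_deriv (e k) (dir_deriv (e i2) a)
      else if j = i2 then (\<lambda>x. - dir_deriv (e k) (dir_deriv (e i1) a) x) else (\<lambda>x. 0))"
      by (rule ext) (simp add: dir_deriv_perp[OF a'(1)] e_def)
    then show ?thesis by (simp add: dir_deriv_uminus[OF D2d])
  qed
  have ax: "(axis j 1 :: real^'n) $ k = (if k = j then 1 else 0)" for j k by (simp add: axis_def)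
  have Dp: "dir_deriv (e j) (\<lambda>x. x $ i1 - m) x = e j $ i1" for j x
    using dir_deriv_diff[OF Ck_differentiable[OF Ck_nth[of 1 i1]] differentiable_const] by (simp add: dir_deriv_nth)
  have "stokes_resolvent_solution \<Omega> (of_real lam) (cvec (perp i1 i2 c)) (cvec (perp i1 i2 a)) (\<lambda>x. complex_of_real (x $ i1 - m))"
  proof (rule strong_solution_is_weak[OF \<Omega>])
    show "Ck 2 (perp i1 i2 a j)" for j using a(1) by (intro Ck_perp) (simp add: eval_nat_numeral)
    show "Ck 1 (\<lambda>x. x $ i1 - m)" by (intro Ck_diff Ck_nth Ck_const)
    show "continuous_on UNIV (perp i1 i2 c j)" for j using c1 by (intro Ck_continuous[of 0] Ck_perp) simp
    show "cvec (perp i1 i2 a) \<in> H1_0_sigma \<Omega>" by (rule perp_in_H1_0_sigma[OF \<Omega> a'(1) a(3,4) i])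
    \<comment> \<open>In component \<open>i1\<close> the derivative of the summand
      \<open>x $ i2\<close> of \<open>c\<close> is 1, which equals the pressure gradient; in every
      other component both contributions are 0.\<close>
    show "perp i1 i2 c j x = lam * perp i1 i2 a j x - (\<Sum>k\<in>UNIV. dir_deriv (axis k 1) (dir_deriv (axis k 1) (perp i1 i2 a j)) x)
        + dir_deriv (axis j 1) (\<lambda>x. x $ i1 - m) x" for j x
      using i unfolding DDperp[unfolded e_def] Dp[unfolded e_def]
      by (auto simp: perp_def Dc[unfolded e_def] Dlap[unfolded e_def] ax sum_negf)
  qed (rule m)
  then show "associated_pressure \<Omega> (of_real lam) (cvec (perp i1 i2 c)) (\<lambda>x. complex_of_real (x $ i1 - m))"
    unfolding associated_pressure_def by blast
qed

section \<open>Boundary layers\<close>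

text \<open>The derivative of \<open>arctan\<close>. It dominates the derivatives of
  \<open>profile\<close>, and its primitive is bounded.\<close>

definition lorentz :: "real \<Rightarrow> real" where "lorentz t = 1 / (1 + t\<^sup>2)"
text \<open>What matters: value and slope 0 and second derivative 1 at 0, boundedness, and
  derivatives dominated by \<open>lorentz\<close>. Being even and rational, it is smooth across the
  boundary \<open>s = 0\<close>, and smoothness of the layers reduces to reciprocals. The numbered
  functions are its successive derivatives.\<close>

definition profile :: "real \<Rightarrow> real" where "profile t = t\<^sup>2 / (2 * (1 + t\<^sup>2))"
definition profile1 :: "real \<Rightarrow> real" where "profile1 t = t / (1 + t\<^sup>2)^2"
definition profile2 :: "real \<Rightarrow> real" where "profile2 t = (1 - 3 * t\<^sup>2) / (1 + t\<^sup>2)^3"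
definition profile3 :: "real \<Rightarrow> real" where "profile3 t = 12 * t * (t\<^sup>2 - 1) / (1 + t\<^sup>2)^4"

lemma one_plus_square_pos: "1 + (t::real)\<^sup>2 > 0" by (simp add: add_pos_nonneg)

lemma one_plus_square_nonzero [simp]: "1 + (t::real)\<^sup>2 \<noteq> 0"
  using one_plus_square_pos[of t] by linarith

lemma lorentz_range: "0 < lorentz t" "lorentz t \<le> 1"
  by (auto simp: lorentz_def one_plus_square_pos divide_simps)

lemma profile_deriv:
  "(profile has_real_derivative profile1 t) (at t)"
  "(profile1 has_real_derivative profile2 t) (at t)"
  "(profile2 has_real_derivative profile3 t) (at t)"
proof -
  have s: "((\<lambda>t. 1 + t\<^sup>2) has_real_derivative 2 * t) (at t)" by (auto intro!: derivative_eq_intros)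
  define d where "d = 1 + t\<^sup>2"
  have d: "d \<noteq> 0" "t\<^sup>2 = d - 1" by (auto simp: d_def)
  have "((\<lambda>t. t\<^sup>2 / (2 * (1 + t\<^sup>2))) has_real_derivative (2 * t * (2 * d) - t\<^sup>2 * (2 * (2 * t))) / (2 * d * (2 * d))) (at t)"
    unfolding d_def by (rule DERIV_divide) (use one_plus_square_pos[of t] in \<open>auto intro!: derivative_eq_intros\<close>)
  moreover have "(2 * t * (2 * d) - t\<^sup>2 * (2 * (2 * t))) / (2 * d * (2 * d)) = t / d^2"
    using d(1) unfolding d(2) by (simp add: field_simps power2_eq_square)
  ultimately show "(profile has_real_derivative profile1 t) (at t)"
    unfolding profile_def[abs_def] profile1_def d_def by simp
  have "((\<lambda>t. t / (1 + t\<^sup>2)^2) has_real_derivative (1 * d^2 - t * (2 * d * (2 * t))) / (d^2 * d^2)) (at t)"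
    unfolding d_def by (rule DERIV_divide) (auto intro!: derivative_eq_intros)
  moreover have "(1 * d^2 - t * (2 * d * (2 * t))) / (d^2 * d^2) = (1 - 3 * t\<^sup>2) / d^3"
  proof -
    have "1 * d^2 - t * (2 * d * (2 * t)) = d * (1 - 3 * t\<^sup>2)"
      by (simp add: d_def algebra_simps power2_eq_square)
    then show ?thesis using d(1) by (simp add: power2_eq_square power3_eq_cube)
  qed
  ultimately show "(profile1 has_real_derivative profile2 t) (at t)"
    unfolding profile1_def[abs_def] profile2_def d_def by simp
  have "((\<lambda>t. (1 - 3 * t\<^sup>2) / (1 + t\<^sup>2)^3) has_real_derivative ((- 6 * t) * d^3 - (1 - 3 * t\<^sup>2) * (3 * d^2 * (2 * t))) / (d^3 * d^3)) (at t)"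
    unfolding d_def by (rule DERIV_divide) (auto intro!: derivative_eq_intros)
  moreover have "((- 6 * t) * d^3 - (1 - 3 * t\<^sup>2) * (3 * d^2 * (2 * t))) / (d^3 * d^3) = 12 * t * (t\<^sup>2 - 1) / d^4"
  proof -
    have "(- 6 * t) * d^3 - (1 - 3 * t\<^sup>2) * (3 * d^2 * (2 * t)) = d^2 * (12 * t * (t\<^sup>2 - 1))"
      by (simp add: d_def algebra_simps eval_nat_numeral)
    then show ?thesis using d(1) by (simp add: eval_nat_numeral)
  qed
  ultimately show "(profile2 has_real_derivative profile3 t) (at t)"
    unfolding profile2_def[abs_def] profile3_def d_def by simp
qed

text \<open>Both |t| and t^2 are at most 1 + t^2, so numerators are absorbed by the denominators.
  The constant is the factor 12 of \<open>profile3\<close>, used for all four bounds.\<close>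

lemma profile_bounds:
  "\<bar>profile t\<bar> \<le> 12" "\<bar>profile1 t\<bar> \<le> 12 * lorentz t" "\<bar>profile2 t\<bar> \<le> 12 * lorentz t" "\<bar>profile3 t\<bar> \<le> 12 * lorentz t"
proof -
  define d where "d = 1 + t\<^sup>2"
  have d: "d \<ge> 1" "d > 0" "t\<^sup>2 = d - 1" "\<bar>d\<bar> = d" using one_plus_square_pos[of t] by (auto simp: d_def)
  have t: "\<bar>t\<bar> \<le> d"
  proof (cases "\<bar>t\<bar> \<le> 1")
    case False
    then have "\<bar>t\<bar> * 1 \<le> \<bar>t\<bar> * \<bar>t\<bar>" by (intro mult_left_mono) auto
    then show ?thesis by (simp add: d_def power2_eq_square)
  qed (use d in simp)
  have l: "lorentz t = 1 / d" by (simp add: lorentz_def d_def)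
  have p: "d \<le> d^2" "d \<le> d^3" using d power_increasing[of 1 2 d] power_increasing[of 1 3 d] by auto
  show "\<bar>profile t\<bar> \<le> 12" unfolding profile_def using d by (simp add: d_def[symmetric] divide_simps)
  have "\<bar>profile1 t\<bar> = \<bar>t\<bar> / d^2" by (simp add: profile1_def abs_divide d_def[symmetric])
  also have "\<dots> \<le> d / d^2" using t d by (intro divide_right_mono) auto
  also have "\<dots> = lorentz t" using d by (simp add: l power2_eq_square)
  also have "\<dots> \<le> 12 * lorentz t" using lorentz_range[of t] by simp
  finally show "\<bar>profile1 t\<bar> \<le> 12 * lorentz t" .
  have "\<bar>profile2 t\<bar> = \<bar>1 - 3 * t\<^sup>2\<bar> / d^3" using d by (simp add: profile2_def abs_divide d_def[symmetric])
  also have "\<dots> \<le> (3 * d^2) / d^3" using d p by (intro divide_right_mono) auto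
  also have "\<dots> = 3 * lorentz t" using d by (simp add: l power2_eq_square power3_eq_cube)
  also have "\<dots> \<le> 12 * lorentz t" using lorentz_range[of t] by simp
  finally show "\<bar>profile2 t\<bar> \<le> 12 * lorentz t" .
  have "\<bar>profile3 t\<bar> = 12 * (\<bar>t\<bar> * \<bar>t\<^sup>2 - 1\<bar>) / d^4" using d by (simp add: profile3_def abs_divide abs_mult d_def[symmetric])
  also have "\<dots> \<le> 12 * (d * d) / d^4"
    using t d by (intro divide_right_mono mult_left_mono mult_mono) auto
  also have "\<dots> \<le> 12 * (d * d^2) / d^4" using t d p by (intro divide_right_mono mult_left_mono mult_mono) auto
  also have "\<dots> = 12 * lorentz t" using d by (simp add: l eval_nat_numeral)
  finally show "\<bar>profile3 t\<bar> \<le> 12 * lorentz t" .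
qed

lemma profile_bounds': "\<bar>profile1 t\<bar> \<le> 12" "\<bar>profile2 t\<bar> \<le> 12"
  using profile_bounds[of t] lorentz_range[of t] by linarith+

section \<open>Derivatives and size of a single layer\<close>

lemma dir_deriv_layer:
  fixes v s :: "'a::euclidean_space \<Rightarrow> real"
  assumes "v differentiable (at x)" "s differentiable (at x)" "\<And>t. (h has_real_derivative h' t) (at t)"
  shows "dir_deriv b (\<lambda>x. v x * h (s x / e)) x = dir_deriv b v x * h (s x / e) + (1/e) * (v x * dir_deriv b s x * h' (s x / e))"
    and "(\<lambda>x. v x * h (s x / e)) differentiable (at x)"
proof -
  have s: "(\<lambda>x. s x / e) differentiable (at x)" using assms(2) by (simp add: divide_inverse)
  have sd: "dir_deriv b (\<lambda>x. s x / e) x = (1/e) * dir_deriv b s x"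
    using dir_deriv_cmult[OF assms(2), of b "1/e"] by simp
  have h: "(\<lambda>x. h (s x / e)) differentiable (at x)" by (rule differentiable_chain_real[OF assms(3) s])
  show "dir_deriv b (\<lambda>x. v x * h (s x / e)) x = dir_deriv b v x * h (s x / e) + (1/e) * (v x * dir_deriv b s x * h' (s x / e))"
    unfolding dir_deriv_mult[OF assms(1) h] dir_deriv_chain_real[OF assms(3) s] sd by simp
  show "(\<lambda>x. v x * h (s x / e)) differentiable (at x)" using assms(1) h by simp
qed

text \<open>A derivative either hits \<open>v\<close>, giving a bounded term, or the scaled
  argument, giving \<open>1/e\<close> times a term concentrated where \<open>s\<close> is of order
  \<open>e\<close>. Since \<open>M\<close> is fixed before \<open>h\<close>, the same lemma treats
  \<open>profile\<close>, \<open>profile1\<close> and \<open>profile2\<close>.\<close>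

lemma layer_dir_deriv_bound:
  fixes v s :: "'a::euclidean_space \<Rightarrow> real"
  assumes v: "Ck 1 v" and s: "Ck 1 s" and \<Omega>: "bounded \<Omega>"
  obtains M where "M \<ge> 0"
    "\<And>h h' b e x. (\<And>t. (h has_real_derivative h' t) (at t)) \<Longrightarrow> (\<And>t. \<bar>h t\<bar> \<le> 12) \<Longrightarrow> (\<And>t. \<bar>h' t\<bar> \<le> 12 * lorentz t) \<Longrightarrow>
       e > 0 \<Longrightarrow> b \<in> Basis \<Longrightarrow> x \<in> \<Omega> \<Longrightarrow>
       \<bar>dir_deriv b (\<lambda>x. v x * h (s x / e)) x\<bar> \<le> M * (1 + lorentz (s x / e) / e)"
proof -
  obtain M1 where M1: "M1 \<ge> 0" "\<And>b x. b \<in> Basis \<Longrightarrow> x \<in> \<Omega> \<Longrightarrow> \<bar>dir_deriv b v x\<bar> \<le> M1"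
    using C1_bound[OF v \<Omega>] by blast
  obtain M2 where M2: "M2 \<ge> 0" "\<And>b x. b \<in> Basis \<Longrightarrow> x \<in> \<Omega> \<Longrightarrow> \<bar>dir_deriv b s x\<bar> \<le> M2"
    using C1_bound[OF s \<Omega>] by blast
  obtain M3 where M3: "M3 > 0" "\<And>x. x \<in> \<Omega> \<Longrightarrow> norm (v x) \<le> M3"
    using continuous_bounded_on[OF Ck_continuous[OF v] \<Omega>] by blast
  define M where "M = 12 * (M1 + M3 * M2)"
  show ?thesis
  proof
    show "M \<ge> 0" using M1 M2 M3 by (simp add: M_def)
    fix h h' :: "real \<Rightarrow> real" and e :: real and b x :: 'a
    assume h: "\<And>t. (h has_real_derivative h' t) (at t)" "\<And>t. \<bar>h t\<bar> \<le> 12" "\<And>t. \<bar>h' t\<bar> \<le> 12 * lorentz t"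
      and e: "e > 0" and b: "b \<in> Basis" and x: "x \<in> \<Omega>"
    have d: "v differentiable (at x)" "s differentiable (at x)" using v s by auto
    have 1: "\<bar>dir_deriv b v x * h (s x / e)\<bar> \<le> M1 * 12"
      unfolding abs_mult using M1 h(2) b x by (intro mult_mono) auto
    have 2: "\<bar>v x * dir_deriv b s x * h' (s x / e)\<bar> \<le> M3 * M2 * (12 * lorentz (s x / e))"
      unfolding abs_mult using M2 M3 h(3) b x by (intro mult_mono) auto
    have "\<bar>(1/e) * (v x * dir_deriv b s x * h' (s x / e))\<bar> \<le> (1/e) * (M3 * M2 * (12 * lorentz (s x / e)))"
      using 2 e by (subst abs_mult) (auto intro!: mult_left_mono divide_right_mono)
    then have "\<bar>dir_deriv b (\<lambda>x. v x * h (s x / e)) x\<bar> \<le> M1 * 12 + (1/e) * (M3 * M2 * (12 * lorentz (s x / e)))"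
      unfolding dir_deriv_layer(1)[OF d h(1)] using 1 by linarith
    also have "\<dots> \<le> M + M * (lorentz (s x / e) / e)"
    proof (rule add_mono)
      show "M1 * 12 \<le> M" using M1 M2 M3 by (simp add: M_def)
      have "12 * (M3 * M2) * (lorentz (s x / e) / e) \<le> M * (lorentz (s x / e) / e)"
        using M1 M2 M3 e lorentz_range[of "s x / e"] by (intro mult_right_mono) (auto simp: M_def)
      then show "(1/e) * (M3 * M2 * (12 * lorentz (s x / e))) \<le> M * (lorentz (s x / e) / e)" by (simp add: mult_ac)
    qed
    finally show "\<bar>dir_deriv b (\<lambda>x. v x * h (s x / e)) x\<bar> \<le> M * (1 + lorentz (s x / e) / e)"
      by (simp add: distrib_left)
  qed
qed

text \<open>The factor \<open>e\<^sup>2\<close> compensates the two factors \<open>1/e\<close> of a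
  second derivative: the Laplacian stays bounded, and so does
  \<open>(1/e\<^sup>2) * layer w s e x\<close>, the term multiplied by \<lambda>.\<close>

definition layer :: "(real^'n \<Rightarrow> real) \<Rightarrow> (real^'n \<Rightarrow> real) \<Rightarrow> real \<Rightarrow> real^'n \<Rightarrow> real" where
  "layer w s e x = e\<^sup>2 * (w x * profile (s x / e))"

lemma Ck_layer:
  assumes "Ck k w" "Ck k s" shows "Ck k (layer w s e)"
proof -
  \<comment> \<open>Partial fractions: only one reciprocal of a nowhere vanishing function
    remains.\<close>
  have "profile t = 1/2 - 1/2 * inverse (1 + t * t)" for t
    using one_plus_square_nonzero[of t] by (simp add: profile_def divide_simps power2_eq_square)
  then have eq: "layer w s e = (\<lambda>x. e\<^sup>2 * (w x * (1/2 - 1/2 * inverse (1 + (1/e * s x) * (1/e * s x)))))"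
    by (simp add: layer_def fun_eq_iff)
  have "1 + (1/e * s x) * (1/e * s x) \<noteq> 0" for x
    using one_plus_square_nonzero[of "1/e * s x"] by (simp add: power2_eq_square)
  then show ?thesis unfolding eq by (intro Ck_cmult Ck_mult Ck_diff Ck_const Ck_inverse Ck_add assms)
qed

text \<open>Sorted by powers of \<open>e\<close>. At points with \<open>s x = 0\<close> only the
  \<open>profile2\<close> term of the Laplacian survives, and \<open>profile2 0 = 1\<close>.\<close>

lemma layer_derivatives:
  fixes w s :: "real^'n \<Rightarrow> real"
  assumes w: "Ck 2 w" and s: "Ck 2 s" and e: "e \<noteq> 0"
  shows "b \<in> Basis \<Longrightarrow> dir_deriv b (layer w s e) x = e\<^sup>2 * (dir_deriv b w x * profile (s x / e)) + e * (w x * dir_deriv b s x * profile1 (s x / e))"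
    and "lap (layer w s e) x = e\<^sup>2 * (lap w x * profile (s x / e))
      + e * ((\<Sum>i\<in>UNIV. 2 * (dir_deriv (axis i 1) w x * dir_deriv (axis i 1) s x) + w x * dir_deriv (axis i 1) (dir_deriv (axis i 1) s) x) * profile1 (s x / e))
      + (w x * (\<Sum>i\<in>UNIV. (dir_deriv (axis i 1) s x)\<^sup>2)) * profile2 (s x / e)"
proof -
  have dw: "w differentiable (at x)" and ds: "s differentiable (at x)" for x using w s by (auto simp: numeral_2_eq_2)
  have D: "dir_deriv b (layer w s e) x = e\<^sup>2 * (dir_deriv b w x * profile (s x / e)) + e * (w x * dir_deriv b s x * profile1 (s x / e))" for b x
    unfolding layer_def[abs_def] dir_deriv_cmult[OF dir_deriv_layer(2)[OF dw ds profile_deriv(1)]]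
      dir_deriv_layer(1)[OF dw ds profile_deriv(1)] using e by (simp add: algebra_simps power2_eq_square)
  then show "dir_deriv b (layer w s e) x = e\<^sup>2 * (dir_deriv b w x * profile (s x / e)) + e * (w x * dir_deriv b s x * profile1 (s x / e))" .
  have DD: "dir_deriv b (dir_deriv b (layer w s e)) x = e\<^sup>2 * (dir_deriv b (dir_deriv b w) x * profile (s x / e))
      + e * ((2 * (dir_deriv b w x * dir_deriv b s x) + w x * dir_deriv b (dir_deriv b s) x) * profile1 (s x / e))
      + (w x * (dir_deriv b s x)\<^sup>2) * profile2 (s x / e)" if b: "b \<in> Basis" for b
  proof -
    have dDw: "dir_deriv b w differentiable (at x)" and dDs: "dir_deriv b s differentiable (at x)" for x
      using w s b by (auto simp: numeral_2_eq_2)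
    have dws: "(\<lambda>x. w x * dir_deriv b s x) differentiable (at x)" for x using dw dDs by simp
    have eq: "dir_deriv b (layer w s e) = (\<lambda>x. e\<^sup>2 * (dir_deriv b w x * profile (s x / e)) + e * ((w x * dir_deriv b s x) * profile1 (s x / e)))"
      using D by auto
    have d1: "(\<lambda>x. e\<^sup>2 * (dir_deriv b w x * profile (s x / e))) differentiable (at x)"
      "(\<lambda>x. e * ((w x * dir_deriv b s x) * profile1 (s x / e))) differentiable (at x)"
      using dir_deriv_layer(2)[OF dDw ds profile_deriv(1)] dir_deriv_layer(2)[OF dws ds profile_deriv(2)]
      by (auto intro!: derivative_intros)
    show ?thesis unfolding eq dir_deriv_add[OF d1]
        dir_deriv_cmult[OF dir_deriv_layer(2)[OF dDw ds profile_deriv(1)]] dir_deriv_cmult[OF dir_deriv_layer(2)[OF dws ds profile_deriv(2)]]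
        dir_deriv_layer(1)[OF dDw ds profile_deriv(1)] dir_deriv_layer(1)[OF dws ds profile_deriv(2)]
        dir_deriv_mult[OF dw dDs]
      using e by (simp add: algebra_simps power2_eq_square)
  qed
  show "lap (layer w s e) x = e\<^sup>2 * (lap w x * profile (s x / e))
      + e * ((\<Sum>i\<in>UNIV. 2 * (dir_deriv (axis i 1) w x * dir_deriv (axis i 1) s x) + w x * dir_deriv (axis i 1) (dir_deriv (axis i 1) s) x) * profile1 (s x / e))
      + (w x * (\<Sum>i\<in>UNIV. (dir_deriv (axis i 1) s x)\<^sup>2)) * profile2 (s x / e)"
  proof -
    have "(\<Sum>i\<in>UNIV. e\<^sup>2 * (A i * p) + e * (B i * q) + (y * Z i) * r) =
        e\<^sup>2 * ((\<Sum>i\<in>UNIV. A i) * p) + e * ((\<Sum>i\<in>UNIV. B i) * q) + (y * (\<Sum>i\<in>UNIV. Z i)) * r"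
      for A B Z :: "'n \<Rightarrow> real" and p q r y
      by (simp add: sum.distrib sum_distrib_left sum_distrib_right)
    then show ?thesis by (simp only: lap_def DD axis_in_Basis_iff Basis_real_def insertI1)
  qed
qed

lemma layer_at_zero:
  fixes w s :: "real^'n \<Rightarrow> real"
  assumes w: "Ck 2 w" and s: "Ck 2 s" and e: "e \<noteq> 0" and z: "s z = 0"
  shows "layer w s e z = 0" "b \<in> Basis \<Longrightarrow> dir_deriv b (layer w s e) z = 0"
    "lap (layer w s e) z = w z * (\<Sum>i\<in>UNIV. (dir_deriv (axis i 1) s z)\<^sup>2)"
  using z layer_derivatives[OF w s e] by (auto simp: layer_def profile_def profile1_def profile2_def)

lemma layer_off_support:
  fixes w s :: "real^'n \<Rightarrow> real"
  assumes S: "open S" "z \<in> S" "\<And>x. x \<in> S \<Longrightarrow> w x = 0"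
  shows "layer w s e z = 0" "dir_deriv b (layer w s e) z = 0" "lap (layer w s e) z = 0"
proof -
  have 0: "layer w s e x = 0" if "x \<in> S" for x using S(3)[OF that] by (simp add: layer_def)
  have 1: "dir_deriv b (layer w s e) x = 0" if "x \<in> S" for x b
  proof -
    have "dir_deriv b (layer w s e) x = dir_deriv b (\<lambda>x. 0) x"
      by (rule dir_deriv_cong_open[OF S(1) that 0])
    then show ?thesis by simp
  qed
  have 2: "dir_deriv b (dir_deriv b (layer w s e)) z = 0" for b
  proof -
    have "dir_deriv b (dir_deriv b (layer w s e)) z = dir_deriv b (\<lambda>x. 0) z"
      by (rule dir_deriv_cong_open[OF S(1,2) 1])
    then show ?thesis by simp
  qed
  show "layer w s e z = 0" "dir_deriv b (layer w s e) z = 0" "lap (layer w s e) z = 0"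
    using 0 1 2 S(2) by (auto simp: lap_def)
qed

text \<open>With \<lambda> = 1/e^2 this is the gradient of \<lambda>a - \<Delta>a for one layer. The
  function is a sum of four C^1 coefficients times profiles with nonnegative powers of
  \<open>e\<close> in front, and \<open>layer_dir_deriv_bound\<close> applies to each
  summand.\<close>

lemma layer_bound:
  fixes w s :: "real^'n \<Rightarrow> real"
  assumes w: "Ck 3 w" and s: "Ck 4 s" and \<Omega>: "bounded \<Omega>"
  obtains M where "M \<ge> 0"
    "\<And>e b x. 0 < e \<Longrightarrow> e \<le> 1 \<Longrightarrow> b \<in> Basis \<Longrightarrow> x \<in> \<Omega> \<Longrightarrow>
      \<bar>dir_deriv b (\<lambda>x. (1/e\<^sup>2) * layer w s e x - lap (layer w s e) x) x\<bar> \<le> M * (1 + lorentz (s x / e) / e)"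
proof -
  define W1 where "W1 x = (\<Sum>i\<in>UNIV. 2 * (dir_deriv (axis i 1) w x * dir_deriv (axis i 1) s x) + w x * dir_deriv (axis i 1) (dir_deriv (axis i 1) s) x)" for x
  define W2 where "W2 x = w x * (\<Sum>i\<in>UNIV. (dir_deriv (axis i 1) s x)\<^sup>2)" for x
  have w2: "Ck 2 w" "Ck 2 s" "Ck 1 w" "Ck 1 s" by (rule Ck_mono[OF w] Ck_mono[OF s], simp)+
  have D1: "Ck 1 (dir_deriv (axis i 1) w)" "Ck 1 (dir_deriv (axis i 1) s)" for i
    using w2 by (auto simp: numeral_2_eq_2)
  have s3: "Ck (Suc (Suc 1)) s" by (rule Ck_mono[OF s]) simp
  have D2: "Ck 1 (dir_deriv (axis i 1) (dir_deriv (axis i 1) s))" for i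
    using s3 by simp
  have W0C: "Ck 1 (lap w)" using w by (intro Ck_lap) (simp add: eval_nat_numeral)
  have W1C: "Ck 1 W1" unfolding W1_def[abs_def] by (intro Ck_sum Ck_add Ck_cmult Ck_mult w2 D1 D2)
  have W2C: "Ck 1 W2" unfolding W2_def[abs_def] power2_eq_square by (intro Ck_mult Ck_sum w2 D1)
  obtain M0 where M0: "M0 \<ge> 0" "\<And>h h' b e x. (\<And>t. (h has_real_derivative h' t) (at t)) \<Longrightarrow> (\<And>t. \<bar>h t\<bar> \<le> 12) \<Longrightarrow> (\<And>t. \<bar>h' t\<bar> \<le> 12 * lorentz t) \<Longrightarrow>
       e > 0 \<Longrightarrow> b \<in> Basis \<Longrightarrow> x \<in> \<Omega> \<Longrightarrow> \<bar>dir_deriv b (\<lambda>x. w x * h (s x / e)) x\<bar> \<le> M0 * (1 + lorentz (s x / e) / e)"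
    by (rule layer_dir_deriv_bound[OF w2(3,4) \<Omega>]; rule that; blast)
  obtain M1 where M1: "M1 \<ge> 0" "\<And>h h' b e x. (\<And>t. (h has_real_derivative h' t) (at t)) \<Longrightarrow> (\<And>t. \<bar>h t\<bar> \<le> 12) \<Longrightarrow> (\<And>t. \<bar>h' t\<bar> \<le> 12 * lorentz t) \<Longrightarrow>
       e > 0 \<Longrightarrow> b \<in> Basis \<Longrightarrow> x \<in> \<Omega> \<Longrightarrow> \<bar>dir_deriv b (\<lambda>x. lap w x * h (s x / e)) x\<bar> \<le> M1 * (1 + lorentz (s x / e) / e)"
    by (rule layer_dir_deriv_bound[OF W0C w2(4) \<Omega>]; rule that; blast)
  obtain M2 where M2: "M2 \<ge> 0" "\<And>h h' b e x. (\<And>t. (h has_real_derivative h' t) (at t)) \<Longrightarrow> (\<And>t. \<bar>h t\<bar> \<le> 12) \<Longrightarrow> (\<And>t. \<bar>h' t\<bar> \<le> 12 * lorentz t) \<Longrightarrow>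
       e > 0 \<Longrightarrow> b \<in> Basis \<Longrightarrow> x \<in> \<Omega> \<Longrightarrow> \<bar>dir_deriv b (\<lambda>x. W1 x * h (s x / e)) x\<bar> \<le> M2 * (1 + lorentz (s x / e) / e)"
    by (rule layer_dir_deriv_bound[OF W1C w2(4) \<Omega>]; rule that; blast)
  obtain M3 where M3: "M3 \<ge> 0" "\<And>h h' b e x. (\<And>t. (h has_real_derivative h' t) (at t)) \<Longrightarrow> (\<And>t. \<bar>h t\<bar> \<le> 12) \<Longrightarrow> (\<And>t. \<bar>h' t\<bar> \<le> 12 * lorentz t) \<Longrightarrow>
       e > 0 \<Longrightarrow> b \<in> Basis \<Longrightarrow> x \<in> \<Omega> \<Longrightarrow> \<bar>dir_deriv b (\<lambda>x. W2 x * h (s x / e)) x\<bar> \<le> M3 * (1 + lorentz (s x / e) / e)"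
    by (rule layer_dir_deriv_bound[OF W2C w2(4) \<Omega>]; rule that; blast)
  show ?thesis
  proof
    show "M0 + M1 + M2 + M3 \<ge> 0" using M0 M1 M2 M3 by simp
    fix e :: real and b x :: "real^'n" assume e: "0 < e" "e \<le> 1" and b: "b \<in> Basis" and x: "x \<in> \<Omega>"
    let ?Q = "1 + lorentz (s x / e) / e"
    have Q: "?Q \<ge> 0" using e lorentz_range[of "s x / e"] by simp
    have eq: "(\<lambda>x. (1/e\<^sup>2) * layer w s e x - lap (layer w s e) x) =
      (\<lambda>x. w x * profile (s x / e) - (e\<^sup>2 * (lap w x * profile (s x / e)) + e * (W1 x * profile1 (s x / e)) + W2 x * profile2 (s x / e)))"
      using e by (simp add: layer_derivatives(2)[OF w2(1,2)] layer_def W1_def W2_def)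
    have ds: "s differentiable (at x)" using w2 by auto
    have d: "w differentiable (at x)" "lap w differentiable (at x)" "W1 differentiable (at x)" "W2 differentiable (at x)"
      using w2 W0C W1C W2C by auto
    note l0 = dir_deriv_layer(2)[OF d(1) ds profile_deriv(1), of e]
      and l1 = dir_deriv_layer(2)[OF d(2) ds profile_deriv(1), of e]
      and l2 = dir_deriv_layer(2)[OF d(3) ds profile_deriv(2), of e]
      and l3 = dir_deriv_layer(2)[OF d(4) ds profile_deriv(3), of e]
    have c1: "(\<lambda>x. e\<^sup>2 * (lap w x * profile (s x / e))) differentiable (at x)" using l1 by (auto intro!: derivative_intros)
    have c2: "(\<lambda>x. e * (W1 x * profile1 (s x / e))) differentiable (at x)" using l2 by (auto intro!: derivative_intros)
    have c3: "(\<lambda>x. e\<^sup>2 * (lap w x * profile (s x / e)) + e * (W1 x * profile1 (s x / e))) differentiable (at x)"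
      using c1 c2 by (rule differentiable_add)
    have c4: "(\<lambda>x. e\<^sup>2 * (lap w x * profile (s x / e)) + e * (W1 x * profile1 (s x / e)) + W2 x * profile2 (s x / e)) differentiable (at x)"
      using c3 l3 by (rule differentiable_add)
    have D: "dir_deriv b (\<lambda>x. (1/e\<^sup>2) * layer w s e x - lap (layer w s e) x) x =
        dir_deriv b (\<lambda>x. w x * profile (s x / e)) x - (e\<^sup>2 * dir_deriv b (\<lambda>x. lap w x * profile (s x / e)) x
        + e * dir_deriv b (\<lambda>x. W1 x * profile1 (s x / e)) x + dir_deriv b (\<lambda>x. W2 x * profile2 (s x / e)) x)"
      unfolding eq by (simp only: dir_deriv_diff[OF l0 c4] dir_deriv_add[OF c3 l3] dir_deriv_add[OF c1 c2] dir_deriv_cmult[OF l1] dir_deriv_cmult[OF l2])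
    have sc: "\<bar>k * y\<bar> \<le> M * ?Q" if "\<bar>y\<bar> \<le> M * ?Q" "0 \<le> k" "k \<le> 1" "0 \<le> M" for k y M :: real
    proof -
      have "\<bar>k * y\<bar> \<le> 1 * \<bar>y\<bar>" unfolding abs_mult using that by (intro mult_right_mono) auto
      then show ?thesis using that by simp
    qed
    have b0: "\<bar>dir_deriv b (\<lambda>x. w x * profile (s x / e)) x\<bar> \<le> M0 * ?Q"
      by (rule M0(2)[OF profile_deriv(1) profile_bounds(1,2) e(1) b x])
    have b1: "\<bar>e\<^sup>2 * dir_deriv b (\<lambda>x. lap w x * profile (s x / e)) x\<bar> \<le> M1 * ?Q"
      by (rule sc[OF M1(2)[OF profile_deriv(1) profile_bounds(1,2) e(1) b x]]) (use e M1 in \<open>auto simp: power_le_one\<close>)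
    have b2: "\<bar>e * dir_deriv b (\<lambda>x. W1 x * profile1 (s x / e)) x\<bar> \<le> M2 * ?Q"
      by (rule sc[OF M2(2)[OF profile_deriv(2) profile_bounds'(1) profile_bounds(3) e(1) b x]]) (use e M2 in auto)
    have b3: "\<bar>dir_deriv b (\<lambda>x. W2 x * profile2 (s x / e)) x\<bar> \<le> M3 * ?Q"
      by (rule M3(2)[OF profile_deriv(3) profile_bounds'(2) profile_bounds(4) e(1) b x])
    have "(M0 + M1 + M2 + M3) * ?Q = M0 * ?Q + M1 * ?Q + M2 * ?Q + M3 * ?Q" by (simp only: distrib_right)
    then show "\<bar>dir_deriv b (\<lambda>x. (1/e\<^sup>2) * layer w s e x - lap (layer w s e) x) x\<bar> \<le> (M0 + M1 + M2 + M3) * ?Q"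
      unfolding D using b0 b1 b2 b3 by linarith
  qed
qed

text \<open>Since \<open>\<partial>\<^sub>\<nu>s = 1\<close>, the integrand is \<open>e \<partial>\<^sub>\<nu>(arctan (s / e))\<close>; integrating by parts against a cutoff gains the factor \<open>e\<close>.\<close>

lemma layer_integral:
  fixes s :: "'a::euclidean_space \<Rightarrow> real"
  assumes \<Omega>: "open \<Omega>" "bounded \<Omega>" and s: "Ck 1 s" and \<nu>: "\<And>x. dir_deriv \<nu> s x = 1"
  obtains C where "C \<ge> 0" "\<And>e. e > 0 \<Longrightarrow> integral\<^sup>L (lebesgue_on \<Omega>) (\<lambda>x. lorentz (s x / e)) \<le> C * e"
proof -
  \<comment> \<open>Equal to 1 on the domain and of bounded support: the integral over the domain is
    at most that of \<open>\<zeta> x * lorentz (s x / e)\<close> over the whole space, where no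
    boundary terms arise.\<close>
  obtain \<zeta> :: "'a \<Rightarrow> real" where \<zeta>: "\<zeta> \<in> test_functions UNIV" "\<And>x. 0 \<le> \<zeta> x" "\<And>x. x \<in> \<Omega> \<Longrightarrow> \<zeta> x = 1"
  proof (cases "\<Omega> = {}")
    case True
    have "(\<lambda>x::'a. 0::real) \<in> test_functions UNIV" by (rule test_functionsI[of _ "{}"]) auto
    then show ?thesis using that True by blast
  next
    case False
    show ?thesis
    proof (rule indicator_compact_approx[of "closure \<Omega>" UNIV])
      fix \<psi> :: "nat \<Rightarrow> 'a \<Rightarrow> real" and N
      assume "\<And>m. m \<ge> N \<Longrightarrow> \<psi> m \<in> test_functions UNIV" "\<And>m x. 0 \<le> \<psi> m x" "\<And>m x. x \<in> closure \<Omega> \<Longrightarrow> \<psi> m x = 1"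
      then show ?thesis using closure_subset[of \<Omega>] by (intro that[of "\<psi> N"]) auto
    qed (use \<Omega> False in auto)
  qed
  have \<zeta>1: "Ck k \<zeta>" "bdd_supp \<zeta>" for k using test_functionsD[OF \<zeta>(1)] by auto
  have d\<zeta>: "\<zeta> differentiable (at x)" and ds: "s differentiable (at x)" for x using \<zeta>1(1)[of 1] s by auto
  have D\<zeta>c: "continuous_on UNIV (dir_deriv \<nu> \<zeta>)"
  proof -
    have "dir_deriv \<nu> \<zeta> = (\<lambda>x. \<Sum>b\<in>Basis. (\<nu> \<bullet> b) *\<^sub>R dir_deriv b \<zeta> x)" by (intro ext dir_deriv_basis[OF d\<zeta>])
    then show ?thesis using \<zeta>1(1)[of 1] by (auto intro!: continuous_intros)
  qed
  have iD: "integrable lborel (dir_deriv \<nu> \<zeta>)" by (intro integrable_continuous_bdd_supp D\<zeta>c bdd_supp_dir_deriv \<zeta>1)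
  \<comment> \<open>After integration by parts the derivative falls on \<open>\<zeta>\<close>, and
    \<open>pi/2\<close> bounds \<open>arctan\<close>; both are independent of
    \<open>e\<close>.\<close>
  define C where "C = (pi/2) * (\<integral>x. \<bar>dir_deriv \<nu> \<zeta> x\<bar> \<partial>lborel)"
  show ?thesis
  proof
    show "C \<ge> 0" by (simp add: C_def)
    fix e :: real assume e: "e > 0"
    have sc: "continuous_on UNIV s" by (rule Ck_continuous[OF s])
    have lc: "continuous_on UNIV (\<lambda>x. lorentz (s x / e))"
      unfolding lorentz_def using sc e by (intro continuous_intros) auto
    have ac: "continuous_on UNIV (\<lambda>x. arctan (s x / e))" using sc e by (intro continuous_intros) auto
    have se: "(\<lambda>x. s x / e) differentiable (at x)" for x using ds by (simp add: divide_inverse)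
    have der: "(arctan has_real_derivative lorentz t) (at t)" for t
      using DERIV_arctan[of t] by (simp add: lorentz_def inverse_eq_divide)
    have dA: "(\<lambda>x. arctan (s x / e)) differentiable (at x)" for x by (rule differentiable_chain_real[OF der se])
    have DA: "dir_deriv b (\<lambda>x. arctan (s x / e)) x = lorentz (s x / e) * ((1/e) * dir_deriv b s x)" for b x
      using dir_deriv_chain_real[OF der se] dir_deriv_cmult[OF ds, of b "1/e"] by simp
    have A1: "Ck 1 (\<lambda>x. arctan (s x / e))"
      using dA s lc e by (auto simp: DA[abs_def] intro!: continuous_intros)
    have pb: "Ck 1 (\<lambda>x. \<zeta> x * arctan (s x / e))" by (intro Ck_mult \<zeta>1 A1)
    have ps: "bdd_supp (\<lambda>x. \<zeta> x * arctan (s x / e))" using bdd_supp_scaleR1[OF \<zeta>1(2), of "\<lambda>x. arctan (s x / e)"] by simp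
    have D: "dir_deriv \<nu> (\<lambda>x. \<zeta> x * arctan (s x / e)) x = (1/e) * (\<zeta> x * lorentz (s x / e)) + dir_deriv \<nu> \<zeta> x * arctan (s x / e)" for x
      unfolding dir_deriv_mult[OF d\<zeta> dA] DA \<nu> by simp
    have i1: "integrable lborel (\<lambda>x. \<zeta> x * lorentz (s x / e))"
      using bdd_supp_scaleR1[OF \<zeta>1(2), of "\<lambda>x. lorentz (s x / e)"] Ck_continuous[OF \<zeta>1(1)[of 0], of UNIV]
      by (intro integrable_continuous_bdd_supp continuous_on_mult lc) auto
    have i2: "integrable lborel (\<lambda>x. dir_deriv \<nu> \<zeta> x * arctan (s x / e))"
      using bdd_supp_scaleR1[OF bdd_supp_dir_deriv[OF \<zeta>1(2)], of \<nu> "\<lambda>x. arctan (s x / e)"]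
      by (intro integrable_continuous_bdd_supp continuous_on_mult D\<zeta>c ac) auto
    have "0 = (\<integral>x. dir_deriv \<nu> (\<lambda>x. \<zeta> x * arctan (s x / e)) x \<partial>lborel)"
      by (rule integral_dir_deriv[OF pb ps, symmetric])
    also have "\<dots> = (1/e) * (\<integral>x. \<zeta> x * lorentz (s x / e) \<partial>lborel) + (\<integral>x. dir_deriv \<nu> \<zeta> x * arctan (s x / e) \<partial>lborel)"
      unfolding D using i1 i2 by simp
    finally have "(\<integral>x. \<zeta> x * lorentz (s x / e) \<partial>lborel) = - e * (\<integral>x. dir_deriv \<nu> \<zeta> x * arctan (s x / e) \<partial>lborel)"
      using e by (simp add: field_simps)
    also have "\<dots> \<le> e * norm (\<integral>x. dir_deriv \<nu> \<zeta> x * arctan (s x / e) \<partial>lborel)"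
      using e by (simp add: abs_if)
    also have "norm (\<integral>x. dir_deriv \<nu> \<zeta> x * arctan (s x / e) \<partial>lborel) \<le> (\<integral>x. (pi/2) * \<bar>dir_deriv \<nu> \<zeta> x\<bar> \<partial>lborel)"
    proof (rule Bochner_Integration.integral_norm_bound_integral[OF i2])
      fix x
      have "\<bar>arctan (s x / e)\<bar> \<le> pi/2" using arctan_lbound[of "s x / e"] arctan_ubound[of "s x / e"] by linarith
      then show "norm (dir_deriv \<nu> \<zeta> x * arctan (s x / e)) \<le> (pi/2) * \<bar>dir_deriv \<nu> \<zeta> x\<bar>"
        using mult_right_mono[OF _ abs_ge_zero[of "dir_deriv \<nu> \<zeta> x"]]
        by (fastforce simp: abs_mult mult.commute)
    qed (use iD in simp)
    also have "\<dots> = C" by (simp add: C_def)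
    finally have 1: "(\<integral>x. \<zeta> x * lorentz (s x / e) \<partial>lborel) \<le> C * e" using e by (simp add: mult.commute)
    have "integral\<^sup>L (lebesgue_on \<Omega>) (\<lambda>x. lorentz (s x / e)) = integral\<^sup>L lebesgue (\<lambda>x. indicator \<Omega> x *\<^sub>R lorentz (s x / e))"
      using \<Omega>(1) by (intro integral_restrict_space) auto
    also have "\<dots> \<le> integral\<^sup>L lebesgue (\<lambda>x. \<zeta> x * lorentz (s x / e))"
    proof (rule integral_mono)
      show "integrable lebesgue (\<lambda>x. indicator \<Omega> x *\<^sub>R lorentz (s x / e))"
        using integrable_continuous_lebesgue_on[OF \<Omega> lc] \<Omega>(1) by (subst (asm) integrable_restrict_space) auto
      show "integrable lebesgue (\<lambda>x. \<zeta> x * lorentz (s x / e))"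
        using i1 by (subst integrable_completion) auto
      show "indicator \<Omega> x *\<^sub>R lorentz (s x / e) \<le> \<zeta> x * lorentz (s x / e)" for x
        using \<zeta>(2,3)[of x] lorentz_range[of "s x / e"] by (auto simp: indicator_def)
    qed
    also have "\<dots> = (\<integral>x. \<zeta> x * lorentz (s x / e) \<partial>lborel)"
      using i1 by (intro integral_completion) auto
    finally show "integral\<^sup>L (lebesgue_on \<Omega>) (\<lambda>x. lorentz (s x / e)) \<le> C * e" using 1 by simp
  qed
qed

text \<open>The telescoping form of a partition of unity: the sum is 1 wherever some
  \<open>\<beta> z\<close> is 1, with no division by the sum of all cutoffs, which vanishes away
  from the boundary. Each summand keeps the factor \<open>\<beta> z\<close> and with it the support
  in one chart.\<close>

lemma product_partition:
  fixes \<beta> :: "'z \<Rightarrow> 'a::euclidean_space \<Rightarrow> real"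
  assumes "finite F" "\<And>z k. z \<in> F \<Longrightarrow> Ck k (\<beta> z)"
  shows "\<exists>h. (\<forall>z\<in>F. \<forall>k. Ck k (h z)) \<and> (\<forall>y. (\<Sum>z\<in>F. \<beta> z y * h z y) = 1 - (\<Prod>z\<in>F. 1 - \<beta> z y))"
  using assms
proof (induction F rule: finite_induct)
  case (insert a F)
  have "\<exists>h. (\<forall>z\<in>F. \<forall>k. Ck k (h z)) \<and> (\<forall>y. (\<Sum>z\<in>F. \<beta> z y * h z y) = 1 - (\<Prod>z\<in>F. 1 - \<beta> z y))"
    by (rule insert.IH) (rule insert.prems, simp)
  then obtain h where h: "\<forall>z\<in>F. \<forall>k. Ck k (h z)"
    and eq: "\<forall>y. (\<Sum>z\<in>F. \<beta> z y * h z y) = 1 - (\<Prod>z\<in>F. 1 - \<beta> z y)" by blast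
  define h' where "h' z = (if z = a then (\<lambda>y. 1) else (\<lambda>y. h z y * (1 - \<beta> a y)))" for z
  have "Ck k (h' z)" if "z \<in> insert a F" for z k
    using that h insert.prems by (auto simp: h'_def intro!: Ck_mult Ck_diff)
  moreover have "(\<Sum>z\<in>insert a F. \<beta> z y * h' z y) = 1 - (\<Prod>z\<in>insert a F. 1 - \<beta> z y)" for y
  proof -
    have "(\<Sum>z\<in>F. \<beta> z y * h' z y) = (\<Sum>z\<in>F. \<beta> z y * h z y) * (1 - \<beta> a y)"
      unfolding sum_distrib_right using insert.hyps by (intro sum.cong) (auto simp: h'_def)
    then show ?thesis using insert.hyps by (simp add: eq h'_def algebra_simps)
  qed
  ultimately show ?case by blast
qed simp

text \<open>Take \<open>s x = x \<bullet> \<nu> - \<gamma> x\<close>. Both terms are defined on the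
  whole space, and \<open>\<gamma>\<close> is constant along \<open>\<nu>\<close>, so the derivative
  of \<open>s\<close> along \<open>\<nu>\<close> is 1 everywhere. In particular the gradient of
  \<open>s\<close> never vanishes.\<close>

lemma boundary_chart:
  fixes \<Omega> :: "'a::euclidean_space set"
  assumes \<Omega>: "open \<Omega>" "Ck_boundary k \<Omega>" and k: "k \<ge> 1" and x0: "x0 \<in> frontier \<Omega>"
  obtains r \<nu> and s :: "'a \<Rightarrow> real" where "r > 0" "Ck k s" "\<And>x. dir_deriv \<nu> s x = 1"
    "\<And>y. y \<in> frontier \<Omega> \<Longrightarrow> y \<in> ball x0 r \<Longrightarrow> s y = 0"
proof -
  obtain r \<nu> and \<gamma> :: "'a \<Rightarrow> real" where r: "r > 0" and \<nu>: "norm \<nu> = 1" and \<gamma>: "Ck k \<gamma>" "\<And>x t. \<gamma> (x + t *\<^sub>R \<nu>) = \<gamma> x"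
    and eq: "\<Omega> \<inter> ball x0 r = {x \<in> ball x0 r. \<gamma> x < x \<bullet> \<nu>}"
    using \<Omega>(2) x0 unfolding Ck_boundary_def by meson
  have mem: "x \<in> \<Omega> \<longleftrightarrow> \<gamma> x < x \<bullet> \<nu>" if "x \<in> ball x0 r" for x
  proof -
    have "x \<in> \<Omega> \<inter> ball x0 r \<longleftrightarrow> x \<in> {x \<in> ball x0 r. \<gamma> x < x \<bullet> \<nu>}" by (simp only: eq)
    then show ?thesis using that by blast
  qed
  define s where "s x = x \<bullet> \<nu> - \<gamma> x" for x
  have lin: "bounded_linear (\<lambda>x. x \<bullet> \<nu>)" by (rule bounded_linear_inner_left)
  have s: "Ck k s" unfolding s_def[abs_def] by (intro Ck_diff Ck_linear lin \<gamma>)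
  have d\<gamma>: "\<gamma> differentiable (at x)" and dl: "(\<lambda>x. x \<bullet> \<nu>) differentiable (at x)" for x
    using Ck_differentiable[OF \<gamma>(1) k] Ck_differentiable[OF Ck_linear[OF lin] k] by auto
  have D\<gamma>: "dir_deriv \<nu> \<gamma> x = 0" for x
  proof -
    have "((\<lambda>t. \<gamma> (x + t *\<^sub>R \<nu>)) has_derivative (\<lambda>h. dir_deriv (h *\<^sub>R \<nu>) \<gamma> x)) (at (0::real))"
    proof -
      have "((\<gamma> \<circ> (\<lambda>t. x + t *\<^sub>R \<nu>)) has_derivative ((\<lambda>v. dir_deriv v \<gamma> (x + 0 *\<^sub>R \<nu>)) \<circ> (\<lambda>h. h *\<^sub>R \<nu>))) (at (0::real))"
        using d\<gamma> by (intro diff_chain_at has_derivative_dir_deriv) (auto intro!: derivative_eq_intros)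
      then show ?thesis by (simp add: o_def)
    qed
    moreover have "((\<lambda>t. \<gamma> (x + t *\<^sub>R \<nu>)) has_derivative (\<lambda>h. 0)) (at (0::real))" by (simp add: \<gamma>(2))
    ultimately have "(\<lambda>h. dir_deriv (h *\<^sub>R \<nu>) \<gamma> x) = (\<lambda>h. 0)" by (rule has_derivative_unique)
    from fun_cong[OF this, of 1] show ?thesis by simp
  qed
  have "dir_deriv \<nu> s x = 1" for x
    unfolding s_def[abs_def] dir_deriv_diff[OF dl d\<gamma>] D\<gamma> dir_deriv_linear[OF lin]
    using \<nu> by (simp add: dot_square_norm)
  moreover have "s y = 0" if y: "y \<in> frontier \<Omega>" "y \<in> ball x0 r" for y
  proof (rule antisym)
    have "y \<notin> \<Omega>" using y(1) \<Omega>(1) by (auto simp: frontier_def interior_open)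
    then show "s y \<le> 0" using mem[OF y(2)] by (simp add: s_def)
    show "0 \<le> s y"
    proof (rule ccontr)
      assume "\<not> 0 \<le> s y"
      \<comment> \<open>Inside the ball the set where \<open>s\<close> is negative is open and
        misses the domain, so it contains no point of the closure.\<close>
      define S where "S = {x. s x < 0} \<inter> ball x0 r"
      have "open S" unfolding S_def using Ck_continuous[OF s, of UNIV]
        by (intro open_Int open_ball open_Collect_less continuous_intros) auto
      moreover have "y \<in> S" using \<open>\<not> 0 \<le> s y\<close> y(2) by (simp add: S_def)
      moreover have "S \<inter> \<Omega> = {}" using mem by (fastforce simp: S_def s_def)
      ultimately show False using y(1) open_Int_closure_eq_empty[of S \<Omega>] by (auto simp: frontier_def)
    qed
  qed
  ultimately show ?thesis using that[OF r s] by blast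
qed

text \<open>The derivative budget: \<open>s\<close> is C^4, so its squared gradient and the weights
  \<open>w\<close> are C^3, and so is \<open>a e\<close>. The Laplacian takes two more derivatives
  and leaves the stream function of the right-hand side C^1, enough for a continuous field.\<close>

lemma layer_stream_function:
  fixes \<Omega> :: "(real^'n) set"
  assumes \<Omega>: "open \<Omega>" "bounded \<Omega>" and bd: "Ck_boundary 4 \<Omega>"
  obtains C and a :: "real \<Rightarrow> real^'n \<Rightarrow> real" where "C \<ge> 0"
    "\<And>e. 0 < e \<Longrightarrow> Ck 3 (a e)" "\<And>e. 0 < e \<Longrightarrow> bdd_supp (a e)"
    "\<And>e z. 0 < e \<Longrightarrow> z \<in> frontier \<Omega> \<Longrightarrow> a e z = 0"
    "\<And>e z b. 0 < e \<Longrightarrow> z \<in> frontier \<Omega> \<Longrightarrow> b \<in> Basis \<Longrightarrow> dir_deriv b (a e) z = 0"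
    "\<And>e z. 0 < e \<Longrightarrow> z \<in> frontier \<Omega> \<Longrightarrow> lap (a e) z = z $ i2"
    "\<And>e. 0 < e \<Longrightarrow> e \<le> 1 \<Longrightarrow>
      (L2_norm \<Omega> (cvec (perp i1 i2 (\<lambda>x. (1/e\<^sup>2) * a e x - lap (a e) x + x $ i2))))\<^sup>2 \<le> C / e"
proof -
  have "\<exists>r \<nu>. \<exists>s :: real^'n \<Rightarrow> real. r > 0 \<and> Ck 4 s \<and> (\<forall>x. dir_deriv \<nu> s x = 1) \<and> (\<forall>y\<in>frontier \<Omega> \<inter> ball z r. s y = 0)" if "z \<in> frontier \<Omega>" for z
  proof (rule boundary_chart[OF \<Omega>(1) bd _ that])
    fix r \<nu> and s :: "real^'n \<Rightarrow> real"
    assume "r > 0" "Ck 4 s" "\<And>x. dir_deriv \<nu> s x = 1" "\<And>y. y \<in> frontier \<Omega> \<Longrightarrow> y \<in> ball z r \<Longrightarrow> s y = 0"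
    then have "r > 0 \<and> Ck 4 s \<and> (\<forall>x. dir_deriv \<nu> s x = 1) \<and> (\<forall>y\<in>frontier \<Omega> \<inter> ball z r. s y = 0)" by auto
    then show ?thesis by blast
  qed simp
  then obtain r \<nu> and s :: "real^'n \<Rightarrow> real^'n \<Rightarrow> real" where r: "\<And>z. z \<in> frontier \<Omega> \<Longrightarrow> r z > 0"
    and s: "\<And>z. z \<in> frontier \<Omega> \<Longrightarrow> Ck 4 (s z)" and \<nu>: "\<And>z x. z \<in> frontier \<Omega> \<Longrightarrow> dir_deriv (\<nu> z) (s z) x = 1"
    and s0: "\<And>z y. z \<in> frontier \<Omega> \<Longrightarrow> y \<in> frontier \<Omega> \<Longrightarrow> y \<in> ball z (r z) \<Longrightarrow> s z y = 0"
    by (metis IntI)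
  have cpt: "compact (frontier \<Omega>)" using \<Omega>(2) by (rule compact_frontier_bounded)
  \<comment> \<open>Half the chart radius, so that a cutoff equal to 1 on the covering ball can
    still have its support inside the chart.\<close>
  have "frontier \<Omega> \<subseteq> (\<Union>z\<in>frontier \<Omega>. ball z (r z / 2))" using r by force
  from compactE_image[OF cpt open_ball this]
  obtain F where F: "F \<subseteq> frontier \<Omega>" "finite F" "frontier \<Omega> \<subseteq> (\<Union>z\<in>F. ball z (r z / 2))"
    by blast
  have Ff: "z \<in> frontier \<Omega>" if "z \<in> F" for z using F(1) that by auto
  have "\<exists>\<beta>\<in>test_functions (ball z (r z)). \<forall>y\<in>cball z (r z / 2). \<beta> y = (1::real)" if "z \<in> F" for z
  proof (rule indicator_compact_approx[of "cball z (r z / 2)" "ball z (r z)"])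
    fix \<psi> :: "nat \<Rightarrow> real^'n \<Rightarrow> real" and N
    assume "\<And>m. m \<ge> N \<Longrightarrow> \<psi> m \<in> test_functions (ball z (r z))" "\<And>m x. x \<in> cball z (r z / 2) \<Longrightarrow> \<psi> m x = 1"
    then show ?thesis by (intro bexI[of _ "\<psi> N"]) auto
  qed (use r[OF Ff[OF that]] in auto)
  then obtain \<beta> :: "real^'n \<Rightarrow> real^'n \<Rightarrow> real" where \<beta>: "\<And>z. z \<in> F \<Longrightarrow> \<beta> z \<in> test_functions (ball z (r z))"
    "\<And>z y. z \<in> F \<Longrightarrow> y \<in> cball z (r z / 2) \<Longrightarrow> \<beta> z y = 1" by metis
  obtain h where h: "\<And>z k. z \<in> F \<Longrightarrow> Ck k (h z)" and hs: "\<And>y. (\<Sum>z\<in>F. \<beta> z y * h z y) = 1 - (\<Prod>z\<in>F. 1 - \<beta> z y)"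
    using product_partition[OF F(2), of \<beta>] test_functionsD(1)[OF \<beta>(1)] by blast
  have part: "(\<Sum>z\<in>F. \<beta> z y * h z y) = 1" if y: "y \<in> frontier \<Omega>" for y
  proof -
    obtain z where z: "z \<in> F" "y \<in> ball z (r z / 2)" using subsetD[OF F(3) y] by blast
    then have "1 - \<beta> z y = 0" using \<beta>(2)[OF z(1), of y] by auto
    then have "(\<Prod>z\<in>F. 1 - \<beta> z y) = 0" using F(2) z(1) by (intro prod_zero) auto
    then show ?thesis by (simp add: hs)
  qed
  \<comment> \<open>The squared gradient of \<open>s\<close>, which the Laplacian of a layer
    produces on the boundary; the weight is divided by it in advance.\<close>
  define G where "G z x = (\<Sum>i\<in>UNIV. (dir_deriv (axis i 1) (s z) x)\<^sup>2)" for z x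
  have ds: "s z differentiable (at x)" if "z \<in> F" for z x using Ck_differentiable[OF s[OF Ff[OF that]]] by simp
  have G0: "G z x \<noteq> 0" if "z \<in> F" for z x
  proof
    assume "G z x = 0"
    then have "dir_deriv (axis i 1) (s z) x = 0" for i
      by (simp add: G_def sum_nonneg_eq_0_iff)
    then have "dir_deriv b (s z) x = 0" if "b \<in> Basis" for b using that by (auto simp: Basis_vec_def)
    then have "dir_deriv (\<nu> z) (s z) x = 0" by (subst dir_deriv_basis[OF ds[OF that]]) simp
    then show False using \<nu>[OF Ff[OF that]] by simp
  qed
  have GC: "Ck 3 (G z)" if "z \<in> F" for z
  proof -
    have "Ck 3 (dir_deriv (axis i 1) (s z))" for i using s[OF Ff[OF that]] by (simp add: eval_nat_numeral)
    then show ?thesis unfolding G_def[abs_def] power2_eq_square by (intro Ck_sum Ck_mult)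
  qed
  \<comment> \<open>Chosen so that on the boundary the Laplacian of the layer is the share
    \<open>\<beta> z x * h z x\<close> of \<open>x $ i2\<close>; by \<open>part\<close> the shares
    add up to 1.\<close>
  define w where "w z x = \<beta> z x * (h z x * x $ i2 * inverse (G z x))" for z x
  have w: "Ck 3 (w z)" if "z \<in> F" for z
    unfolding w_def[abs_def] using that by (intro Ck_mult Ck_inverse h test_functionsD(1)[OF \<beta>(1)] Ck_nth GC G0)
  have w2: "Ck 2 (w z)" and s2: "Ck 2 (s z)" and s1: "Ck 1 (s z)" if "z \<in> F" for z
    by (rule Ck_mono[OF w[OF that]], simp, (rule Ck_mono[OF s[OF Ff[OF that]]], simp)+)
  define a where "a e x = (\<Sum>z\<in>F. layer (w z) (s z) e x)" for e x
  have a_eq: "a e = (\<lambda>x. \<Sum>z\<in>F. layer (w z) (s z) e x)" for e by (simp add: a_def[abs_def])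
  have l3: "Ck 3 (layer (w z) (s z) e)" if "z \<in> F" for z e
    using that by (intro Ck_layer w Ck_mono[OF s[OF Ff]]) auto
  have dl: "layer (w z) (s z) e differentiable (at x)" if "z \<in> F" for z e x
    by (rule Ck_differentiable[OF l3[OF that]]) simp
  have a3: "Ck 3 (a e)" for e unfolding a_eq by (intro Ck_sum l3)
  have Da: "dir_deriv b (a e) = (\<lambda>x. \<Sum>z\<in>F. dir_deriv b (layer (w z) (s z) e) x)" for b e
    unfolding a_eq using dl by (intro ext dir_deriv_sum)
  have lapa: "lap (a e) x = (\<Sum>z\<in>F. lap (layer (w z) (s z) e) x)" for e x
  proof -
    have "dir_deriv b (layer (w z) (s z) e) differentiable (at x)" if "z \<in> F" "b \<in> Basis" for z b
      using l3[OF that(1), of e] that(2) by (simp add: eval_nat_numeral)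
    then have "dir_deriv (axis i 1) (dir_deriv (axis i 1) (a e)) x = (\<Sum>z\<in>F. dir_deriv (axis i 1) (dir_deriv (axis i 1) (layer (w z) (s z) e)) x)" for i
      unfolding Da by (intro dir_deriv_sum) auto
    then show ?thesis by (simp add: lap_def) (rule sum.swap)
  qed
  have front: "layer (w z) (s z) e y = 0" "b \<in> Basis \<Longrightarrow> dir_deriv b (layer (w z) (s z) e) y = 0"
    "lap (layer (w z) (s z) e) y = (\<beta> z y * h z y) * y $ i2" if z: "z \<in> F" and y: "y \<in> frontier \<Omega>" and e: "0 < e" for z y e b
  proof -
    define S where "S = - closure {x. \<beta> z x \<noteq> 0}"
    have S: "open S" "\<And>x. x \<in> S \<Longrightarrow> \<beta> z x = 0" using closure_subset[of "{x. \<beta> z x \<noteq> 0}"] by (auto simp: S_def)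
    have "layer (w z) (s z) e y = 0 \<and> (b \<in> Basis \<longrightarrow> dir_deriv b (layer (w z) (s z) e) y = 0) \<and>
      lap (layer (w z) (s z) e) y = (\<beta> z y * h z y) * y $ i2"
    \<comment> \<open>Outside its own chart \<open>s z\<close> may be nonzero on the frontier, but
      there the weight vanishes on a whole neighbourhood, and so do all derivatives of the
      layer.\<close>
    proof (cases "y \<in> S")
      case True
      have "w z x = 0" if "x \<in> S" for x using S(2)[OF that] by (simp add: w_def)
      from layer_off_support[OF S(1) True this] show ?thesis using S(2)[OF True] by simp
    next
      case False
      then have "y \<in> ball z (r z)" using \<beta>(1)[OF z] by (auto simp: test_functions_def S_def)
      then have "s z y = 0" by (rule s0[OF Ff[OF z] y])
      note L = layer_at_zero[OF w2[OF z] s2[OF z] _ this, of e]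
      have "w z y * (\<Sum>i\<in>UNIV. (dir_deriv (axis i 1) (s z) y)\<^sup>2) = (\<beta> z y * h z y) * y $ i2"
        using G0[OF z, of y] by (simp add: w_def flip: G_def)
      then show ?thesis using L e by auto
    qed
    then show "layer (w z) (s z) e y = 0" "b \<in> Basis \<Longrightarrow> dir_deriv b (layer (w z) (s z) e) y = 0"
      "lap (layer (w z) (s z) e) y = (\<beta> z y * h z y) * y $ i2" by auto
  qed
  define Q where "Q z M \<longleftrightarrow> (\<forall>e b x. 0 < e \<longrightarrow> e \<le> 1 \<longrightarrow> b \<in> Basis \<longrightarrow> x \<in> \<Omega> \<longrightarrow>
      \<bar>dir_deriv b (\<lambda>x. (1/e\<^sup>2) * layer (w z) (s z) e x - lap (layer (w z) (s z) e) x) x\<bar> \<le> M * (1 + lorentz (s z x / e) / e))" for z M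
  have "\<exists>M\<ge>0. Q z M" if "z \<in> F" for z
    unfolding Q_def by (rule layer_bound[OF w[OF that] s[OF Ff[OF that]] \<Omega>(2)]) blast
  then obtain M where M': "\<And>z. z \<in> F \<Longrightarrow> M z \<ge> 0" "\<And>z. z \<in> F \<Longrightarrow> Q z (M z)" by metis
  have M: "\<bar>dir_deriv b (\<lambda>x. (1/e\<^sup>2) * layer (w z) (s z) e x - lap (layer (w z) (s z) e) x) x\<bar> \<le> M z * (1 + lorentz (s z x / e) / e)"
    if "z \<in> F" "0 < e" "e \<le> 1" "b \<in> Basis" "x \<in> \<Omega>" for z e b x
    using M'(2)[OF that(1)] that(2-) unfolding Q_def by blast
  have "\<exists>C\<ge>0. \<forall>e>0. integral\<^sup>L (lebesgue_on \<Omega>) (\<lambda>x. lorentz (s z x / e)) \<le> C * e" if "z \<in> F" for z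
    by (rule layer_integral[OF \<Omega> s1[OF that] \<nu>[OF Ff[OF that]]]) blast
  then obtain C where C: "\<And>z. z \<in> F \<Longrightarrow> C z \<ge> 0" "\<And>z e. z \<in> F \<Longrightarrow> e > 0 \<Longrightarrow> integral\<^sup>L (lebesgue_on \<Omega>) (\<lambda>x. lorentz (s z x / e)) \<le> C z * e"
    by metis
  define n where "n = real CARD('n)"
  \<comment> \<open>The summand 1 bounds the derivative of \<open>x $ i2\<close>; the rest collects
    the bounded parts of all layers.\<close>
  define A where "A = 1 + (\<Sum>z\<in>F. M z)"
  define \<mu> where "\<mu> = measure (lebesgue_on \<Omega>) \<Omega>"
  define K where "K = n\<^sup>2 * (2 * A\<^sup>2 * \<mu> + 2 * card F * (\<Sum>z\<in>F. (M z)\<^sup>2 * C z))"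
  interpret finite_measure "lebesgue_on \<Omega>" using finite_lebesgue_on \<Omega> by blast
  have K0: "K \<ge> 0" unfolding K_def \<mu>_def using C(1) by (intro mult_nonneg_nonneg add_nonneg_nonneg sum_nonneg) auto
  show ?thesis
  proof (rule that[OF K0, of a])
    fix e :: real assume e: "0 < e"
    show "Ck 3 (a e)" by (rule a3)
    show "bdd_supp (a e)"
    proof -
      have "\<exists>R. \<forall>x. R < norm x \<longrightarrow> \<beta> z x = 0" if "z \<in> F" for z
        using test_functionsD(3)[OF \<beta>(1)[OF that]] by (simp add: bdd_supp_def)
      then obtain R where R: "\<And>z x. z \<in> F \<Longrightarrow> R z < norm x \<Longrightarrow> \<beta> z x = 0" by metis
      have "a e x = 0" if "(\<Sum>z\<in>F. \<bar>R z\<bar>) < norm x" for x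
      proof -
        have "\<beta> z x = 0" if z: "z \<in> F" for z
        proof (rule R[OF z])
          have "\<bar>R z\<bar> \<le> (\<Sum>z\<in>F. \<bar>R z\<bar>)" using z F(2) by (intro member_le_sum) auto
          then show "R z < norm x" using \<open>(\<Sum>z\<in>F. \<bar>R z\<bar>) < norm x\<close> by linarith
        qed
        then show ?thesis by (simp add: a_def layer_def w_def)
      qed
      then show ?thesis unfolding bdd_supp_def by blast
    qed
    show "a e y = 0" if "y \<in> frontier \<Omega>" for y using front(1)[OF _ that e] by (simp add: a_def)
    show "dir_deriv b (a e) y = 0" if "y \<in> frontier \<Omega>" "b \<in> Basis" for y b
      using front(2)[OF _ that(1) e that(2)] by (simp add: Da)
    show "lap (a e) y = y $ i2" if y: "y \<in> frontier \<Omega>" for y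
      using front(3)[OF _ y e] part[OF y] by (simp add: lapa flip: sum_distrib_right)
    assume e1: "e \<le> 1"
    define c where "c x = (1/e\<^sup>2) * a e x - lap (a e) x + x $ i2" for x
    let ?k = "\<lambda>z x. (1/e\<^sup>2) * layer (w z) (s z) e x - lap (layer (w z) (s z) e) x"
    have c_eq: "c = (\<lambda>x. (\<Sum>z\<in>F. ?k z x) + x $ i2)"
      unfolding c_def[abs_def] by (simp add: a_def lapa sum_subtractf sum_distrib_left sum_divide_distrib)
    have k1: "Ck 1 (?k z)" if "z \<in> F" for z
      using l3[OF that, of e] by (intro Ck_diff Ck_cmult Ck_lap Ck_mono[OF l3[OF that]]) (simp_all add: eval_nat_numeral)
    have c1: "Ck 1 c" unfolding c_eq by (intro Ck_add Ck_sum k1 Ck_nth)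
    have dk: "?k z differentiable (at x)" if "z \<in> F" for z x by (rule Ck_differentiable[OF k1[OF that]]) simp
    have Dc: "dir_deriv b c x = (\<Sum>z\<in>F. dir_deriv b (?k z) x) + b $ i2" for b x
    proof -
      have 1: "(\<lambda>x. \<Sum>z\<in>F. ?k z x) differentiable (at x)"
        by (rule Ck_differentiable[of 1]) (intro Ck_sum k1, assumption, simp)
      have 2: "(\<lambda>x::real^'n. x $ i2) differentiable (at x)" by (rule Ck_differentiable[OF Ck_nth[of 1]]) simp
      show ?thesis unfolding c_eq dir_deriv_add[OF 1 2] dir_deriv_nth
        using dk by (subst dir_deriv_sum) auto
    qed
    define q where "q z x = lorentz (s z x / e)" for z x
    have q: "0 \<le> q z x" "q z x \<le> 1" for z x using lorentz_range[of "s z x / e"] by (auto simp: q_def)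
    have qc: "continuous_on UNIV (q z)" if "z \<in> F" for z
      unfolding q_def[abs_def] lorentz_def using Ck_continuous[OF s1[OF that], of UNIV] e by (intro continuous_intros) auto
    define T where "T x = (\<Sum>z\<in>F. M z * q z x)" for x
    have T0: "T x \<ge> 0" for x unfolding T_def using M'(1) q by (intro sum_nonneg) auto
    have bound: "\<bar>dir_deriv b c x\<bar> \<le> A + T x / e" if "b \<in> Basis" "x \<in> \<Omega>" for b x
    proof -
      have "\<bar>b $ i2\<bar> \<le> 1" using component_le_norm_cart[of b i2] that(1) by simp
      moreover have "\<bar>\<Sum>z\<in>F. dir_deriv b (?k z) x\<bar> \<le> (\<Sum>z\<in>F. M z * (1 + q z x / e))"
        unfolding q_def by (rule order_trans[OF sum_abs], rule sum_mono) (rule M[OF _ e e1 that])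
      ultimately have "\<bar>dir_deriv b c x\<bar> \<le> (\<Sum>z\<in>F. M z * (1 + q z x / e)) + 1" unfolding Dc by linarith
      also have "\<dots> = A + T x / e"
        by (simp add: A_def T_def distrib_left sum.distrib sum_divide_distrib)
      finally show ?thesis .
    qed
    have pb: "\<bar>perp i1 i2 c j x\<bar> \<le> A + T x / e" if "x \<in> \<Omega>" for j x
    proof -
      have "0 \<le> A + T x / e" using bound[of "axis i1 1" x] that by simp
      then show ?thesis using bound[of "axis i1 1" x] bound[of "axis i2 1" x] that by (auto simp: perp_def)
    qed
    \<comment> \<open>Squaring gives the factor \<open>1/e\<^sup>2\<close>, and \<open>q\<close>
      between 0 and 1 lets its square be replaced by \<open>q\<close> itself. The integral of
      \<open>q\<close> is of order \<open>e\<close>, which leaves the order \<open>1/e\<close> in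
      the end.\<close>
    have sq: "(norm (cvec (perp i1 i2 c) x))\<^sup>2 \<le> n\<^sup>2 * (2 * A\<^sup>2 + 2 * card F / e\<^sup>2 * (\<Sum>z\<in>F. (M z)\<^sup>2 * q z x))" if x: "x \<in> \<Omega>" for x
    proof -
      have "norm (cvec (perp i1 i2 c) x) \<le> n * (A + T x / e)" unfolding n_def by (rule norm_cvec_le) (rule pb[OF x])
      then have "(norm (cvec (perp i1 i2 c) x))\<^sup>2 \<le> (n * (A + T x / e))\<^sup>2" by (intro power_mono) auto
      also have "\<dots> = n\<^sup>2 * (A + T x / e)\<^sup>2" by (rule power_mult_distrib)
      also have "\<dots> \<le> n\<^sup>2 * (2 * A\<^sup>2 + 2 * (T x / e)\<^sup>2)"
        using sum_squares_bound[of A "T x / e"] by (intro mult_left_mono) (auto simp: power2_sum)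
      also have "(T x / e)\<^sup>2 = (T x)\<^sup>2 / e\<^sup>2" by (rule power_divide)
      also have "(T x)\<^sup>2 \<le> card F * (\<Sum>z\<in>F. (M z)\<^sup>2 * q z x)"
      proof -
        have "(T x)\<^sup>2 \<le> (\<Sum>z\<in>F. (M z * q z x)\<^sup>2) * card F" unfolding T_def by (rule sum_squared_le_sum_of_squares)
        also have "\<dots> \<le> (\<Sum>z\<in>F. (M z)\<^sup>2 * q z x) * card F"
        proof (intro mult_right_mono sum_mono)
          fix z
          have "(q z x)\<^sup>2 \<le> q z x" using q[of z x] by (simp add: power2_eq_square mult_left_le)
          then show "(M z * q z x)\<^sup>2 \<le> (M z)\<^sup>2 * q z x" by (simp add: power_mult_distrib mult_left_mono)
        qed auto
        finally show ?thesis by (simp add: mult.commute)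
      qed
      finally show ?thesis
        using e by (simp add: divide_right_mono mult_left_mono mult.assoc)
    qed
    have cc: "continuous_on UNIV (cvec (perp i1 i2 c))" using c1 by (intro Ck_continuous[of 0] Ck_cvec Ck_perp) simp
    have iq: "integrable (lebesgue_on \<Omega>) (q z)" if "z \<in> F" for z by (rule integrable_continuous_lebesgue_on[OF \<Omega> qc[OF that]])
    have iS: "integrable (lebesgue_on \<Omega>) (\<lambda>x. \<Sum>z\<in>F. (M z)\<^sup>2 * q z x)"
      using iq by (intro Bochner_Integration.integrable_sum integrable_mult_right)
    have "(L2_norm \<Omega> (cvec (perp i1 i2 c)))\<^sup>2 = integral\<^sup>L (lebesgue_on \<Omega>) (\<lambda>x. (norm (cvec (perp i1 i2 c) x))\<^sup>2)"
      by (simp add: L2_norm_def)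
    also have "\<dots> \<le> integral\<^sup>L (lebesgue_on \<Omega>) (\<lambda>x. n\<^sup>2 * (2 * A\<^sup>2 + 2 * card F / e\<^sup>2 * (\<Sum>z\<in>F. (M z)\<^sup>2 * q z x)))"
    proof (rule integral_mono)
      show "integrable (lebesgue_on \<Omega>) (\<lambda>x. (norm (cvec (perp i1 i2 c) x))\<^sup>2)"
        using continuous_L2[OF \<Omega> cc] by (simp add: L2_def)
      show "integrable (lebesgue_on \<Omega>) (\<lambda>x. n\<^sup>2 * (2 * A\<^sup>2 + 2 * card F / e\<^sup>2 * (\<Sum>z\<in>F. (M z)\<^sup>2 * q z x)))"
        using iS by simp
    qed (use sq in auto)
    also have "\<dots> = n\<^sup>2 * (2 * A\<^sup>2 * \<mu> + 2 * card F / e\<^sup>2 * (\<Sum>z\<in>F. (M z)\<^sup>2 * integral\<^sup>L (lebesgue_on \<Omega>) (q z)))"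
      using iS iq by (simp add: \<mu>_def)
    also have "\<dots> \<le> n\<^sup>2 * (2 * A\<^sup>2 * \<mu> / e + 2 * card F / e\<^sup>2 * (\<Sum>z\<in>F. (M z)\<^sup>2 * (C z * e)))"
    proof (intro mult_left_mono add_mono sum_mono)
      have "2 * A\<^sup>2 * \<mu> * 1 \<le> 2 * A\<^sup>2 * \<mu> * (1 / e)" using e e1 by (intro mult_left_mono) (auto simp: \<mu>_def)
      then show "2 * A\<^sup>2 * \<mu> \<le> 2 * A\<^sup>2 * \<mu> / e" by simp
      show "integral\<^sup>L (lebesgue_on \<Omega>) (q z) \<le> C z * e" if "z \<in> F" for z unfolding q_def[abs_def] by (rule C(2)[OF that e])
    qed auto
    also have "\<dots> = K / e"
    proof -
      have "(\<Sum>z\<in>F. (M z)\<^sup>2 * (C z * e)) = (\<Sum>z\<in>F. (M z)\<^sup>2 * C z) * e" by (simp add: sum_distrib_right mult.assoc)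
      then show ?thesis using e by (simp add: K_def power2_eq_square field_simps)
    qed
    finally show "(L2_norm \<Omega> (cvec (perp i1 i2 (\<lambda>x. (1/e\<^sup>2) * a e x - lap (a e) x + x $ i2))))\<^sup>2 \<le> K / e"
      by (simp add: c_def[abs_def])
  qed
qed

section \<open>The pressure and the choice of the resolvent parameter\<close>

lemma linear_pressure:
  fixes \<Omega> :: "(real^'n) set"
  assumes \<Omega>: "open \<Omega>" "bounded \<Omega>" "\<Omega> \<noteq> {}"
  obtains m where "(\<lambda>x. complex_of_real (x $ i - m)) \<in> L2_zero \<Omega>" "L2_norm \<Omega> (\<lambda>x. complex_of_real (x $ i - m)) > 0"
proof -
  interpret finite_measure "lebesgue_on \<Omega>" using finite_lebesgue_on \<Omega> by blast
  have null: "emeasure lebesgue S \<noteq> 0" if "open S" "S \<noteq> {}" for S :: "(real^'n) set"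
    using open_not_negligible[OF that] that(1) by (auto simp: negligible_iff_null_sets null_sets_def)
  define \<mu> where "\<mu> = measure (lebesgue_on \<Omega>) \<Omega>"
  have "emeasure (lebesgue_on \<Omega>) \<Omega> \<noteq> 0" using null[OF \<Omega>(1,3)] \<Omega>(1) by (simp add: emeasure_restrict_space)
  then have \<mu>: "\<mu> > 0" using emeasure_eq_measure[of \<Omega>] by (simp add: \<mu>_def zero_less_measure_iff)
  have cx: "continuous_on UNIV (\<lambda>x::real^'n. x $ i)" by (intro continuous_intros)
  have ix: "integrable (lebesgue_on \<Omega>) (\<lambda>x. x $ i)" by (rule integrable_continuous_lebesgue_on[OF \<Omega>(1,2) cx])
  \<comment> \<open>The mean value of the coordinate over the domain, so that the pressure has mean
    zero.\<close>
  define m where "m = integral\<^sup>L (lebesgue_on \<Omega>) (\<lambda>x. x $ i) / \<mu>"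
  let ?p = "\<lambda>x. complex_of_real (x $ i - m)"
  have cp: "continuous_on UNIV ?p" by (intro continuous_intros)
  have pL: "?p \<in> L2 \<Omega>" by (rule continuous_L2[OF \<Omega>(1,2) cp])
  have "integral\<^sup>L (lebesgue_on \<Omega>) (\<lambda>x. x $ i - m) = 0"
    using ix \<mu> by (simp add: m_def \<mu>_def)
  then have "integral\<^sup>L (lebesgue_on \<Omega>) ?p = 0"
    by (subst integral_complex_of_real) simp
  then have 1: "?p \<in> L2_zero \<Omega>" using pL by (simp add: L2_zero_def)
  have "L2_norm \<Omega> ?p > 0"
  proof (rule ccontr)
    assume "\<not> L2_norm \<Omega> ?p > 0"
    moreover have i2: "integrable (lebesgue_on \<Omega>) (\<lambda>x. (norm (?p x))\<^sup>2)" using pL by (simp add: L2_def)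
    ultimately have "integral\<^sup>L (lebesgue_on \<Omega>) (\<lambda>x. (norm (?p x))\<^sup>2) = 0"
      by (simp add: L2_norm_def order.antisym)
    then have "AE x in lebesgue_on \<Omega>. (norm (?p x))\<^sup>2 = 0"
      using integral_nonneg_eq_0_iff_AE[OF i2] by simp
    \<comment> \<open>The domain without a hyperplane: open, and nonempty because a ball inside the
      domain contains two points with different \<open>i\<close>-th coordinates. A nonempty open set
      is not null, so the pressure cannot vanish almost everywhere.\<close>
    define S where "S = \<Omega> \<inter> {x. x $ i \<noteq> m}"
    have S: "open S" unfolding S_def using \<Omega>(1) cx by (intro open_Int open_Collect_neq) auto
    obtain x0 where x0: "x0 \<in> \<Omega>" using \<Omega>(3) by auto
    then obtain d where d: "d > 0" "ball x0 d \<subseteq> \<Omega>" using \<Omega>(1) by (auto simp: open_contains_ball)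
    have "x0 + (d/2) *\<^sub>R axis i 1 \<in> \<Omega>" using d by (intro subsetD[OF d(2)]) (auto simp: dist_norm norm_axis_1)
    moreover have "(x0 + (d/2) *\<^sub>R axis i 1) $ i = x0 $ i + d/2" by simp
    ultimately have "S \<noteq> {}" using x0 d(1) unfolding S_def by (cases "x0 $ i = m") auto
    have "AE x in lebesgue_on \<Omega>. x \<notin> S"
      using \<open>AE x in lebesgue_on \<Omega>. (norm (?p x))\<^sup>2 = 0\<close> by eventually_elim (auto simp: S_def)
    moreover have "S \<in> sets (lebesgue_on \<Omega>)"
      using S \<Omega>(1) by (subst sets_restrict_space_iff) (auto simp: S_def)
    ultimately have "emeasure (lebesgue_on \<Omega>) S = 0"
      by (subst (asm) AE_iff_measurable[where N=S]) (auto simp: S_def)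
    then have "emeasure lebesgue S = 0" using \<Omega>(1) by (subst (asm) emeasure_restrict_space) (auto simp: S_def)
    then show False using null[OF S \<open>S \<noteq> {}\<close>] by simp
  qed
  then show ?thesis using that 1 by blast
qed

theorem proposition3p4:
  fixes \<Omega> :: "(real^'n) set" and \<theta> \<alpha> :: real
  assumes "CARD('n) \<ge> 2"
    and "domain \<Omega>" and "bounded \<Omega>" and "Ck_boundary 4 \<Omega>"
    and "pi / 2 < \<theta>" and "\<theta> < pi"
    and "\<alpha> > 1 / 4"
  shows "\<forall>n::nat. \<exists>f\<in>L2_sigma \<Omega>. \<exists>lam\<in>sector \<theta>. cmod lam \<ge> 1 \<and>
           (\<exists>p. associated_pressure \<Omega> lam f p \<and>
                cmod lam powr \<alpha> * L2_norm \<Omega> p > real n * L2_norm \<Omega> f)"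
proof
  fix n :: nat
  have \<Omega>: "open \<Omega>" "bounded \<Omega>" "\<Omega> \<noteq> {}" using assms by (auto simp: domain_def)
  have "\<theta> > 0" using assms(5) pi_gt_zero by linarith
  obtain i1 i2 :: 'n where i: "i1 \<noteq> i2"
    using assms(1) by (metis card_2_iff' card_le_Suc0_iff_eq finite_class.finite_UNIV iso_tuple_UNIV_I not_less_eq_eq numeral_2_eq_2)
  show "\<exists>f\<in>L2_sigma \<Omega>. \<exists>lam\<in>sector \<theta>. cmod lam \<ge> 1 \<and>
      (\<exists>p. associated_pressure \<Omega> lam f p \<and> cmod lam powr \<alpha> * L2_norm \<Omega> p > real n * L2_norm \<Omega> f)"
  proof (rule layer_stream_function[OF \<Omega>(1,2) assms(4), of i2 i1])
    fix C and a :: "real \<Rightarrow> real^'n \<Rightarrow> real"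
    assume C: "C \<ge> 0" and a: "\<And>e. 0 < e \<Longrightarrow> Ck 3 (a e)" "\<And>e. 0 < e \<Longrightarrow> bdd_supp (a e)"
      "\<And>e z. 0 < e \<Longrightarrow> z \<in> frontier \<Omega> \<Longrightarrow> a e z = 0"
      "\<And>e z b. 0 < e \<Longrightarrow> z \<in> frontier \<Omega> \<Longrightarrow> b \<in> Basis \<Longrightarrow> dir_deriv b (a e) z = 0"
      "\<And>e z. 0 < e \<Longrightarrow> z \<in> frontier \<Omega> \<Longrightarrow> lap (a e) z = z $ i2"
      and bound: "\<And>e. 0 < e \<Longrightarrow> e \<le> 1 \<Longrightarrow>
        (L2_norm \<Omega> (cvec (perp i1 i2 (\<lambda>x. (1/e\<^sup>2) * a e x - lap (a e) x + x $ i2))))\<^sup>2 \<le> C / e"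
    obtain m where p: "(\<lambda>x. complex_of_real (x $ i1 - m)) \<in> L2_zero \<Omega>" "L2_norm \<Omega> (\<lambda>x. complex_of_real (x $ i1 - m)) > 0"
      using linear_pressure[OF \<Omega>, of i1] by blast
    define P where "P = L2_norm \<Omega> (\<lambda>x. complex_of_real (x $ i1 - m))"
    have P: "P > 0" using p(2) by (simp add: P_def)
    define \<delta> where "\<delta> = \<alpha> - 1/4"
    have \<delta>: "\<delta> > 0" using assms(7) by (simp add: \<delta>_def)
    \<comment> \<open>The resolvent parameter \<lambda>, taken real. Adding 1 inside the power makes
      the inequality \<open>t2\<close> strict, and the maximum with 1 gives both |\<lambda>| \<ge> 1
      and \<open>e \<le> 1\<close>.\<close>
    define t where "t = max 1 ((real n * sqrt C / P + 1) powr (1/\<delta>))"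
    have t1: "t \<ge> 1" by (simp add: t_def)
    have b0: "real n * sqrt C / P + 1 > 0" using P C by (simp add: add_nonneg_pos)
    have "real n * sqrt C / P < real n * sqrt C / P + 1" by simp
    also have "\<dots> = ((real n * sqrt C / P + 1) powr (1/\<delta>)) powr \<delta>" using \<delta> b0 by (simp add: powr_powr)
    also have "\<dots> \<le> t powr \<delta>" using \<delta> by (intro powr_mono2) (auto simp: t_def)
    finally have t2: "real n * sqrt C < t powr \<delta> * P" using P by (simp add: divide_less_eq)
    define e where "e = t powr (-(1/2))"
    have e: "0 < e" "e \<le> 1" using t1 powr_mono[of "-(1/2)" 0 t] by (auto simp: e_def)
    have et: "1 / e\<^sup>2 = t" using t1 by (simp add: e_def powr_minus divide_simps flip: powr_numeral) (simp add: powr_powr)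
    have et2: "1 / e = t powr (1/2)" using t1 by (simp add: e_def powr_minus divide_simps)
    let ?c = "\<lambda>x. t * a e x - lap (a e) x + x $ i2"
    let ?f = "cvec (perp i1 i2 ?c)"
    have f: "?f \<in> L2_sigma \<Omega>" "associated_pressure \<Omega> (of_real t) ?f (\<lambda>x. complex_of_real (x $ i1 - m))"
      using stream_function_solution[OF \<Omega>(1,2) i a(1)[OF e(1)] a(2)[OF e(1)] a(3)[OF e(1)] a(4)[OF e(1)] a(5)[OF e(1)] refl p(1)]
      by auto
    have "(L2_norm \<Omega> ?f)\<^sup>2 \<le> C * t powr (1/2)" using bound[OF e] unfolding et by (simp add: et2[symmetric])
    then have "L2_norm \<Omega> ?f \<le> sqrt (C * t powr (1/2))" by (rule real_le_rsqrt)
    also have "\<dots> = sqrt C * t powr (1/4)" using t1 by (simp add: real_sqrt_mult powr_half_sqrt[symmetric] powr_powr)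
    finally have "real n * L2_norm \<Omega> ?f \<le> real n * (sqrt C * t powr (1/4))" by (intro mult_left_mono) auto
    also have "\<dots> = (real n * sqrt C) * t powr (1/4)" by simp
    also have "\<dots> < (t powr \<delta> * P) * t powr (1/4)" using t2 t1 by (intro mult_strict_right_mono) auto
    also have "\<dots> = t powr \<alpha> * P" by (simp add: \<delta>_def flip: powr_add)
    finally have "real n * L2_norm \<Omega> ?f < t powr \<alpha> * P" .
    \<comment> \<open>A positive real number has argument 0 and lies in every sector of positive
      angle.\<close>
    moreover have "complex_of_real t \<in> sector \<theta>" using t1 \<open>\<theta> > 0\<close> by (simp add: sector_def Arg_of_real)
    moreover have "cmod (complex_of_real t) = t" using t1 by simp
    ultimately show ?thesis using f t1 unfolding P_def by (intro bexI[of _ ?f] bexI[of _ "complex_of_real t"] conjI exI) auto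
  qed
qed

end
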